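(* Let $T$ be a real, non-singular $d\times d$ matrix, regarded as a transformation of the torus $\mathbb{T}^d$. Suppose that $T$ is diagonal with all eigenvalues $\beta_i>1$ and $1<\beta_1\le\beta_2\le\dots\le\beta_d$. Let $\{f_n\}_{n\ge1}$ be a sequence of vector-valued functions $f_n:\mathbb{T}^d\to\mathbb{T}^d$ with a uniform Lipschitz constant, i.e. there is $c>0$ with $|f_n(\mathbf{x})-f_n(\mathbf{y})|\le c|\mathbf{x}-\mathbf{y}|$ for all $n\in\mathbb{N}$ and $\mathbf{x},\mathbf{y}\in\mathbb{T}^d$. Let $\Psi=(\psi_1,\dots,\psi_d)$ with $\psi_i:\mathbb{N}\to\mathbb{R}^+$, and let $\mathcal{C}(\Psi)$ be the set of accumulation points $\mathbf{t}=(t_1,\dots,t_d)$ of the sequence $\big\{\big(\frac{-\log\psi_1(n)}{n},\dots,\frac{-\log\psi_d(n)}{n}\big)\big\}_{n\ge1}$. If $\mathcal{C}(\Psi)$ is bounded, then $$\dim_{\mathrm H}W(T,\Psi,\{f_n\})=\sup_{\mathbf{t}\in\mathcal{C}(\Psi)}\ \min_{1\le i\le d}\{\lambda_i(\mathbf{t})\},$$ where $$\lambda_i(\mathbf{t}):=\sum_{j\in\mathcal{Q}_i^1}1+\sum_{j\in\mathcal{Q}_i^2}\Big(1-\frac{t_j}{\log\beta_i+t_i}\Big)+\sum_{j\in\mathcal{Q}_i^3}\frac{\log\beta_j}{\log\beta_i+t_i}$$ and $$\mathcal{Q}_i^1:=\{1\le j\le d:\log\beta_j>\log\beta_i+t_i\},\qquad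 \mathcal{Q}_i^2:=\{1\le j\le d:\log\beta_j+t_j\le\log\beta_i+t_i\},$$ $$\mathcal{Q}_i^3:=\{1,\dots,d\}\setminus(\mathcal{Q}_i^1\cup\mathcal{Q}_i^2).$$
   Context: $\mathbb{T}^d=\mathbb{R}^d/\mathbb{Z}^d$; $|\cdot|$ denotes the usual metric on $\mathbb{T}$ (distance of the difference to the nearest integer) and also the metric on $\mathbb{T}^d$ induced by the Euclidean metric. A real matrix $T$ acts on $\mathbb{T}^d$ (identified with $[0,1)^d$) by $\mathbf{x}\mapsto T\mathbf{x}\ (\mathrm{mod}\ 1)$ and $T^n$ is the $n$-th iterate of this map. For $\mathbf{y}\in\mathbb{T}^d$ and $\Psi(n)=(\psi_1(n),\dots,\psi_d(n))$, let $L(\mathbf{y},\Psi(n))=\{\mathbf{x}\in\mathbb{T}^d:|x_i-y_i|<\psi_i(n)\text{ for all }1\le i\le d\}$. Define $$W(T,\Psi,\{f_n\})=\{\mathbf{x}\in\mathbb{T}^d:T^n(\mathbf{x})\in L(f_n(\mathbf{x}),\Psi(n))\text{ for infinitely many }n\in\mathbb{N}\}.$$ $\mathbb{R}^+$ is the set of positive reals and $\dim_{\mathrm H}$ is Hausdorff dimension.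
   Formalization: All accumulation points t are assumed to have coordinates t_i ≥ 0 (the formula fails for exponentially growing ψ_i), and accumulation points are taken in [-∞,∞]^d, so "C(Ψ) bounded" also excludes exponents tending to infinity along a subsequence. *)

theory Defs
  imports "HOL-Analysis.Analysis"
begin

section \<open>Hausdorff dimension\<close>

text \<open>The metric is an explicit parameter: the torus below is a subset of \<open>real ^ 'd\<close> whose metric is
  not the \<open>dist\<close> of that type.\<close>

definition diam_wrt :: "('a \<Rightarrow> 'a \<Rightarrow> real) \<Rightarrow> 'a set \<Rightarrow> real" where
  "diam_wrt d U = (if U = {} then 0 else (SUP (x, y)\<in>U \<times> U. d x y))"

text \<open>Since \<open>0 powr 0 = 0\<close> in HOL, the case \<open>s = 0\<close> is separated, so that every nonempty set
  contributes 1 to the 0-dimensional (counting) measure and the empty set contributes 0.\<close>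

definition hausdorff_weight :: "('a \<Rightarrow> 'a \<Rightarrow> real) \<Rightarrow> real \<Rightarrow> 'a set \<Rightarrow> ennreal" where
  "hausdorff_weight d s U =
     (if U = {} then 0 else if s = 0 then 1 else ennreal (diam_wrt d U powr s))"

definition hausdorff_pre :: "'a set \<Rightarrow> ('a \<Rightarrow> 'a \<Rightarrow> real) \<Rightarrow> real \<Rightarrow> real \<Rightarrow> 'a set \<Rightarrow> ennreal" where
  "hausdorff_pre M d s \<delta> A =
     (INF U \<in> {U :: nat \<Rightarrow> 'a set. A \<subseteq> (\<Union>k. U k) \<and>
                 (\<forall>k. U k \<subseteq> M \<and> (\<forall>x\<in>U k. \<forall>y\<in>U k. d x y \<le> \<delta>))}.
        (\<Sum>k. hausdorff_weight d s (U k)))"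

definition hausdorff_measure :: "'a set \<Rightarrow> ('a \<Rightarrow> 'a \<Rightarrow> real) \<Rightarrow> real \<Rightarrow> 'a set \<Rightarrow> ennreal" where
  "hausdorff_measure M d s A = (SUP \<delta>\<in>{0<..}. hausdorff_pre M d s \<delta> A)"

definition hausdorff_dim :: "'a set \<Rightarrow> ('a \<Rightarrow> 'a \<Rightarrow> real) \<Rightarrow> 'a set \<Rightarrow> ereal" where
  "hausdorff_dim M d A = Inf {ereal s | s. 0 \<le> s \<and> hausdorff_measure M d s A = 0}"

section \<open>The torus and matrix transformations\<close>

definition torus :: "(real ^ 'd) set" where
  "torus = {x. \<forall>i. 0 \<le> x $ i \<and> x $ i < 1}"

definition circle_dist :: "real \<Rightarrow> real \<Rightarrow> real" where
  "circle_dist a b = infdist (a - b) \<int>"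

definition torus_dist :: "real ^ 'd \<Rightarrow> real ^ 'd \<Rightarrow> real" where
  "torus_dist x y = infdist (x - y) {z. \<forall>i. z $ i \<in> \<int>}"

definition torus_map :: "real ^ 'd ^ 'd \<Rightarrow> real ^ 'd \<Rightarrow> real ^ 'd" where
  "torus_map T x = (\<chi> i. frac ((T *v x) $ i))"

definition target_box :: "real ^ 'd \<Rightarrow> real ^ 'd \<Rightarrow> (real ^ 'd) set" where
  "target_box y r = {x \<in> torus. \<forall>i. circle_dist (x $ i) (y $ i) < r $ i}"

definition W_set :: "real ^ 'd ^ 'd \<Rightarrow> (nat \<Rightarrow> real ^ 'd) \<Rightarrow>
    (nat \<Rightarrow> real ^ 'd \<Rightarrow> real ^ 'd) \<Rightarrow> (real ^ 'd) set" where
  "W_set T \<Psi> f =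
     {x \<in> torus. infinite {n. 1 \<le> n \<and> (torus_map T ^^ n) x \<in> target_box (f n x) (\<Psi> n)}}"

section \<open>Accumulation points and the dimension numbers\<close>

text \<open>Accumulation points of a sequence, i.e. limits of subsequences (a value taken infinitely often
  counts).\<close>

definition accumulation_points :: "(nat \<Rightarrow> 'a :: topological_space) \<Rightarrow> 'a set" where
  "accumulation_points s = {l. \<exists>r. strict_mono r \<and> (\<lambda>n. s (r n)) \<longlonglongrightarrow> l}"

definition ereal_vec :: "real ^ 'd \<Rightarrow> ereal ^ 'd" where
  "ereal_vec t = (\<chi> i. ereal (t $ i))"

text \<open>Accumulation points are taken in the product of extended real lines, so that coordinates
  escaping to infinity along a subsequence are seen. In particular, this set lies in a bounded subset
  of \<open>real ^ 'd\<close> only if the sequence itself is bounded. The irrelevant term \<open>n = 0\<close> is junk.\<close>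

definition C_set :: "(nat \<Rightarrow> real ^ 'd) \<Rightarrow> (ereal ^ 'd) set" where
  "C_set \<Psi> = accumulation_points (\<lambda>n. ereal_vec (\<chi> i. - ln (\<Psi> n $ i) / real n))"

definition Q1 :: "('d \<Rightarrow> real) \<Rightarrow> real ^ 'd \<Rightarrow> 'd \<Rightarrow> 'd set" where
  "Q1 \<beta> t i = {j. ln (\<beta> j) > ln (\<beta> i) + t $ i}"

definition Q2 :: "('d \<Rightarrow> real) \<Rightarrow> real ^ 'd \<Rightarrow> 'd \<Rightarrow> 'd set" where
  "Q2 \<beta> t i = {j. ln (\<beta> j) + t $ j \<le> ln (\<beta> i) + t $ i}"

definition Q3 :: "('d \<Rightarrow> real) \<Rightarrow> real ^ 'd \<Rightarrow> 'd \<Rightarrow> 'd set" where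
  "Q3 \<beta> t i = UNIV - (Q1 \<beta> t i \<union> Q2 \<beta> t i)"

definition lam :: "('d :: finite \<Rightarrow> real) \<Rightarrow> real ^ 'd \<Rightarrow> 'd \<Rightarrow> real" where
  "lam \<beta> t i =
     (\<Sum>j\<in>Q1 \<beta> t i. 1)
     + (\<Sum>j\<in>Q2 \<beta> t i. 1 - t $ j / (ln (\<beta> i) + t $ i))
     + (\<Sum>j\<in>Q3 \<beta> t i. ln (\<beta> j) / (ln (\<beta> i) + t $ i))"

end

theory Submission
  imports Defs
begin

text \<open>Covering at scale \<open>exp (- n A)\<close> the set hit at time \<open>n\<close> costs about
  \<open>exp (n * (\<Sum>j. \<Phi> (ln (\<beta> j)) (t j) A))\<close> cubes, and the ratio of this exponent to \<open>A\<close> is smallest at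
  one of the points \<open>A = ln (\<beta> i) + t i\<close>, where it equals \<open>lam \<beta> t i\<close>. This gives the upper bound.
  For the lower bound, full cylinders of the one-dimensional beta transformations equidistribute
  up to constants. In a product of such cylinders the solutions form a box sheared by the moving
  target, found as fixed points of a contraction. Nesting these boxes, each filled with a grid of
  tiny cubes, yields a Cantor set whose uniform mass distribution satisfies
  \<open>\<mu> (ball x \<rho>) \<le> K * \<rho> powr s\<close>, because the above covering numbers are sharp at all scales.\<close>

section \<open>Cylinders of the beta transformation\<close>

text \<open>For non-integer \<beta> cylinders need not be full, so neither the number of branches
  nor equidistribution is immediate. Both rest on one decomposition: at time n every point lies in
  the rightmost remnant of a full cylinder of some order m <= n. Summing over m bounds the number of
  branches, and comparing lengths gives full cylinders a positive density in every interval. The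
  targets depend on the point, but within a branch a displacement is magnified by \<beta>^n while
  the target moves at most c times as far. For large n the motion is therefore a small perturbation
  in both bounds. In the upper bound the best scale A depends on n; compactness of the extended real
  line makes the gain in the exponent uniform. In the lower bound, refining cubes of side \<sigma>
  loses a factor \<sigma>^(-d), because a cube holds only its share of the cylinders. One constant K
  still serves all levels because s is strictly below the attainable exponent s0: each new side is
  taken so small that the number of cubes then present pays for the loss in the next step.\<close>

definition btrans :: "real \<Rightarrow> real \<Rightarrow> real" where
  "btrans \<beta> x = frac (\<beta> * x)"

text \<open>Cylinders are recorded by their left end points, so that counting them means counting
  separated reals and no symbolic coding is needed. Full means that the iterate maps the interval
  onto all of [0, 1).\<close>

definition full_cyl :: "real \<Rightarrow> nat \<Rightarrow> real set" where
  "full_cyl \<beta> n = {z. 0 \<le> z \<and> z + 1 / \<beta> ^ n \<le> 1 \<and>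
     (\<forall>x. z \<le> x \<and> x < z + 1 / \<beta> ^ n \<longrightarrow> (btrans \<beta> ^^ n) x = \<beta> ^ n * (x - z))}"

text \<open>The left endpoint of the rightmost cylinder of order \<open>n\<close>.\<close>

fun tail_pt :: "real \<Rightarrow> nat \<Rightarrow> real" where
  "tail_pt \<beta> 0 = 0"
| "tail_pt \<beta> (Suc q) =
     tail_pt \<beta> q + (of_int \<lceil>\<beta> * (\<beta> ^ q * (1 - tail_pt \<beta> q))\<rceil> - 1) / \<beta> ^ Suc q"

lemma btrans_range: "0 \<le> btrans \<beta> x" "btrans \<beta> x < 1"
  by (auto simp: btrans_def frac_lt_1)

lemma btrans_funpow_range:
  assumes "0 \<le> x" "x < 1"
  shows "0 \<le> (btrans \<beta> ^^ n) x" "(btrans \<beta> ^^ n) x < 1"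
  using assms by (cases n; simp add: btrans_range)+

lemma frac_shift: "of_int e \<le> (u::real) \<Longrightarrow> u < of_int e + 1 \<Longrightarrow> frac u = u - of_int e"
  by (simp add: frac_def floor_eq_iff)

lemma full_cylD:
  assumes "z \<in> full_cyl \<beta> n" "z \<le> x" "x < z + 1 / \<beta> ^ n"
  shows "(btrans \<beta> ^^ n) x = \<beta> ^ n * (x - z)"
  using assms by (auto simp: full_cyl_def)

lemma full_cyl_zero: "0 \<in> full_cyl \<beta> 0"
  by (simp add: full_cyl_def)

context
  fixes \<beta> :: real
  assumes \<beta>: "1 < \<beta>"
begin

text \<open>The leftmost child keeps the left end point, and it is full again because \<beta> > 1
  leaves room for a complete first branch. Hence the number of full cylinders inside a fixed
  interval cannot decrease with the order.\<close>

lemma full_cyl_Suc: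
  assumes "z \<in> full_cyl \<beta> n"
  shows "z \<in> full_cyl \<beta> (Suc n)"
proof -
  have le: "1 / \<beta> ^ Suc n \<le> 1 / \<beta> ^ n"
    using \<beta> by (intro divide_left_mono) auto
  have "(btrans \<beta> ^^ Suc n) x = \<beta> ^ Suc n * (x - z)"
    if "z \<le> x" "x < z + 1 / \<beta> ^ Suc n" for x
  proof -
    have "(btrans \<beta> ^^ n) x = \<beta> ^ n * (x - z)"
      using full_cylD[OF assms] that le by simp
    moreover have "\<beta> ^ Suc n * (x - z) < 1"
      using that(2) \<beta> by (simp add: field_simps)
    moreover have "0 \<le> \<beta> ^ Suc n * (x - z)"
      using that(1) \<beta> by simp
    ultimately show ?thesis
      by (simp add: btrans_def frac_eq mult.assoc)
  qed
  then show ?thesis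
    using assms le unfolding full_cyl_def by auto
qed

lemma full_cyl_mono: "m \<le> n \<Longrightarrow> z \<in> full_cyl \<beta> m \<Longrightarrow> z \<in> full_cyl \<beta> n"
  by (induction rule: dec_induct) (auto intro: full_cyl_Suc)

text \<open>If two of the half-open intervals overlapped, the larger left end point would satisfy
  both affine formulas, which have the same slope but different zeros.\<close>

lemma full_cyl_separated:
  assumes "z \<in> full_cyl \<beta> n" "z' \<in> full_cyl \<beta> n" "z \<noteq> z'"
  shows "1 / \<beta> ^ n \<le> \<bar>z - z'\<bar>"
proof -
  have *: "u + 1 / \<beta> ^ n \<le> v" if "u \<in> full_cyl \<beta> n" "v \<in> full_cyl \<beta> n" "u < v" for u v
  proof (rule ccontr)
    assume "\<not> ?thesis"
    then have "\<beta> ^ n * (v - u) = \<beta> ^ n * (v - v)"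
      using full_cylD[OF that(1), of v] full_cylD[OF that(2), of v] \<beta> that by simp
    then show False using \<beta> that by simp
  qed
  show ?thesis
    using *[OF assms(1,2)] *[OF assms(2,1)] assms(3) by linarith
qed

text \<open>After \<open>q\<close> iterates the rightmost interval has become [0, a) with a =
  \<beta>^q (1 - \<open>tail_pt \<beta> q\<close>) and 0 < a <= 1. The induction multiplies this by
  \<beta> and keeps the last branch.\<close>

lemma tail_pt_props:
  "0 \<le> tail_pt \<beta> q" "tail_pt \<beta> q < 1" "\<beta> ^ q * (1 - tail_pt \<beta> q) \<le> 1"
  "\<forall>x. tail_pt \<beta> q \<le> x \<longrightarrow> x < 1 \<longrightarrow> (btrans \<beta> ^^ q) x = \<beta> ^ q * (x - tail_pt \<beta> q)"
proof (induction q)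
  case (Suc q)
  define a where "a = \<beta> ^ q * (1 - tail_pt \<beta> q)"
  \<comment> \<open>The last branch of [0, \<beta> a) starts at the largest integer strictly below
    \<open>\<beta> * a\<close>. With a floor the branch would be empty whenever
    \<open>\<beta> * a\<close> is an integer.\<close>
  define e where "e = \<lceil>\<beta> * a\<rceil> - 1"
  have a: "0 < a" "a \<le> 1"
    using Suc(2,3) \<beta> by (auto simp: a_def)
  have e: "of_int e < \<beta> * a" "\<beta> * a \<le> of_int e + 1"
    unfolding e_def by linarith+
  have "0 \<le> e"
    using a \<beta> by (simp add: e_def)
  have t: "tail_pt \<beta> (Suc q) = tail_pt \<beta> q + of_int e / \<beta> ^ Suc q"
    by (simp add: e_def a_def)
  have diff: "\<beta> ^ Suc q * (1 - tail_pt \<beta> (Suc q)) = \<beta> * a - of_int e"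
    unfolding t a_def using \<beta> by (simp add: field_simps)
  show "0 \<le> tail_pt \<beta> (Suc q)"
    unfolding t using Suc(1) \<open>0 \<le> e\<close> \<beta> by simp
  have "0 < \<beta> ^ Suc q * (1 - tail_pt \<beta> (Suc q))"
    using e diff by simp
  then show "tail_pt \<beta> (Suc q) < 1"
    using \<beta> zero_less_mult_pos[of "\<beta> ^ Suc q" "1 - tail_pt \<beta> (Suc q)"] by (simp del: tail_pt.simps)
  show "\<beta> ^ Suc q * (1 - tail_pt \<beta> (Suc q)) \<le> 1"
    using diff e by simp
  show "\<forall>x. tail_pt \<beta> (Suc q) \<le> x \<longrightarrow> x < 1 \<longrightarrow>
    (btrans \<beta> ^^ Suc q) x = \<beta> ^ Suc q * (x - tail_pt \<beta> (Suc q))"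
  proof (intro allI impI)
    fix x assume x: "tail_pt \<beta> (Suc q) \<le> x" "x < 1"
    have "tail_pt \<beta> q \<le> tail_pt \<beta> (Suc q)"
      unfolding t using \<open>0 \<le> e\<close> \<beta> by simp
    then have 1: "(btrans \<beta> ^^ q) x = \<beta> ^ q * (x - tail_pt \<beta> q)"
      using Suc(4) x by simp
    have 2: "\<beta> * (\<beta> ^ q * (x - tail_pt \<beta> q)) = \<beta> ^ Suc q * (x - tail_pt \<beta> (Suc q)) + of_int e"
      unfolding t using \<beta> by (simp add: field_simps)
    have "\<beta> ^ Suc q * (x - tail_pt \<beta> (Suc q)) < \<beta> ^ Suc q * (1 - tail_pt \<beta> (Suc q))"
      using x \<beta> by (intro mult_strict_left_mono) auto
    then have 3: "\<beta> ^ Suc q * (x - tail_pt \<beta> (Suc q)) < 1"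
      using diff e by linarith
    have 4: "0 \<le> \<beta> ^ Suc q * (x - tail_pt \<beta> (Suc q))"
      using x \<beta> by simp
    have "frac (\<beta> * (\<beta> ^ q * (x - tail_pt \<beta> q))) = \<beta> ^ Suc q * (x - tail_pt \<beta> (Suc q))"
      using frac_shift[of e "\<beta> * (\<beta> ^ q * (x - tail_pt \<beta> q))"] 2 3 4 by linarith
    then show "(btrans \<beta> ^^ Suc q) x = \<beta> ^ Suc q * (x - tail_pt \<beta> (Suc q))"
      using 1 by (simp add: btrans_def)
  qed
qed (use \<beta> in auto)

text \<open>The first \<open>m\<close> iterates carry the cylinder onto [0, 1), and the remaining
  \<open>n - m\<close> follow the rightmost branch. Since the image lies in [0, 1), the piece has
  length at most \<open>1 / \<beta> ^ n\<close>.\<close>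

lemma piece_affine:
  assumes z: "z \<in> full_cyl \<beta> m" and "m \<le> n"
    and x: "z + tail_pt \<beta> (n - m) / \<beta> ^ m \<le> x" "x < z + 1 / \<beta> ^ m"
  shows "(btrans \<beta> ^^ n) x = \<beta> ^ n * (x - (z + tail_pt \<beta> (n - m) / \<beta> ^ m))"
    and "x < z + tail_pt \<beta> (n - m) / \<beta> ^ m + 1 / \<beta> ^ n"
proof -
  define q where "q = n - m"
  have n: "n = q + m" using \<open>m \<le> n\<close> by (simp add: q_def)
  have pos: "0 < \<beta> ^ m" "0 < \<beta> ^ q" using \<beta> by auto
  have "z \<le> x"
    using x(1) tail_pt_props(1)[of q] pos by (smt (verit) divide_nonneg_pos q_def)
  then have u: "(btrans \<beta> ^^ m) x = \<beta> ^ m * (x - z)"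
    using full_cylD[OF z] x by simp
  have "tail_pt \<beta> q \<le> \<beta> ^ m * (x - z)" "\<beta> ^ m * (x - z) < 1"
    using x pos \<beta> by (auto simp: q_def field_simps)
  then have "(btrans \<beta> ^^ q) (\<beta> ^ m * (x - z)) = \<beta> ^ q * (\<beta> ^ m * (x - z) - tail_pt \<beta> q)"
    using tail_pt_props(4) by blast
  also have "\<dots> = \<beta> ^ n * (x - (z + tail_pt \<beta> (n - m) / \<beta> ^ m))"
    using pos \<beta> unfolding n by (simp add: field_simps power_add)
  finally show eq: "(btrans \<beta> ^^ n) x = \<beta> ^ n * (x - (z + tail_pt \<beta> (n - m) / \<beta> ^ m))"
    unfolding n funpow_add by (simp add: u)
  have "0 \<le> z" "z + 1 / \<beta> ^ m \<le> 1" using z by (auto simp: full_cyl_def)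
  then have "0 \<le> x" "x < 1"
    using x \<open>z \<le> x\<close> by auto
  then have "\<beta> ^ n * (x - (z + tail_pt \<beta> (n - m) / \<beta> ^ m)) < 1"
    using btrans_funpow_range(2)[of x n \<beta>] eq by simp
  then show "x < z + tail_pt \<beta> (n - m) / \<beta> ^ m + 1 / \<beta> ^ n"
    using \<beta> by (simp add: field_simps)
qed

text \<open>The branch of order \<open>Suc n\<close> containing \<open>x\<close> is either complete,
  and then it is itself a full cylinder of that order, or it is the truncated last branch of its
  piece, and then it prolongs the tail of the same full cylinder of order \<open>m\<close>.\<close>

lemma piece_cover:
  assumes "0 \<le> x" "x < 1"
  shows "\<exists>m\<le>n. \<exists>z\<in>full_cyl \<beta> m. z + tail_pt \<beta> (n - m) / \<beta> ^ m \<le> x \<and> x < z + 1 / \<beta> ^ m"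
proof (induction n)
  case 0
  show ?case using assms full_cyl_zero by (intro exI[of _ 0]) (auto intro!: bexI[of _ 0])
next
  case (Suc n)
  then obtain m z where m: "m \<le> n" and z: "z \<in> full_cyl \<beta> m"
    and x: "z + tail_pt \<beta> (n - m) / \<beta> ^ m \<le> x" "x < z + 1 / \<beta> ^ m"
    by auto
  define q where "q = n - m"
  define w where "w = z + tail_pt \<beta> q / \<beta> ^ m"
  define a where "a = \<beta> ^ q * (1 - tail_pt \<beta> q)"
  define e where "e = \<lfloor>\<beta> ^ Suc n * (x - w)\<rfloor>"
  have n: "n = q + m" using m by (simp add: q_def)
  have pos: "0 < \<beta> ^ m" "0 < \<beta> ^ q" "0 < \<beta> ^ n" "0 < \<beta> ^ Suc n" using \<beta> by auto
  have e: "of_int e \<le> \<beta> ^ Suc n * (x - w)" "\<beta> ^ Suc n * (x - w) < of_int e + 1"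
    unfolding e_def by linarith+
  have "0 \<le> e" unfolding e_def using x pos by (simp add: w_def q_def)
  have end_eq: "\<beta> ^ Suc n * (z + 1 / \<beta> ^ m - w) = \<beta> * a"
    unfolding w_def a_def n using \<beta> by (simp add: field_simps power_add)
  have less: "of_int e < \<beta> * a"
  proof -
    have "\<beta> ^ Suc n * (x - w) < \<beta> ^ Suc n * (z + 1 / \<beta> ^ m - w)"
      using x pos by (intro mult_strict_left_mono) auto
    then show ?thesis using e end_eq by linarith
  qed
  show ?case
  proof (cases "of_int e + 1 \<le> \<beta> * a")
    case True
    define z' where "z' = w + of_int e / \<beta> ^ Suc n"
    have ends: "z' + 1 / \<beta> ^ Suc n \<le> z + 1 / \<beta> ^ m"
    proof -
      have "\<beta> ^ Suc n * (z' + 1 / \<beta> ^ Suc n - w) = of_int e + 1"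
        unfolding z'_def using pos(4) \<beta> by (simp add: field_simps del: power_Suc)
      then have "\<beta> ^ Suc n * (z' + 1 / \<beta> ^ Suc n - w) \<le> \<beta> ^ Suc n * (z + 1 / \<beta> ^ m - w)"
        using True end_eq by linarith
      then show ?thesis using pos(4) by (simp del: power_Suc)
    qed
    have "w \<le> z'" unfolding z'_def using \<open>0 \<le> e\<close> pos by simp
    moreover have "0 \<le> w" "z + 1 / \<beta> ^ m \<le> 1"
      using z tail_pt_props(1)[of q] pos by (auto simp: w_def full_cyl_def)
    moreover have "(btrans \<beta> ^^ Suc n) y = \<beta> ^ Suc n * (y - z')"
      if y: "z' \<le> y" "y < z' + 1 / \<beta> ^ Suc n" for y
    proof -
      have "(btrans \<beta> ^^ n) y = \<beta> ^ n * (y - w)"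
        unfolding w_def q_def
        by (rule piece_affine(1)[OF z m]) (use y \<open>w \<le> z'\<close> ends in \<open>auto simp: w_def q_def\<close>)
      moreover have "\<beta> * (\<beta> ^ n * (y - w)) = \<beta> ^ Suc n * (y - z') + of_int e"
        unfolding z'_def using pos \<beta> by (simp add: field_simps)
      moreover have "\<beta> ^ Suc n * (y - z') < 1"
        using y(2) pos(4) \<beta> by (simp add: field_simps del: power_Suc)
      moreover have "0 \<le> \<beta> ^ Suc n * (y - z')"
        using y(1) pos(4) by simp
      ultimately show ?thesis
        using frac_shift[of e "\<beta> * (\<beta> ^ n * (y - w))"] by (simp add: btrans_def)
    qed
    ultimately have "z' \<in> full_cyl \<beta> (Suc n)"
      unfolding full_cyl_def using ends by auto
    moreover have "z' \<le> x" "x < z' + 1 / \<beta> ^ Suc n"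
      unfolding z'_def using e pos(4) \<beta> by (auto simp: field_simps simp del: power_Suc)
    ultimately show ?thesis by (intro exI[of _ "Suc n"]) auto
  next
    case False
    then have "\<lceil>\<beta> * a\<rceil> = e + 1" using less by (simp add: ceiling_eq_iff)
    then have "z + tail_pt \<beta> (Suc n - m) / \<beta> ^ m = w + of_int e / \<beta> ^ Suc n"
      unfolding w_def n using \<beta> by (simp add: Suc_diff_le a_def field_simps power_add)
    moreover have "w + of_int e / \<beta> ^ Suc n \<le> x"
      using e(1) pos(4) \<beta> by (simp add: field_simps del: power_Suc)
    ultimately show ?thesis using m z x by (intro exI[of _ m] conjI bexI[of _ z]) auto
  qed
qed

end

section \<open>Counting affine branches and full cylinders\<close>

lemma separated_card:
  fixes S :: "real set"
  assumes "0 < \<delta>" "S \<subseteq> {a..b}" "a \<le> b"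
    and sep: "\<And>x y. x \<in> S \<Longrightarrow> y \<in> S \<Longrightarrow> x \<noteq> y \<Longrightarrow> \<delta> \<le> \<bar>x - y\<bar>"
  shows "finite S" "real (card S) \<le> (b - a) / \<delta> + 1"
proof -
  let ?g = "\<lambda>x. \<lfloor>(x - a) / \<delta>\<rfloor>"
  have inj: "inj_on ?g S"
  proof (rule inj_onI, rule ccontr)
    fix x y assume xy: "x \<in> S" "y \<in> S" "?g x = ?g y" "x \<noteq> y"
    then have "\<bar>(x - a) / \<delta> - (y - a) / \<delta>\<bar> < 1" by linarith
    then have "\<bar>x - y\<bar> < \<delta>"
      using \<open>0 < \<delta>\<close> by (simp add: diff_divide_distrib[symmetric] abs_divide)
    then show False using sep[OF xy(1,2,4)] by simp
  qed
  have sub: "?g ` S \<subseteq> {0..\<lfloor>(b - a) / \<delta>\<rfloor>}"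
    using assms(1,2) by (auto 0 3 intro!: floor_mono divide_right_mono divide_nonneg_pos)
  then show "finite S"
    using inj finite_subset[OF sub] finite_imageD by blast
  have "card S \<le> card {0..\<lfloor>(b - a) / \<delta>\<rfloor>}"
    using card_inj_on_le[OF inj sub] by simp
  moreover have "0 \<le> (b - a) / \<delta>" using assms by simp
  ultimately show "real (card S) \<le> (b - a) / \<delta> + 1"
    by simp linarith
qed

context
  fixes \<beta> :: real
  assumes \<beta>: "1 < \<beta>"
begin

lemma full_cyl_card:
  fixes n :: nat and a b :: real
  assumes "a \<le> b"
  defines "S \<equiv> {z \<in> full_cyl \<beta> n. a \<le> z \<and> z + 1 / \<beta> ^ n \<le> b}"
  shows "finite S" "real (card S) \<le> (b - a) * \<beta> ^ n"
proof -
  have pos: "0 < 1 / \<beta> ^ n" using \<beta> by simp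
  have "S \<subseteq> {a..b}" using pos unfolding S_def by (auto simp del: zero_less_divide_1_iff)
  then show "finite S"
    by (rule separated_card(1)[OF pos _ \<open>a \<le> b\<close>])
      (use pos full_cyl_separated[OF \<beta>] in \<open>auto simp: S_def dest: add_pos_nonneg\<close>)
  show "real (card S) \<le> (b - a) * \<beta> ^ n"
  proof (cases "S = {}")
    case False
    \<comment> \<open>Only left end points are counted, and they stay one spacing away from
      \<open>b\<close>. Shortening the interval accordingly cancels the \<open>+ 1\<close> of
      \<open>separated_card\<close>.\<close>
    then have "a \<le> b - 1 / \<beta> ^ n" by (auto simp: S_def)
    then have "real (card S) \<le> (b - 1 / \<beta> ^ n - a) / (1 / \<beta> ^ n) + 1"
      by (intro separated_card(2)[OF pos])
        (use full_cyl_separated[OF \<beta>] in \<open>auto simp: S_def\<close>)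
    also have "\<dots> = (b - a) * \<beta> ^ n" using \<beta> by (simp add: field_simps)
    finally show ?thesis .
  next
    case True
    then have "card S = 0" by simp
    then show ?thesis using assms(1) \<beta> by simp
  qed
qed

lemma full_cyl_finite: "finite (full_cyl \<beta> n)" "real (card (full_cyl \<beta> n)) \<le> \<beta> ^ n"
proof -
  have "full_cyl \<beta> n = {z \<in> full_cyl \<beta> n. 0 \<le> z \<and> z + 1 / \<beta> ^ n \<le> 1}"
    by (auto simp: full_cyl_def)
  then show "finite (full_cyl \<beta> n)" "real (card (full_cyl \<beta> n)) \<le> \<beta> ^ n"
    using full_cyl_card[of 0 1 n] by auto
qed

lemma power_sum_bound: "(\<Sum>m\<le>n. \<beta> ^ m) \<le> \<beta> ^ n * (\<beta> / (\<beta> - 1))"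
proof -
  have "(\<Sum>m\<le>n. \<beta> ^ m) = (\<beta> ^ Suc n - 1) / (\<beta> - 1)"
    using \<beta> geometric_sum[of \<beta> "Suc n"] by (simp add: lessThan_Suc_atMost)
  also have "\<dots> \<le> \<beta> ^ Suc n / (\<beta> - 1)"
    using \<beta> by (intro divide_right_mono) auto
  finally show ?thesis by (simp add: mult.commute)
qed

text \<open>By \<open>piece_cover\<close> a branch is determined by an order \<open>m\<close> and a
  full cylinder of that order. There are at most \<beta>^m of the latter, and the geometric sum over
  \<open>m\<close> costs only the factor \<open>\<beta> / (\<beta> - 1)\<close>.\<close>

lemma branches:
  "\<exists>S. finite S \<and> real (card S) \<le> \<beta> ^ n * (\<beta> / (\<beta> - 1)) \<and>
     (\<forall>x. 0 \<le> x \<and> x < 1 \<longrightarrow> (\<exists>w\<in>S. (btrans \<beta> ^^ n) x = \<beta> ^ n * (x - w)))"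
proof -
  define S where "S = (\<Union>m\<le>n. (\<lambda>z. z + tail_pt \<beta> (n - m) / \<beta> ^ m) ` full_cyl \<beta> m)"
  have "card S \<le> (\<Sum>m\<le>n. card ((\<lambda>z. z + tail_pt \<beta> (n - m) / \<beta> ^ m) ` full_cyl \<beta> m))"
    unfolding S_def by (rule card_UN_le) simp
  also have "\<dots> \<le> (\<Sum>m\<le>n. card (full_cyl \<beta> m))"
    by (intro sum_mono card_image_le full_cyl_finite)
  finally have "real (card S) \<le> (\<Sum>m\<le>n. real (card (full_cyl \<beta> m)))"
    using of_nat_mono by fastforce
  also have "\<dots> \<le> (\<Sum>m\<le>n. \<beta> ^ m)"
    by (intro sum_mono full_cyl_finite)
  also have "\<dots> \<le> \<beta> ^ n * (\<beta> / (\<beta> - 1))" by (rule power_sum_bound)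
  finally have "real (card S) \<le> \<beta> ^ n * (\<beta> / (\<beta> - 1))" .
  moreover have "finite S" unfolding S_def using full_cyl_finite by auto
  moreover have "\<exists>w\<in>S. (btrans \<beta> ^^ n) x = \<beta> ^ n * (x - w)" if x: "0 \<le> x" "x < 1" for x
  proof -
    obtain m z where *: "m \<le> n" "z \<in> full_cyl \<beta> m"
      "z + tail_pt \<beta> (n - m) / \<beta> ^ m \<le> x" "x < z + 1 / \<beta> ^ m"
      using piece_cover[OF \<beta> x, of n] by blast
    show ?thesis
      using piece_affine(1)[OF \<beta> *(2,1,3,4)] *(1,2) unfolding S_def by blast
  qed
  ultimately show ?thesis by blast
qed

text \<open>Pieces of time \<open>n\<close>, each of length at most \<beta>^(-n), cover the middle
  half of the interval. A piece that comes from a full cylinder of order at least \<open>M\<close>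
  has this cylinder inside the whole interval, because the cylinder is no longer than the margin of
  a quarter. Orders below \<open>M\<close> contribute at most \<open>M * \<beta> ^ M\<close>,
  independently of \<open>n\<close>.\<close>

lemma full_cyl_sum_lower:
  assumes ab: "0 \<le> a" "a < b" "b \<le> 1" and M: "1 / \<beta> ^ M \<le> (b - a) / 4"
  defines "N \<equiv> \<lambda>m. card {z \<in> full_cyl \<beta> m. a \<le> z \<and> z + 1 / \<beta> ^ m \<le> b}"
  shows "(b - a) / 2 * \<beta> ^ n \<le> real M * \<beta> ^ M + (\<Sum>m\<le>n. real (N m))"
proof -
  define F where "F = (\<lambda>m. {z \<in> full_cyl \<beta> m. a \<le> z \<and> z + 1 / \<beta> ^ m \<le> b})"
  define G where "G = (\<lambda>m. if m < M then full_cyl \<beta> m else F m)"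
  define w where "w = (\<lambda>m z. z + tail_pt \<beta> (n - m) / \<beta> ^ m)"
  define \<delta> where "\<delta> = (b - a) / 4"
  have finG: "finite (G m)" for m
    using full_cyl_finite full_cyl_card(1)[of a b m] ab by (auto simp: G_def F_def)
  have pos: "0 < \<beta> ^ n" using \<beta> by simp
  have cover: "{a + \<delta>..<b - \<delta>} \<subseteq> (\<Union>m\<le>n. \<Union>z\<in>G m. {w m z..w m z + 1 / \<beta> ^ n})"
  proof
    fix x assume x: "x \<in> {a + \<delta>..<b - \<delta>}"
    then have "a + (b - a) / 4 \<le> x" "x < b - (b - a) / 4" by (auto simp: \<delta>_def)
    then have x01: "0 \<le> x" "x < 1" using ab by argo+
    obtain m z where *: "m \<le> n" "z \<in> full_cyl \<beta> m"
      "z + tail_pt \<beta> (n - m) / \<beta> ^ m \<le> x" "x < z + 1 / \<beta> ^ m"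
      using piece_cover[OF \<beta> x01, of n] by blast
    have "z \<in> G m"
    proof (cases "m < M")
      case False
      have "1 / \<beta> ^ m \<le> 1 / \<beta> ^ M"
        using False \<beta> by (intro divide_left_mono power_increasing) auto
      moreover have "z \<le> x"
        using *(3) tail_pt_props(1)[OF \<beta>, of "n - m"] \<beta>
        by (smt (verit) divide_nonneg_nonneg zero_le_power)
      ultimately show ?thesis
        using * False M \<open>a + (b - a) / 4 \<le> x\<close> \<open>x < b - (b - a) / 4\<close> by (simp add: G_def F_def) argo
    qed (use * in \<open>auto simp: G_def\<close>)
    then show "x \<in> (\<Union>m\<le>n. \<Union>z\<in>G m. {w m z..w m z + 1 / \<beta> ^ n})"
      using piece_affine(2)[OF \<beta> *(2,1,3,4)] * by (fastforce simp: w_def)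
  qed
  have "(b - a) / 2 = measure lborel {a + \<delta>..<b - \<delta>}"
    using ab by (simp add: \<delta>_def field_simps)
  also have "\<dots> \<le> measure lborel (\<Union>m\<le>n. \<Union>z\<in>G m. {w m z..w m z + 1 / \<beta> ^ n})"
    by (rule measure_mono_fmeasurable[OF cover])
      (auto intro!: fmeasurable.finite_UN finG fmeasurable_compact)
  also have "\<dots> \<le> (\<Sum>m\<le>n. measure lborel (\<Union>z\<in>G m. {w m z..w m z + 1 / \<beta> ^ n}))"
    by (intro measure_UNION_le) (auto intro!: sets.finite_UN finG)
  also have "\<dots> \<le> (\<Sum>m\<le>n. \<Sum>z\<in>G m. measure lborel {w m z..w m z + 1 / \<beta> ^ n})"
    by (intro sum_mono measure_UNION_le finG) auto
  also have "\<dots> = (\<Sum>m\<le>n. real (card (G m)) / \<beta> ^ n)"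
    using \<beta> by simp
  finally have "(b - a) / 2 * \<beta> ^ n \<le> (\<Sum>m\<le>n. real (card (G m)))"
    using pos pos_le_divide_eq[OF pos] by (simp add: sum_divide_distrib[symmetric])
  also have "\<dots> \<le> (\<Sum>m\<le>n. (if m < M then \<beta> ^ M else 0) + real (N m))"
  proof (rule sum_mono)
    fix m
    have "real (card (full_cyl \<beta> m)) \<le> \<beta> ^ M" if "m < M"
      using full_cyl_finite(2)[of m] power_increasing[of m M \<beta>] that \<beta> by linarith
    then show "real (card (G m)) \<le> (if m < M then \<beta> ^ M else 0) + real (N m)"
      by (auto simp: G_def N_def F_def add_increasing2)
  qed
  also have "\<dots> \<le> real M * \<beta> ^ M + (\<Sum>m\<le>n. real (N m))"
  proof -
    have "(\<Sum>m\<le>n. if m < M then \<beta> ^ M else 0) = (\<Sum>m\<in>{..n} \<inter> {..<M}. \<beta> ^ M)"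
      by (subst sum.inter_restrict) (auto intro!: sum.cong)
    also have "\<dots> \<le> (\<Sum>m\<in>{..<M}. \<beta> ^ M)"
      using \<beta> by (intro sum_mono2) auto
    finally show ?thesis by (simp add: sum.distrib)
  qed
  finally show ?thesis .
qed

text \<open>The constant \<open>c\<close> does not depend on the interval. Full cylinders of orders \<open>n - k, \<dots>, n\<close> must
  together occupy a fixed proportion of it, and each of them contains one of order \<open>n\<close>.\<close>

lemma full_cyl_count:
  "\<exists>c>0. \<forall>a b. 0 \<le> a \<and> a < b \<and> b \<le> 1 \<longrightarrow>
     (\<exists>n0. \<forall>n\<ge>n0. c * (b - a) * \<beta> ^ n \<le> real (card {z \<in> full_cyl \<beta> n. a \<le> z \<and> z + 1 / \<beta> ^ n \<le> b}))"
proof -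
  \<comment> \<open>With this \<open>k\<close> the orders up to \<open>n - k\<close> account for at
    most (b - a) \<beta>^n / 8 of the available (b - a) \<beta>^n / 4. The other half is shared by
    \<open>k\<close> orders, each with at most as many cylinders as order \<open>n\<close>.\<close>
  obtain k where k: "8 * (\<beta> / (\<beta> - 1)) < \<beta> ^ k"
    using real_arch_pow[OF \<beta>] by blast
  define c where "c = 1 / (8 * (real k + 1))"
  have "\<exists>n0. \<forall>n\<ge>n0. c * (b - a) * \<beta> ^ n \<le> real (card {z \<in> full_cyl \<beta> n. a \<le> z \<and> z + 1 / \<beta> ^ n \<le> b})"
    if ab: "0 \<le> a" "a < b" "b \<le> 1" for a b
  proof -
    define N where "N = (\<lambda>m. card {z \<in> full_cyl \<beta> m. a \<le> z \<and> z + 1 / \<beta> ^ m \<le> b})"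
    obtain M where M: "4 / (b - a) < \<beta> ^ M"
      using real_arch_pow[OF \<beta>] by blast
    then have M': "1 / \<beta> ^ M \<le> (b - a) / 4"
      using ab \<beta> by (simp add: field_simps)
    obtain n1 where n1: "4 * (real M * \<beta> ^ M) / (b - a) < \<beta> ^ n1"
      using real_arch_pow[OF \<beta>] by blast
    have mono: "N m \<le> N n" if "m \<le> n" for m n
    proof -
      have "1 / \<beta> ^ n \<le> 1 / \<beta> ^ m"
        using that \<beta> by (intro divide_left_mono power_increasing) auto
      then have "{z \<in> full_cyl \<beta> m. a \<le> z \<and> z + 1 / \<beta> ^ m \<le> b} \<subseteq>
        {z \<in> full_cyl \<beta> n. a \<le> z \<and> z + 1 / \<beta> ^ n \<le> b}"
        using full_cyl_mono[OF \<beta> that] by auto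
      then show ?thesis unfolding N_def
        by (intro card_mono full_cyl_card) (use ab in auto)
    qed
    have "c * (b - a) * \<beta> ^ n \<le> real (N n)" if n: "n \<ge> n1 + k" for n
    proof -
      have "\<beta> ^ n1 \<le> \<beta> ^ n" using n \<beta> by (intro power_increasing) auto
      then have "real M * \<beta> ^ M \<le> (b - a) / 4 * \<beta> ^ n"
        using n1 ab pos_divide_le_eq[of "b - a" "4 * (real M * \<beta> ^ M)" "\<beta> ^ n"]
        by (simp add: mult.commute)
      then have 1: "(b - a) / 4 * \<beta> ^ n \<le> (\<Sum>m\<le>n. real (N m))"
        using full_cyl_sum_lower[OF ab M', of n] unfolding N_def by linarith
      have "(\<Sum>m\<le>n. real (N m)) = (\<Sum>m\<le>n - k. real (N m)) + (\<Sum>m\<in>{n - k<..n}. real (N m))"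
        by (subst sum.union_disjoint[symmetric]) (auto intro!: sum.cong)
      also have "(\<Sum>m\<in>{n - k<..n}. real (N m)) \<le> (\<Sum>m\<in>{n - k<..n}. real (N n))"
        using mono by (intro sum_mono) auto
      also have "\<dots> = real k * real (N n)" using n by simp
      also have "(\<Sum>m\<le>n - k. real (N m)) \<le> (\<Sum>m\<le>n - k. (b - a) * \<beta> ^ m)"
        unfolding N_def by (intro sum_mono full_cyl_card) (use ab in auto)
      also have "\<dots> \<le> (b - a) * (\<beta> ^ (n - k) * (\<beta> / (\<beta> - 1)))"
        unfolding sum_distrib_left[symmetric] using power_sum_bound ab by (intro mult_left_mono) auto
      also have "\<dots> \<le> (b - a) * (\<beta> ^ n / 8)"
      proof -
        have "8 * (\<beta> ^ (n - k) * (\<beta> / (\<beta> - 1))) \<le> \<beta> ^ (n - k) * \<beta> ^ k"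
          using mult_left_mono[OF less_imp_le[OF k], of "\<beta> ^ (n - k)"] \<beta> by (simp add: mult_ac)
        also have "\<dots> = \<beta> ^ n" using n by (simp add: power_add[symmetric])
        finally have "\<beta> ^ (n - k) * (\<beta> / (\<beta> - 1)) \<le> \<beta> ^ n / 8" by linarith
        then show ?thesis using ab by (intro mult_left_mono) linarith+
      qed
      finally have "(b - a) / 8 * \<beta> ^ n \<le> real k * real (N n)" using 1 by simp
      also have "\<dots> \<le> (real k + 1) * real (N n)" by (simp add: algebra_simps)
      finally show ?thesis by (simp add: c_def field_simps)
    qed
    then show ?thesis unfolding N_def by blast
  qed
  moreover have "0 < c" by (simp add: c_def)
  ultimately show ?thesis by blast
qed

end

section \<open>The torus metric\<close>

lemma circle_dist_alt: "circle_dist a b = \<bar>a - b - of_int (round (a - b))\<bar>"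
proof (rule antisym)
  show "circle_dist a b \<le> \<bar>a - b - of_int (round (a - b))\<bar>"
    unfolding circle_dist_def
    by (rule infdist_le2[of "of_int (round (a - b))"]) (auto simp: dist_real_def)
  have "\<bar>a - b - of_int (round (a - b))\<bar> \<le> (INF k\<in>\<int>. dist (a - b) k)"
    by (rule cINF_greatest) (auto simp: dist_real_def round_diff_minimal elim!: Ints_cases intro: Ints_0)
  then show "\<bar>a - b - of_int (round (a - b))\<bar> \<le> circle_dist a b"
    unfolding circle_dist_def infdist_def by (auto intro: Ints_0 split: if_splits)
qed

lemma circle_dist_le: "circle_dist a b \<le> \<bar>a - b - of_int k\<bar>"
  by (simp add: circle_dist_alt round_diff_minimal)

lemma circle_dist_nonneg: "0 \<le> circle_dist a b"
  by (simp add: circle_dist_alt)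

lemma circle_dist_eq:
  assumes "\<bar>a - b\<bar> \<le> 1 / 2"
  shows "circle_dist a b = \<bar>a - b\<bar>"
proof (rule antisym)
  show "circle_dist a b \<le> \<bar>a - b\<bar>" using circle_dist_le[of a b 0] by simp
  show "\<bar>a - b\<bar> \<le> circle_dist a b"
  proof (cases "round (a - b) = 0")
    case False
    then have "1 \<le> \<bar>real_of_int (round (a - b))\<bar>" by linarith
    then show ?thesis using assms unfolding circle_dist_alt by linarith
  qed (simp add: circle_dist_alt)
qed

lemma circle_dist_nth_le: "circle_dist (x $ i) (y $ i) \<le> torus_dist x y"
proof -
  let ?L = "{z :: real ^ 'a. \<forall>i. z $ i \<in> \<int>}"
  have "0 \<in> ?L" by simp
  then have ne: "?L \<noteq> {}" by blast
  have "circle_dist (x $ i) (y $ i) \<le> (INF z\<in>?L. dist (x - y) z)"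
  proof (rule cINF_greatest[OF ne])
    fix z assume "z \<in> ?L"
    then obtain k where k: "z $ i = of_int k" by (auto elim: Ints_cases)
    have "circle_dist (x $ i) (y $ i) \<le> \<bar>(x - y - z) $ i\<bar>"
      using circle_dist_le[of "x $ i" "y $ i" k] k by simp
    also have "\<dots> \<le> dist (x - y) z"
      unfolding dist_norm by (rule component_le_norm_cart)
    finally show "circle_dist (x $ i) (y $ i) \<le> dist (x - y) z" .
  qed
  then show ?thesis unfolding torus_dist_def infdist_def if_not_P[OF ne] .
qed

lemma torus_dist_le: "torus_dist x y \<le> norm (x - y)"
  unfolding torus_dist_def by (rule infdist_le2[of 0]) auto

lemma torus_dist_nonneg: "0 \<le> torus_dist x y"
  by (simp add: torus_dist_def infdist_nonneg)

lemma torus_map_funpow: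
  assumes "\<forall>i j. T $ i $ j = (if i = j then \<beta> i else 0)"
  shows "(torus_map T ^^ n) x $ i = (btrans (\<beta> i) ^^ n) (x $ i)"
proof (induction n)
  case (Suc n)
  have "(T *v y) $ i = \<beta> i * y $ i" for y
  proof -
    have "(T *v y) $ i = (\<Sum>j\<in>UNIV. if j = i then \<beta> i * y $ i else 0)"
      by (simp add: matrix_vector_mult_def assms if_distrib[of "\<lambda>a. a * _"] cong: if_cong)
    then show ?thesis by simp
  qed
  then show ?case using Suc by (simp add: torus_map_def btrans_def)
qed simp

section \<open>Null sets for Hausdorff measure\<close>

lemma hausdorff_weight_le:
  assumes "0 < s" "\<forall>x\<in>U. \<forall>y\<in>U. d x y \<le> D" "\<And>x y. 0 \<le> d x y" "0 \<le> D"
  shows "hausdorff_weight d s U \<le> ennreal (D powr s)"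
proof (cases "U = {}")
  case False
  then obtain u where u: "u \<in> U" by auto
  have "(SUP (x, y)\<in>U \<times> U. d x y) \<le> D"
    using False assms(2) by (intro cSUP_least) auto
  moreover have "0 \<le> (SUP (x, y)\<in>U \<times> U. d x y)"
    by (rule cSUP_upper2[where x = "(u, u)"]) (use u assms in \<open>auto intro!: bdd_aboveI2[of _ _ D]\<close>)
  ultimately show ?thesis
    using False assms(1) by (auto simp: hausdorff_weight_def diam_wrt_def intro!: ennreal_leI powr_mono2)
qed (simp add: hausdorff_weight_def)

text \<open>This is the Hausdorff-Cantelli lemma: a limsup set is covered by the covers of all
  \<open>A n\<close> with \<open>n \<ge> N\<close>, whose total cost is the tail of a geometric
  series.\<close>

lemma hausdorff_measure_limsup_zero:
  fixes d :: "'a \<Rightarrow> 'a \<Rightarrow> real"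
  assumes s: "0 < s" and d: "\<And>x y. 0 \<le> d x y"
    and B: "B \<subseteq> {x. infinite {n. x \<in> A n}}"
    and q: "0 \<le> q" "q < 1" and D: "\<And>n. 0 \<le> D n" "D \<longlonglongrightarrow> 0"
    and cover: "\<And>n. n \<ge> N0 \<Longrightarrow> \<exists>\<U>. finite \<U> \<and> A n \<subseteq> \<Union>\<U> \<and>
      (\<forall>U\<in>\<U>. U \<subseteq> M \<and> (\<forall>x\<in>U. \<forall>y\<in>U. d x y \<le> D n)) \<and> real (card \<U>) * D n powr s \<le> K * q ^ n"
  shows "hausdorff_measure M d s B = 0"
proof -
  have K: "0 \<le> K * q ^ n" if "n \<ge> N0" for n
    using cover[OF that] by (metis mult_nonneg_nonneg of_nat_0_le_iff order_trans powr_ge_zero)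
  have "hausdorff_pre M d s \<delta> B \<le> 0 + ennreal \<epsilon>" if "0 < \<delta>" "0 < \<epsilon>" for \<delta> \<epsilon>
  proof -
    have "\<forall>\<^sub>F n in sequentially. D n < \<delta>"
      using D(2) \<open>0 < \<delta>\<close> by (rule order_tendstoD)
    moreover have "(\<lambda>n. K * q ^ n * (1 / (1 - q))) \<longlonglongrightarrow> K * 0 * (1 / (1 - q))"
      using q by (intro tendsto_intros LIMSEQ_realpow_zero)
    then have "\<forall>\<^sub>F n in sequentially. K * q ^ n * (1 / (1 - q)) < \<epsilon>"
      using \<open>0 < \<epsilon>\<close> by (auto dest: order_tendstoD(2))
    ultimately have "\<forall>\<^sub>F n in sequentially. D n < \<delta> \<and> K * q ^ n * (1 / (1 - q)) < \<epsilon> \<and> n \<ge> N0"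
      using eventually_ge_at_top by eventually_elim auto
    then obtain N where N: "\<And>n. n \<ge> N \<Longrightarrow> D n < \<delta>" "K * q ^ N * (1 / (1 - q)) < \<epsilon>" "N \<ge> N0"
      unfolding eventually_sequentially by (metis order_refl)
    have "\<forall>n. \<exists>\<U>. finite \<U> \<and> A (N + n) \<subseteq> \<Union>\<U> \<and>
      (\<forall>U\<in>\<U>. U \<subseteq> M \<and> (\<forall>x\<in>U. \<forall>y\<in>U. d x y \<le> D (N + n))) \<and>
      real (card \<U>) * D (N + n) powr s \<le> K * q ^ (N + n)"
      using cover N(3) by (meson trans_le_add1)
    then obtain \<U> where U: "\<And>n. finite (\<U> n)" "\<And>n. A (N + n) \<subseteq> \<Union>(\<U> n)"
      "\<And>n U. U \<in> \<U> n \<Longrightarrow> U \<subseteq> M \<and> (\<forall>x\<in>U. \<forall>y\<in>U. d x y \<le> D (N + n))"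
      "\<And>n. real (card (\<U> n)) * D (N + n) powr s \<le> K * q ^ (N + n)"
      by metis
    have "\<forall>n. \<exists>e. bij_betw e {..<card (\<U> n)} (\<U> n)"
      using ex_bij_betw_nat_finite[OF U(1)] by (simp add: atLeast0LessThan)
    then obtain e where e: "\<And>n. bij_betw (e n) {..<card (\<U> n)} (\<U> n)" by metis
    \<comment> \<open>Padding the finite families by empty sets, which have weight 0, allows a
      single enumeration over pairs of naturals.\<close>
    define V where "V = (\<lambda>(n, i). if i < card (\<U> n) then e n i else {})"
    have VU: "V (n, i) = {} \<or> V (n, i) \<in> \<U> n" for n i
      using e[of n] by (auto simp: V_def bij_betw_def)
    have Vsub: "V p \<subseteq> M \<and> (\<forall>x\<in>V p. \<forall>y\<in>V p. d x y \<le> \<delta>)" for p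
    proof (cases p)
      case (Pair n i)
      have "D (N + n) \<le> \<delta>" using N(1)[of "N + n"] by simp
      then show ?thesis using VU[of n i] U(3)[of "V (n, i)" n] unfolding Pair by force
    qed
    have "B \<subseteq> (\<Union>k. V (prod_decode k))"
    proof
      fix x assume "x \<in> B"
      then obtain m where m: "m \<ge> N" "x \<in> A m"
        using B unfolding infinite_nat_iff_unbounded_le by blast
      then obtain n where "m = N + n" by (metis le_iff_add)
      then obtain U where xU: "U \<in> \<U> n" "x \<in> U" using m U(2)[of n] by auto
      then obtain i where "i < card (\<U> n)" "e n i = U"
        using bij_betw_imp_surj_on[OF e[of n]] by (metis imageE lessThan_iff)
      then have "x \<in> V (prod_decode (prod_encode (n, i)))" using xU by (simp add: V_def)
      then show "x \<in> (\<Union>k. V (prod_decode k))" by blast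
    qed
    then have "hausdorff_pre M d s \<delta> B \<le> (\<Sum>k. hausdorff_weight d s (V (prod_decode k)))"
      unfolding hausdorff_pre_def using Vsub by (intro INF_lower2[of "\<lambda>k. V (prod_decode k)"]) auto
    also have "\<dots> = (\<Sum>n. \<Sum>i. hausdorff_weight d s (V (n, i)))"
      by (rule suminf_ennreal_2dimen[where f = "\<lambda>p. hausdorff_weight d s (V p)"]) simp
    also have "\<dots> \<le> (\<Sum>n. ennreal (K * q ^ (N + n)))"
    proof (rule suminf_le)
      fix n
      have "(\<Sum>i. hausdorff_weight d s (V (n, i))) = (\<Sum>i<card (\<U> n). hausdorff_weight d s (V (n, i)))"
        by (rule suminf_finite) (auto simp: V_def hausdorff_weight_def)
      also have "\<dots> \<le> (\<Sum>i<card (\<U> n). ennreal (D (N + n) powr s))"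
      proof (rule sum_mono)
        fix i assume "i \<in> {..<card (\<U> n)}"
        then have "V (n, i) \<in> \<U> n" using e[of n] by (auto simp: V_def bij_betw_def)
        then show "hausdorff_weight d s (V (n, i)) \<le> ennreal (D (N + n) powr s)"
          using U(3) by (intro hausdorff_weight_le s d D) blast
      qed
      also have "\<dots> = ennreal (real (card (\<U> n)) * D (N + n) powr s)"
        by (simp add: ennreal_mult ennreal_of_nat_eq_real_of_nat)
      also have "\<dots> \<le> ennreal (K * q ^ (N + n))" by (intro ennreal_leI U)
      finally show "(\<Sum>i. hausdorff_weight d s (V (n, i))) \<le> ennreal (K * q ^ (N + n))" .
    qed auto
    also have "\<dots> = ennreal (K * q ^ N * (1 / (1 - q)))"
    proof (rule suminf_ennreal_eq)
      show "0 \<le> K * q ^ (N + n)" for n using K N(3) by simp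
      have "(\<lambda>n. K * q ^ N * q ^ n) sums (K * q ^ N * (1 / (1 - q)))"
        using q by (intro sums_mult geometric_sums) auto
      then show "(\<lambda>n. K * q ^ (N + n)) sums (K * q ^ N * (1 / (1 - q)))"
        by (simp add: power_add mult.assoc)
    qed
    also have "\<dots> \<le> ennreal \<epsilon>" using N(2) by (intro ennreal_leI) simp
    finally show ?thesis by simp
  qed
  then have "hausdorff_pre M d s \<delta> B = 0" if "0 < \<delta>" for \<delta>
    using ennreal_le_epsilon[of 0 "hausdorff_pre M d s \<delta> B"] that by (metis le_zero_eq)
  then show ?thesis
    unfolding hausdorff_measure_def by (intro antisym SUP_least) auto
qed

section \<open>Upper bound\<close>

text \<open>In a coordinate with expansion rate \<open>exp b\<close> and target size \<open>exp (- n t)\<close>, the points hitting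
  the target at time \<open>n\<close> are covered by about \<open>exp (n * \<Phi> b t A)\<close> intervals of length
  \<open>exp (- n A)\<close>.\<close>

definition \<Phi> :: "real \<Rightarrow> real \<Rightarrow> real \<Rightarrow> real" where
  "\<Phi> b t A = max (min A b) (A - t)"

text \<open>Modulo 1 a point is its target plus the signed displacement \<theta>, so points with
  close displacements are about as close as their targets.\<close>

lemma circle_dist_diff_le:
  assumes "\<theta> = u - v - of_int (round (u - v))" "\<theta>' = u' - v' - of_int (round (u' - v'))"
  shows "circle_dist u u' \<le> \<bar>\<theta> - \<theta>'\<bar> + circle_dist v v'"
proof -
  define k where "k = round (u - v) - round (u' - v') + round (v - v')"
  have "u - u' - of_int k = (\<theta> - \<theta>') + (v - v' - of_int (round (v - v')))"
    unfolding assms k_def by simp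
  then show ?thesis
    using circle_dist_le[of u u' k] by (simp add: circle_dist_alt[of v v'])
qed

text \<open>A key consists of the branch of the \<open>n\<close>-th iterate, the quarter of the circle containing the
  image, and the rounded displacement from the target. Within a quarter the circle distance is the
  distance on the line.\<close>

lemma coordinate_keys:
  assumes \<beta>: "1 < \<beta>" and n: "1 \<le> n" and A: "0 < A"
  defines "r \<equiv> exp (- real n * A)"
  shows "\<exists>I :: (real \<times> int \<times> int) set. \<exists>key. finite I \<and>
    real (card I) \<le> 20 * (\<beta> / (\<beta> - 1)) * exp (real n * \<Phi> (ln \<beta>) t A) \<and>
    (\<forall>x y. 0 \<le> x \<and> x < 1 \<and> circle_dist ((btrans \<beta> ^^ n) x) y < exp (- real n * t) \<longrightarrow> key x y \<in> I) \<and>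
    (\<forall>x y x' y'. 0 \<le> x \<and> x < 1 \<and> 0 \<le> x' \<and> x' < 1 \<and> key x y = key x' y' \<longrightarrow>
        \<bar>x - x'\<bar> \<le> r + circle_dist y y' / \<beta> ^ n)"
proof -
  define C where "C = \<beta> / (\<beta> - 1)"
  have C: "1 \<le> C" using \<beta> by (simp add: C_def)
  have r: "0 < r" "r \<le> 1" using A by (auto simp: r_def)
  have \<beta>n: "\<beta> ^ n = exp (real n * ln \<beta>)" "0 < \<beta> ^ n"
    using \<beta> by (auto simp: exp_of_nat_mult)
  show ?thesis
  \<comment> \<open>If the branches are shorter than \<open>r\<close>, the target cannot be
    exploited at this scale, and a plain grid of step \<open>r\<close> does as well. Otherwise
    branches are counted one by one.\<close>
  proof (cases "1 / \<beta> ^ n \<le> r")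
    case True
    define I :: "(real \<times> int \<times> int) set" where "I = {0} \<times> {0..\<lfloor>1 / r\<rfloor>} \<times> {0}"
    define key :: "real \<Rightarrow> real \<Rightarrow> real \<times> int \<times> int" where "key = (\<lambda>x y. (0, \<lfloor>x / r\<rfloor>, 0))"
    have "exp (- (real n * ln \<beta>)) \<le> exp (- real n * A)"
      using True unfolding \<beta>n r_def by (simp add: exp_minus divide_inverse)
    then have "A \<le> ln \<beta>" using n by simp
    then have "A \<le> \<Phi> (ln \<beta>) t A" by (simp add: \<Phi>_def)
    then have "1 / r \<le> exp (real n * \<Phi> (ln \<beta>) t A)"
      by (simp add: r_def exp_minus divide_inverse mult_left_mono)
    moreover have "1 \<le> 1 / r" using r by simp
    moreover have "real (card I) = of_int \<lfloor>1 / r\<rfloor> + 1"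
      using r by (simp add: I_def card_cartesian_product)
    ultimately have "real (card I) \<le> 2 * exp (real n * \<Phi> (ln \<beta>) t A)" by linarith
    also have "\<dots> \<le> 20 * C * exp (real n * \<Phi> (ln \<beta>) t A)"
      using C by (intro mult_right_mono) auto
    finally have "real (card I) \<le> 20 * C * exp (real n * \<Phi> (ln \<beta>) t A)" .
    moreover have "\<bar>x - x'\<bar> \<le> r + circle_dist y y' / \<beta> ^ n" if "key x y = key x' y'" for x y x' y'
    proof -
      have "\<bar>x / r - x' / r\<bar> < 1" using that unfolding key_def by simp linarith
      then have "\<bar>x - x'\<bar> < r" using r by (simp add: diff_divide_distrib[symmetric] abs_divide)
      then show ?thesis using circle_dist_nonneg[of y y'] \<beta>n(2) by (simp add: add_increasing2)
    qed
    moreover have "key x y \<in> I" if "0 \<le> x" "x < 1" for x y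
      using that r by (auto simp: key_def I_def intro!: floor_mono divide_right_mono)
    moreover have "finite I" by (simp add: I_def)
    ultimately show ?thesis unfolding C_def by blast
  next
    case False
    define p where "p = exp (- real n * t)"
    \<comment> \<open>The scale \<open>r\<close> as seen after \<open>n\<close> iterates. Four
      quarters times \<open>2 * k + 1\<close> rounded displacements give at most 8 p / \<omega> + 12
      keys per branch, whence the constant 20 = 8 + 12.\<close>
    define \<omega> where "\<omega> = \<beta> ^ n * r"
    define k where "k = \<lceil>p / \<omega>\<rceil>"
    have pos: "0 < p" "0 < \<omega>" using r \<beta>n by (auto simp: p_def \<omega>_def)
    obtain S where S: "finite S" "real (card S) \<le> \<beta> ^ n * C"
      "\<And>x. 0 \<le> x \<Longrightarrow> x < 1 \<Longrightarrow> \<exists>w\<in>S. (btrans \<beta> ^^ n) x = \<beta> ^ n * (x - w)"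
      using branches[OF \<beta>, of n] unfolding C_def by blast
    then obtain w where w: "\<And>x. 0 \<le> x \<Longrightarrow> x < 1 \<Longrightarrow> w x \<in> S \<and> (btrans \<beta> ^^ n) x = \<beta> ^ n * (x - w x)"
      by metis
    define \<theta> where "\<theta> = (\<lambda>x y. (btrans \<beta> ^^ n) x - y - of_int (round ((btrans \<beta> ^^ n) x - y)))"
    define I where "I = S \<times> {0..3::int} \<times> {- k..k}"
    define key where "key = (\<lambda>x y. (w x, \<lfloor>4 * (btrans \<beta> ^^ n) x\<rfloor>, \<lfloor>\<theta> x y / \<omega>\<rfloor>))"
    have "0 < p / \<omega>" using pos by simp
    then have "0 \<le> k" unfolding k_def by linarith
    have "exp (- real n * A) < exp (- (real n * ln \<beta>))"
      using False unfolding \<beta>n r_def by (simp add: exp_minus divide_inverse)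
    then have "ln \<beta> < A" using n by simp
    then have \<Phi>: "ln \<beta> \<le> \<Phi> (ln \<beta>) t A" "A - t \<le> \<Phi> (ln \<beta>) t A" by (auto simp: \<Phi>_def)
    have "real (card I) = real (card S) * (4 * (2 * of_int k + 1))"
      using \<open>0 \<le> k\<close> S(1) by (simp add: I_def card_cartesian_product)
    also have "\<dots> \<le> (\<beta> ^ n * C) * (4 * (2 * of_int k + 1))"
      using S(2) \<open>0 \<le> k\<close> by (intro mult_right_mono) auto
    also have "\<dots> \<le> (\<beta> ^ n * C) * (4 * (2 * (p / \<omega>) + 3))"
    proof -
      have "of_int k \<le> p / \<omega> + 1" unfolding k_def by linarith
      then show ?thesis using C \<beta>n(2) by (intro mult_left_mono) auto
    qed
    also have "\<dots> = C * (8 * exp (real n * (A - t)) + 12 * exp (real n * ln \<beta>))"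
    proof -
      have "\<beta> ^ n * (p / \<omega>) = exp (real n * (A - t))"
        using \<beta>n(2) \<beta> by (simp add: \<omega>_def p_def r_def algebra_simps exp_diff exp_minus divide_simps)
      moreover have "(\<beta> ^ n * C) * (4 * (2 * (p / \<omega>) + 3)) = C * (8 * (\<beta> ^ n * (p / \<omega>)) + 12 * \<beta> ^ n)"
        by (simp only: algebra_simps) simp
      ultimately show ?thesis by (simp only: \<beta>n(1))
    qed
    also have "\<dots> \<le> C * (8 * exp (real n * \<Phi> (ln \<beta>) t A) + 12 * exp (real n * \<Phi> (ln \<beta>) t A))"
      using C \<Phi> by (intro mult_left_mono add_mono) (auto intro!: mult_left_mono)
    finally have "real (card I) \<le> 20 * C * exp (real n * \<Phi> (ln \<beta>) t A)" by simp
    moreover have "\<bar>x - x'\<bar> \<le> r + circle_dist y y' / \<beta> ^ n"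
      if x: "0 \<le> x" "x < 1" "0 \<le> x'" "x' < 1" and key: "key x y = key x' y'" for x y x' y'
    proof -
      let ?u = "(btrans \<beta> ^^ n) x" and ?u' = "(btrans \<beta> ^^ n) x'"
      have "\<bar>\<theta> x y / \<omega> - \<theta> x' y' / \<omega>\<bar> < 1" using key unfolding key_def by simp linarith
      then have 1: "\<bar>\<theta> x y - \<theta> x' y'\<bar> \<le> \<omega>"
        using pos by (simp add: diff_divide_distrib[symmetric] abs_divide)
      have "\<bar>4 * ?u - 4 * ?u'\<bar> < 1" using key unfolding key_def by simp linarith
      then have "\<bar>?u - ?u'\<bar> \<le> 1 / 2" by arith
      then have "\<bar>?u - ?u'\<bar> = circle_dist ?u ?u'" by (rule circle_dist_eq[symmetric])
      also have "\<dots> \<le> \<omega> + circle_dist y y'"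
        using circle_dist_diff_le[of "\<theta> x y" ?u y "\<theta> x' y'" ?u' y'] 1 by (simp add: \<theta>_def)
      also have "?u - ?u' = \<beta> ^ n * (x - x')"
        using w[OF x(1,2)] w[OF x(3,4)] key by (simp add: key_def algebra_simps)
      finally have "\<beta> ^ n * \<bar>x - x'\<bar> \<le> \<beta> ^ n * r + circle_dist y y'"
        using \<beta>n(2) by (simp add: abs_mult \<omega>_def)
      then show ?thesis using \<beta>n(2) \<beta> by (simp add: field_simps)
    qed
    moreover have "key x y \<in> I"
      if x: "0 \<le> x" "x < 1" and hit: "circle_dist ((btrans \<beta> ^^ n) x) y < p" for x y
    proof -
      have "\<bar>\<theta> x y\<bar> < p" using hit by (simp add: \<theta>_def circle_dist_alt)
      then have "\<bar>\<theta> x y / \<omega>\<bar> \<le> p / \<omega>" using pos by (simp add: abs_divide divide_right_mono)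
      then have "- k \<le> \<lfloor>\<theta> x y / \<omega>\<rfloor>" "\<lfloor>\<theta> x y / \<omega>\<rfloor> \<le> k" unfolding k_def by linarith+
      moreover have "0 \<le> \<lfloor>4 * (btrans \<beta> ^^ n) x\<rfloor>" "\<lfloor>4 * (btrans \<beta> ^^ n) x\<rfloor> \<le> 3"
        using btrans_funpow_range[OF x, of n \<beta>] by linarith+
      ultimately show ?thesis using w[OF x] by (simp add: key_def I_def)
    qed
    moreover have "finite I" using S by (simp add: I_def)
    ultimately show ?thesis unfolding C_def p_def by blast
  qed
qed

section \<open>Covers of the set hit at time n by a moving target\<close>

definition hit_set :: "('d \<Rightarrow> real) \<Rightarrow> (nat \<Rightarrow> real ^ 'd \<Rightarrow> real ^ 'd) \<Rightarrow> nat \<Rightarrow> ('d \<Rightarrow> real) \<Rightarrow> (real ^ 'd) set" where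
  "hit_set \<beta> f n \<psi> =
     {x \<in> torus. \<forall>i. circle_dist ((btrans (\<beta> i) ^^ n) (x $ i)) (f n x $ i) < \<psi> i}"

locale moving_targets =
  fixes \<beta> :: "'d::finite \<Rightarrow> real" and f :: "nat \<Rightarrow> real ^ 'd \<Rightarrow> real ^ 'd" and c :: real
  assumes \<beta>: "\<And>i. 1 < \<beta> i"
    and c: "0 < c"
    and lipschitz: "\<And>n x y. 1 \<le> n \<Longrightarrow> x \<in> torus \<Longrightarrow> y \<in> torus \<Longrightarrow>
      torus_dist (f n x) (f n y) \<le> c * torus_dist x y"
begin

lemma circle_dist_target_le:
  assumes "1 \<le> n" "x \<in> torus" "y \<in> torus"
  shows "circle_dist (f n x $ i) (f n y $ i) \<le> c * norm (x - y)"
proof -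
  have "circle_dist (f n x $ i) (f n y $ i) \<le> c * torus_dist x y"
    using circle_dist_nth_le lipschitz[OF assms] order_trans by blast
  also have "\<dots> \<le> c * norm (x - y)" using c torus_dist_le by (intro mult_left_mono) auto
  finally show ?thesis .
qed

lemma eventually_inverse_power_small:
  assumes "0 < \<epsilon>"
  shows "\<forall>\<^sub>F n in sequentially. (\<Sum>i\<in>UNIV. 1 / \<beta> i ^ n) < \<epsilon>"
proof -
  have "(\<lambda>n. \<Sum>i\<in>UNIV. (1 / \<beta> i) ^ n) \<longlonglongrightarrow> (\<Sum>i\<in>(UNIV :: 'd set). 0)"
    using \<beta> by (intro tendsto_sum LIMSEQ_realpow_zero) (auto simp: less_imp_le order.strict_trans[OF zero_less_one])
  then show ?thesis
    using order_tendstoD(2)[of _ 0 sequentially \<epsilon>] assms by (simp add: power_one_over)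
qed

text \<open>Solutions with equal keys in all coordinates form one covering set. \<open>N0\<close>
  and \<open>K\<close> precede the quantifiers over \<open>t\<close> and \<open>A\<close> because
  both vary with \<open>n\<close> where the covers are used.\<close>

lemma hit_set_cover:
  "\<exists>N0 K. 0 < K \<and> (\<forall>n\<ge>N0. \<forall>t A. 0 < A \<longrightarrow> (\<exists>\<U>. finite \<U> \<and>
     hit_set \<beta> f n (\<lambda>i. exp (- real n * t i)) \<subseteq> \<Union>\<U> \<and>
     (\<forall>U\<in>\<U>. U \<subseteq> torus \<and> (\<forall>x\<in>U. \<forall>y\<in>U. torus_dist x y \<le> 2 * real CARD('d) * exp (- real n * A))) \<and>
     real (card \<U>) \<le> K * exp (real n * (\<Sum>i\<in>UNIV. \<Phi> (ln (\<beta> i)) (t i) A))))"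
proof -
  define K where "K = (\<Prod>i\<in>UNIV. 20 * (\<beta> i / (\<beta> i - 1)))"
  have "0 < K" unfolding K_def using \<beta> by (intro prod_pos) (auto intro!: divide_pos_pos simp: less_imp_le order.strict_trans[OF zero_less_one])
  have "\<forall>\<^sub>F n in sequentially. (\<Sum>i\<in>UNIV. 1 / \<beta> i ^ n) < 1 / (2 * c) \<and> 1 \<le> n"
    using c by (intro eventually_conj eventually_inverse_power_small eventually_ge_at_top) auto
  then obtain N0 where N0: "\<And>n. n \<ge> N0 \<Longrightarrow> (\<Sum>i\<in>UNIV. 1 / \<beta> i ^ n) < 1 / (2 * c) \<and> 1 \<le> n"
    unfolding eventually_sequentially by blast
  have "\<exists>\<U>. finite \<U> \<and> hit_set \<beta> f n (\<lambda>i. exp (- real n * t i)) \<subseteq> \<Union>\<U> \<and>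
     (\<forall>U\<in>\<U>. U \<subseteq> torus \<and> (\<forall>x\<in>U. \<forall>y\<in>U. torus_dist x y \<le> 2 * real CARD('d) * exp (- real n * A))) \<and>
     real (card \<U>) \<le> K * exp (real n * (\<Sum>i\<in>UNIV. \<Phi> (ln (\<beta> i)) (t i) A))"
    if n: "n \<ge> N0" and A: "0 < A" for n t A
  proof -
    have n1: "1 \<le> n" using N0 n by blast
    define r where "r = exp (- real n * A)"
    have "\<forall>i. \<exists>I :: (real \<times> int \<times> int) set. \<exists>key. finite I \<and>
      real (card I) \<le> 20 * (\<beta> i / (\<beta> i - 1)) * exp (real n * \<Phi> (ln (\<beta> i)) (t i) A) \<and>
      (\<forall>x y. 0 \<le> x \<and> x < 1 \<and> circle_dist ((btrans (\<beta> i) ^^ n) x) y < exp (- real n * t i) \<longrightarrow> key x y \<in> I) \<and>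
      (\<forall>x y x' y'. 0 \<le> x \<and> x < 1 \<and> 0 \<le> x' \<and> x' < 1 \<and> key x y = key x' y' \<longrightarrow>
          \<bar>x - x'\<bar> \<le> r + circle_dist y y' / \<beta> i ^ n)"
      unfolding r_def using coordinate_keys[OF \<beta> n1 A] by blast
    then obtain I :: "'d \<Rightarrow> (real \<times> int \<times> int) set" and key where
      I: "\<And>i. finite (I i)"
        "\<And>i. real (card (I i)) \<le> 20 * (\<beta> i / (\<beta> i - 1)) * exp (real n * \<Phi> (ln (\<beta> i)) (t i) A)" and
      key: "\<And>i x y. 0 \<le> x \<Longrightarrow> x < 1 \<Longrightarrow> circle_dist ((btrans (\<beta> i) ^^ n) x) y < exp (- real n * t i) \<Longrightarrow> key i x y \<in> I i"
        "\<And>i x y x' y'. 0 \<le> x \<Longrightarrow> x < 1 \<Longrightarrow> 0 \<le> x' \<Longrightarrow> x' < 1 \<Longrightarrow> key i x y = key i x' y' \<Longrightarrow>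
          \<bar>x - x'\<bar> \<le> r + circle_dist y y' / \<beta> i ^ n"
      by metis
    define H where "H = hit_set \<beta> f n (\<lambda>i. exp (- real n * t i))"
    define \<kappa> where "\<kappa> = (\<lambda>x. \<lambda>i. key i (x $ i) (f n x $ i))"
    define \<U> where "\<U> = (\<lambda>v. {x \<in> H. \<kappa> x = v}) ` (PiE UNIV I)"
    have fin: "finite (PiE UNIV I)" using I by (intro finite_PiE) auto
    have "real (card \<U>) \<le> real (card (PiE UNIV I))"
      unfolding \<U>_def by (simp add: card_image_le fin)
    also have "\<dots> = (\<Prod>i\<in>UNIV. real (card (I i)))" by (simp add: card_PiE)
    also have "\<dots> \<le> (\<Prod>i\<in>UNIV. 20 * (\<beta> i / (\<beta> i - 1)) * exp (real n * \<Phi> (ln (\<beta> i)) (t i) A))"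
      using I(2) by (intro prod_mono conjI) simp_all
    also have "\<dots> = K * exp (real n * (\<Sum>i\<in>UNIV. \<Phi> (ln (\<beta> i)) (t i) A))"
      unfolding K_def by (simp only: prod.distrib sum_distrib_left exp_sum finite_class.finite_UNIV)
    finally have card: "real (card \<U>) \<le> K * exp (real n * (\<Sum>i\<in>UNIV. \<Phi> (ln (\<beta> i)) (t i) A))" .
    have H: "0 \<le> x $ i" "x $ i < 1" "x \<in> torus" if "x \<in> H" for x i
      using that by (auto simp: H_def hit_set_def torus_def)
    have "\<kappa> x \<in> PiE UNIV I" if "x \<in> H" for x
      using that key(1)[OF H(1,2)[OF that]] by (auto simp: \<kappa>_def H_def hit_set_def)
    then have cover: "H \<subseteq> \<Union>\<U>" by (auto simp: \<U>_def)
    have diam: "torus_dist x y \<le> 2 * real CARD('d) * r"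
      if xy: "x \<in> H" "y \<in> H" "\<kappa> x = \<kappa> y" for x y
    proof -
      have "\<bar>x $ i - y $ i\<bar> \<le> r + c * norm (x - y) * (1 / \<beta> i ^ n)" for i
      proof -
        have "key i (x $ i) (f n x $ i) = key i (y $ i) (f n y $ i)"
          using fun_cong[OF xy(3), of i] by (simp add: \<kappa>_def)
        then have "\<bar>x $ i - y $ i\<bar> \<le> r + circle_dist (f n x $ i) (f n y $ i) / \<beta> i ^ n"
          using key(2)[OF H(1,2)[OF xy(1)] H(1,2)[OF xy(2)]] by blast
        also have "\<dots> \<le> r + c * norm (x - y) * (1 / \<beta> i ^ n)"
          using circle_dist_target_le[OF n1 H(3)[OF xy(1)] H(3)[OF xy(2)], of i] \<beta>[of i]
          by (simp add: divide_right_mono)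
        finally show ?thesis .
      qed
      \<comment> \<open>The distance reappears on the right because the target moves with the point.
        Its coefficient is at most 1/2 by the choice of \<open>N0\<close>, so it is absorbed at the
        price of a factor 2.\<close>
      then have "norm (x - y) \<le> (\<Sum>i\<in>UNIV. r + c * norm (x - y) * (1 / \<beta> i ^ n))"
        by (intro order_trans[OF norm_le_l1_cart] sum_mono) simp
      also have "\<dots> = real CARD('d) * r + c * norm (x - y) * (\<Sum>i\<in>UNIV. 1 / \<beta> i ^ n)"
        by (simp add: sum.distrib sum_distrib_left)
      also have "\<dots> \<le> real CARD('d) * r + c * norm (x - y) * (1 / (2 * c))"
        using N0[OF n] c by (intro add_left_mono mult_left_mono) auto
      finally have "norm (x - y) \<le> 2 * real CARD('d) * r" using c by simp
      then show ?thesis using torus_dist_le order_trans by blast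
    qed
    show ?thesis
    proof (intro exI[of _ \<U>] conjI)
      show "finite \<U>" using fin by (simp add: \<U>_def)
      show "\<forall>U\<in>\<U>. U \<subseteq> torus \<and> (\<forall>x\<in>U. \<forall>y\<in>U. torus_dist x y \<le> 2 * real CARD('d) * exp (- real n * A))"
        using diam H(3) by (auto simp: \<U>_def r_def)
    qed (use cover card in \<open>auto simp: H_def\<close>)
  qed
  then show ?thesis using \<open>0 < K\<close> by blast
qed

end

section \<open>The dimension numbers\<close>

text \<open>The sets \<open>Q1\<close>, \<open>Q2\<close>, \<open>Q3\<close> are the three regimes
  of \<open>\<Phi>\<close> at the scale A = \<open>ln (\<beta> i) + t $ i\<close>: its value is A, A
  - t_j and ln \<beta>_j respectively. Nonnegativity of \<open>t\<close> makes \<open>Q1\<close> and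
  \<open>Q2\<close> disjoint.\<close>

lemma lam_eq:
  fixes t :: "real ^ 'd::finite"
  assumes \<beta>: "\<And>i. 1 < \<beta> i" and t: "\<And>i. 0 \<le> t $ i"
  shows "lam \<beta> t i = (\<Sum>j\<in>UNIV. \<Phi> (ln (\<beta> j)) (t $ j) (ln (\<beta> i) + t $ i)) / (ln (\<beta> i) + t $ i)"
proof -
  define A where "A = ln (\<beta> i) + t $ i"
  have "0 < A" using \<beta>[of i] t[of i] by (simp add: A_def add_pos_nonneg)
  have disj: "Q1 \<beta> t i \<inter> Q2 \<beta> t i = {}"
    using t by (auto simp: Q1_def Q2_def) (smt (verit))
  have all: "Q1 \<beta> t i \<union> Q2 \<beta> t i \<union> Q3 \<beta> t i = UNIV" "(Q1 \<beta> t i \<union> Q2 \<beta> t i) \<inter> Q3 \<beta> t i = {}"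
    by (auto simp: Q3_def)
  have 1: "\<Phi> (ln (\<beta> j)) (t $ j) A / A = 1" if "j \<in> Q1 \<beta> t i" for j
    using that t[of j] \<open>0 < A\<close> by (auto simp: Q1_def A_def \<Phi>_def)
  have 2: "\<Phi> (ln (\<beta> j)) (t $ j) A / A = 1 - t $ j / A" if "j \<in> Q2 \<beta> t i" for j
  proof -
    have "\<Phi> (ln (\<beta> j)) (t $ j) A = A - t $ j"
      using that by (auto simp: Q2_def A_def \<Phi>_def)
    then show ?thesis using \<open>0 < A\<close> by (simp add: diff_divide_distrib)
  qed
  have 3: "\<Phi> (ln (\<beta> j)) (t $ j) A / A = ln (\<beta> j) / A" if "j \<in> Q3 \<beta> t i" for j
    using that by (auto simp: Q1_def Q2_def Q3_def A_def \<Phi>_def)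
  have "lam \<beta> t i = (\<Sum>j\<in>Q1 \<beta> t i \<union> Q2 \<beta> t i \<union> Q3 \<beta> t i. \<Phi> (ln (\<beta> j)) (t $ j) A / A)"
    unfolding lam_def by (simp add: sum.union_disjoint disj all(2) 1 2 3 flip: A_def)
  then show ?thesis unfolding all(1) by (simp add: sum_divide_distrib A_def)
qed

text \<open>Between consecutive points of the form \<open>b i + t i\<close> the ratio below is bounded from below by
  a function of the form \<open>P + D / A\<close>, with equality at the given \<open>A\<close>; so one can move to the
  next such point on the right or on the left, depending on the sign of \<open>D\<close>.\<close>

lemma \<Phi>_sum_minimum:
  fixes b t :: "'d::finite \<Rightarrow> real"
  assumes b: "\<And>i. 0 < b i" and t: "\<And>i. 0 < t i" and A: "0 < A"
  shows "\<exists>i. (\<Sum>j\<in>UNIV. \<Phi> (b j) (t j) (b i + t i)) * A \<le> (\<Sum>j\<in>UNIV. \<Phi> (b j) (t j) A) * (b i + t i)"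
proof -
  define low mid where "low = {j. b j + t j \<le> A}" and "mid = {j. b j < A \<and> A < b j + t j}"
  \<comment> \<open>Slope and intercept of the \<open>j\<close>-th summand at the given
    \<open>A\<close>: slope 0 on the plateau \<open>mid\<close>, slope 1 before and after
    it.\<close>
  define p q where "p = (\<lambda>j. if j \<in> mid then 0 else 1 :: real)"
    and "q = (\<lambda>j. if j \<in> low then - t j else if j \<in> mid then b j else 0)"
  define P D where "P = sum p UNIV" and "D = sum q UNIV"
  have at_A: "(\<Sum>j\<in>UNIV. \<Phi> (b j) (t j) A) = P * A + D"
  proof -
    have "\<Phi> (b j) (t j) A = p j * A + q j" for j
      using b[of j] t[of j] by (auto simp: p_def q_def low_def mid_def \<Phi>_def)
    then show ?thesis by (simp add: P_def D_def sum.distrib sum_distrib_right)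
  qed
  have move: ?thesis
    if le: "\<And>j. \<Phi> (b j) (t j) (b i + t i) \<le> p j * (b i + t i) + q j"
      and D: "D * (A - (b i + t i)) \<le> 0" for i
  proof -
    have "(\<Sum>j\<in>UNIV. \<Phi> (b j) (t j) (b i + t i)) \<le> (\<Sum>j\<in>UNIV. p j * (b i + t i) + q j)"
      by (intro sum_mono le)
    also have "\<dots> = P * (b i + t i) + D"
      by (simp only: sum.distrib sum_distrib_right P_def D_def)
    finally have "(\<Sum>j\<in>UNIV. \<Phi> (b j) (t j) (b i + t i)) * A \<le> (P * (b i + t i) + D) * A"
      using A by (intro mult_right_mono) auto
    also have "\<dots> = (P * A + D) * (b i + t i) + D * (A - (b i + t i))" by (simp add: algebra_simps)
    finally show ?thesis using D unfolding at_A by (intro exI[of _ i]) linarith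
  qed
  show ?thesis
  proof (cases "0 \<le> D")
    case True
    \<comment> \<open>A critical point to the right of \<open>A\<close> must exist: otherwise every
      intercept is \<open>- t j\<close> and \<open>D\<close> is negative. The nearest one is used,
      so that no other summand leaves its last regime before it.\<close>
    have "- low \<noteq> {}"
    proof
      assume "- low = {}"
      then have "low = UNIV" by auto
      then have "q = (\<lambda>j. - t j)" by (auto simp: q_def)
      then have "D < 0" unfolding D_def using t by (simp add: sum_negf sum_pos)
      then show False using True by simp
    qed
    then have "\<exists>i\<in>- low. \<forall>j\<in>- low. b i + t i \<le> b j + t j"
      using arg_min_if_finite(1)[of "- low" "\<lambda>i. b i + t i"] arg_min_least[of "- low" _ "\<lambda>i. b i + t i"]
      by (meson finite)
    then obtain i where i: "i \<in> - low" "\<And>j. j \<in> - low \<Longrightarrow> b i + t i \<le> b j + t j" by blast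
    have "A < b i + t i" using i(1) by (simp add: low_def)
    moreover have "\<Phi> (b j) (t j) (b i + t i) \<le> p j * (b i + t i) + q j" for j
      using i(2)[of j] \<open>A < b i + t i\<close> t[of j] b[of j] by (auto simp: p_def q_def low_def mid_def \<Phi>_def)
    ultimately show ?thesis using True by (intro move[of i]) (auto intro: mult_nonneg_nonpos)
  next
    case False
    \<comment> \<open>Symmetrically, without a critical point at or to the left of \<open>A\<close>
      no intercept would be negative. The largest such point is used.\<close>
    have "low \<noteq> {}"
    proof
      assume "low = {}"
      then have "0 \<le> D" unfolding D_def q_def using b by (intro sum_nonneg) (auto simp: less_imp_le)
      then show False using False by simp
    qed
    then have "\<exists>i\<in>low. \<forall>j\<in>low. - (b i + t i) \<le> - (b j + t j)"
      using arg_min_if_finite(1)[of low "\<lambda>i. - (b i + t i)"] arg_min_least[of low _ "\<lambda>i. - (b i + t i)"]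
      by (meson finite)
    then obtain i where i: "i \<in> low" "\<And>j. j \<in> low \<Longrightarrow> b j + t j \<le> b i + t i"
      using neg_le_iff_le by blast
    have "b i + t i \<le> A" using i(1) by (simp add: low_def)
    moreover have "\<Phi> (b j) (t j) (b i + t i) \<le> p j * (b i + t i) + q j" for j
      using i(2)[of j] \<open>b i + t i \<le> A\<close> t[of j] b[of j] t[of i] b[of i]
      by (auto simp: p_def q_def low_def mid_def \<Phi>_def)
    ultimately show ?thesis using False by (intro move[of i]) (auto intro: mult_nonpos_nonneg)
  qed
qed

lemma tendsto_\<Phi> [tendsto_intros]:
  "(t \<longlongrightarrow> t0) F \<Longrightarrow> (A \<longlongrightarrow> A0) F \<Longrightarrow> ((\<lambda>x. \<Phi> b (t x) (A x)) \<longlongrightarrow> \<Phi> b t0 A0) F"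
  unfolding \<Phi>_def by (intro tendsto_intros)

section \<open>Convergent subsequences\<close>

text \<open>Compactness of the extended line, applied to one coordinate after another. Since limits
  always exist here, a hypothesis on all accumulation points controls the whole sequence.\<close>

lemma ereal_vec_convergent_subsequence:
  fixes x :: "nat \<Rightarrow> ereal ^ 'd::finite"
  shows "\<exists>l r. strict_mono r \<and> (\<lambda>n. x (r n)) \<longlonglongrightarrow> l"
proof -
  have "\<exists>r. strict_mono r \<and> (\<forall>i\<in>S. \<exists>l. (\<lambda>n. x (r n) $ i) \<longlonglongrightarrow> l)" for S :: "'d set"
  proof (induction S rule: finite_induct[OF finite])
    case 1
    show ?case by (intro exI[of _ id]) (simp add: strict_mono_def)
  next
    case (2 i S)
    then obtain r where r: "strict_mono r" "\<And>j. j \<in> S \<Longrightarrow> \<exists>l. (\<lambda>n. x (r n) $ j) \<longlonglongrightarrow> l" by auto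
    obtain l q where q: "strict_mono q" "((\<lambda>n. x (r n) $ i) \<circ> q) \<longlonglongrightarrow> l"
      using compact_complete_linorder by blast
    have "\<exists>l. (\<lambda>n. x ((r \<circ> q) n) $ j) \<longlonglongrightarrow> l" if "j \<in> insert i S" for j
    proof (cases "j = i")
      case False
      then obtain l' where "(\<lambda>n. x (r n) $ j) \<longlonglongrightarrow> l'" using r(2) \<open>j \<in> insert i S\<close> by auto
      then show ?thesis using LIMSEQ_subseq_LIMSEQ[OF _ q(1)] by (fastforce simp: o_def)
    qed (use q in \<open>auto simp: o_def\<close>)
    then show ?case using strict_mono_o[OF r(1) q(1)] by blast
  qed
  then obtain r where r: "strict_mono r" "\<forall>i\<in>UNIV. \<exists>l. (\<lambda>n. x (r n) $ i) \<longlonglongrightarrow> l" by blast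
  then have "\<forall>i. \<exists>l. (\<lambda>n. x (r n) $ i) \<longlonglongrightarrow> l" by simp
  from choice[OF this] obtain l where "\<forall>i. (\<lambda>n. x (r n) $ i) \<longlonglongrightarrow> l i" by blast
  then have "(\<lambda>n. x (r n)) \<longlonglongrightarrow> (\<chi> i. l i)" by (intro vec_tendstoI) simp
  then show ?thesis using r(1) by blast
qed

lemma tendsto_ereal_vec_iff:
  "((\<lambda>n. ereal_vec (x n)) \<longlongrightarrow> ereal_vec t) F \<longleftrightarrow> (\<forall>i. ((\<lambda>n. x n $ i) \<longlongrightarrow> t $ i) F)"
proof
  assume *: "((\<lambda>n. ereal_vec (x n)) \<longlongrightarrow> ereal_vec t) F"
  show "\<forall>i. ((\<lambda>n. x n $ i) \<longlongrightarrow> t $ i) F"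
    using tendsto_vec_nth[OF *] by (simp add: ereal_vec_def)
next
  assume "\<forall>i. ((\<lambda>n. x n $ i) \<longlongrightarrow> t $ i) F"
  then show "((\<lambda>n. ereal_vec (x n)) \<longlongrightarrow> ereal_vec t) F"
    by (intro vec_tendstoI) (simp add: ereal_vec_def)
qed

context moving_targets
begin

text \<open>A compactness argument: if no \<epsilon> works, times violating it for 1, 1/2, 1/3, ...
  have a convergent subsequence. The scale \<open>A\<close> that is good for its limit is a fixed
  competitor along the subsequence, and passing to the limit contradicts the strict
  inequality.\<close>

lemma uniform_exponent_gap:
  fixes \<tau> :: "nat \<Rightarrow> real ^ 'd"
  assumes crit: "\<And>l r. strict_mono r \<Longrightarrow> (\<lambda>n. ereal_vec (\<tau> (r n))) \<longlonglongrightarrow> l \<Longrightarrow>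
      \<exists>t A. l = ereal_vec t \<and> a0 \<le> A \<and> (\<Sum>i\<in>UNIV. \<Phi> (ln (\<beta> i)) (t $ i) A) < s * A"
  shows "\<exists>\<epsilon>>0. \<exists>N. \<forall>n\<ge>N. \<exists>A\<ge>a0. (\<Sum>i\<in>UNIV. \<Phi> (ln (\<beta> i)) (\<tau> n $ i) A) \<le> (s - \<epsilon>) * A"
proof (rule ccontr)
  let ?F = "\<lambda>t A. \<Sum>i\<in>UNIV. \<Phi> (ln (\<beta> i)) (t $ i) A"
  assume "\<not> ?thesis"
  then have neg: "\<exists>n\<ge>N. \<forall>A\<ge>a0. (s - \<epsilon>) * A < ?F (\<tau> n) A" if "0 < \<epsilon>" for \<epsilon> N
    using that by (meson not_le)
  have "\<exists>r. \<forall>k. (\<forall>A\<ge>a0. (s - 1 / real (Suc k)) * A < ?F (\<tau> (r k)) A) \<and> r k < r (Suc k)"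
  proof (rule dependent_nat_choice)
    show "\<exists>n. \<forall>A\<ge>a0. (s - 1 / real (Suc 0)) * A < ?F (\<tau> n) A" using neg[of "1 / real (Suc 0)" 0] by auto
    show "\<exists>m. (\<forall>A\<ge>a0. (s - 1 / real (Suc (Suc k))) * A < ?F (\<tau> m) A) \<and> n < m" for n k
      using neg[of "1 / real (Suc (Suc k))" "Suc n"] by (auto simp: Suc_le_eq)
  qed
  then obtain r where r: "\<And>k A. a0 \<le> A \<Longrightarrow> (s - 1 / real (Suc k)) * A < ?F (\<tau> (r k)) A" "strict_mono r"
    unfolding strict_mono_Suc_iff by blast
  obtain l q where q: "strict_mono q" "(\<lambda>k. ereal_vec (\<tau> (r (q k)))) \<longlonglongrightarrow> l"
    using ereal_vec_convergent_subsequence[of "\<lambda>k. ereal_vec (\<tau> (r k))"] by blast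
  then obtain t A where t: "l = ereal_vec t" "a0 \<le> A" "?F t A < s * A"
    using crit[of "r \<circ> q" l] strict_mono_o[OF r(2) q(1)] by (auto simp: o_def)
  have L1: "(\<lambda>k. ?F (\<tau> (r (q k))) A) \<longlonglongrightarrow> ?F t A"
    using q(2) unfolding t(1) tendsto_ereal_vec_iff by (intro tendsto_sum tendsto_\<Phi> tendsto_const) auto
  have L2: "(\<lambda>k. (s - 1 / real (Suc (q k))) * A) \<longlonglongrightarrow> (s - 0) * A"
    using LIMSEQ_subseq_LIMSEQ[OF LIMSEQ_Suc[OF lim_1_over_n] q(1)]
    by (intro tendsto_intros) (simp add: o_def)
  have "(s - 0) * A \<le> ?F t A"
    by (rule LIMSEQ_le[OF L2 L1]) (use r(1)[OF t(2)] in \<open>auto intro: less_imp_le\<close>)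
  then show False using t(3) by simp
qed

text \<open>Each time \<open>n\<close> is covered at its own scale \<open>A n\<close>, with cost
  about exp (- n \<epsilon> A_n). The common lower bound \<open>a0\<close> of the scales makes the
  diameters tend to 0 and the costs geometric.\<close>

lemma hausdorff_measure_limsup_hit_set_zero:
  fixes \<tau> :: "nat \<Rightarrow> real ^ 'd"
  assumes s: "0 < s" and a0: "0 < a0"
    and crit: "\<And>l r. strict_mono r \<Longrightarrow> (\<lambda>n. ereal_vec (\<tau> (r n))) \<longlonglongrightarrow> l \<Longrightarrow>
      \<exists>t A. l = ereal_vec t \<and> a0 \<le> A \<and> (\<Sum>i\<in>UNIV. \<Phi> (ln (\<beta> i)) (t $ i) A) < s * A"
    and B: "B \<subseteq> {x. infinite {n. x \<in> hit_set \<beta> f n (\<lambda>i. exp (- real n * \<tau> n $ i))}}"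
  shows "hausdorff_measure torus torus_dist s B = 0"
proof -
  obtain \<epsilon> N1 where \<epsilon>: "0 < \<epsilon>" and
    ex: "\<And>n. n \<ge> N1 \<Longrightarrow> \<exists>A\<ge>a0. (\<Sum>i\<in>UNIV. \<Phi> (ln (\<beta> i)) (\<tau> n $ i) A) \<le> (s - \<epsilon>) * A"
    using uniform_exponent_gap[of \<tau> a0 s] crit by meson
  have "\<forall>n. \<exists>A. a0 \<le> A \<and> (n \<ge> N1 \<longrightarrow> (\<Sum>i\<in>UNIV. \<Phi> (ln (\<beta> i)) (\<tau> n $ i) A) \<le> (s - \<epsilon>) * A)"
  proof
    fix n
    show "\<exists>A. a0 \<le> A \<and> (n \<ge> N1 \<longrightarrow> (\<Sum>i\<in>UNIV. \<Phi> (ln (\<beta> i)) (\<tau> n $ i) A) \<le> (s - \<epsilon>) * A)"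
    proof (cases "n \<ge> N1")
      case False
      then show ?thesis by (intro exI[of _ a0]) simp
    qed (use ex in simp)
  qed
  from choice[OF this] obtain A where A: "\<And>n. a0 \<le> A n"
    "\<And>n. n \<ge> N1 \<Longrightarrow> (\<Sum>i\<in>UNIV. \<Phi> (ln (\<beta> i)) (\<tau> n $ i) (A n)) \<le> (s - \<epsilon>) * A n" by blast
  obtain N0 K where K: "0 < K" and cover: "\<forall>n\<ge>N0. \<forall>t A. 0 < A \<longrightarrow> (\<exists>\<U>. finite \<U> \<and>
     hit_set \<beta> f n (\<lambda>i. exp (- real n * t i)) \<subseteq> \<Union>\<U> \<and>
     (\<forall>U\<in>\<U>. U \<subseteq> torus \<and> (\<forall>x\<in>U. \<forall>y\<in>U. torus_dist x y \<le> 2 * real CARD('d) * exp (- real n * A))) \<and>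
     real (card \<U>) \<le> K * exp (real n * (\<Sum>i\<in>UNIV. \<Phi> (ln (\<beta> i)) (t i) A)))"
    using hit_set_cover by (elim exE conjE)
  define k where "k = 2 * real CARD('d)"
  define D where "D = (\<lambda>n. k * exp (- real n * A n))"
  have k: "0 < k" by (simp add: k_def)
  have Apos: "0 < A n" for n using A(1)[of n] a0 by linarith
  have expa: "exp (- real n * x) = exp (- x) ^ n" for n and x :: real
    by (simp add: exp_of_nat_mult[symmetric])
  show ?thesis
  proof (rule hausdorff_measure_limsup_zero[OF s torus_dist_nonneg, where D = D and q = "exp (- (\<epsilon> * a0))"
        and K = "K * k powr s" and ?N0.0 = "max N0 N1"
        and A = "\<lambda>n. hit_set \<beta> f n (\<lambda>i. exp (- real n * \<tau> n $ i))"])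
    show "B \<subseteq> {x. infinite {n. x \<in> hit_set \<beta> f n (\<lambda>i. exp (- real n * \<tau> n $ i))}}" by (rule B)
    show "0 \<le> exp (- (\<epsilon> * a0))" "exp (- (\<epsilon> * a0)) < 1" using \<epsilon> a0 by auto
    show "0 \<le> D n" for n using k by (simp add: D_def)
    have "(\<lambda>n. k * exp (- a0) ^ n) \<longlonglongrightarrow> k * 0"
      using a0 by (intro tendsto_intros LIMSEQ_realpow_zero) auto
    then have L: "(\<lambda>n. k * exp (- a0) ^ n) \<longlonglongrightarrow> 0" by simp
    have "D n \<le> k * exp (- a0) ^ n" for n
      unfolding D_def expa[symmetric] using k A(1)[of n] by (simp add: mult_left_mono)
    moreover have "0 \<le> D n" for n using k by (simp add: D_def)
    ultimately show "D \<longlonglongrightarrow> 0"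
      using tendsto_sandwich[OF _ _ tendsto_const L, of D] by simp
    fix n assume n: "n \<ge> max N0 N1"
    let ?F = "\<Sum>i\<in>UNIV. \<Phi> (ln (\<beta> i)) (\<tau> n $ i) (A n)"
    obtain \<U> where U: "finite \<U>" "hit_set \<beta> f n (\<lambda>i. exp (- real n * \<tau> n $ i)) \<subseteq> \<Union>\<U>"
     "\<forall>U\<in>\<U>. U \<subseteq> torus \<and> (\<forall>x\<in>U. \<forall>y\<in>U. torus_dist x y \<le> D n)"
     "real (card \<U>) \<le> K * exp (real n * ?F)"
      using cover[rule_format, OF _ Apos[of n], of n "\<lambda>i. \<tau> n $ i"] n unfolding D_def k_def by auto
    have Dn: "D n powr s = k powr s * exp (- (real n * A n * s))"
      using k by (simp add: D_def powr_mult exp_powr_real)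
    have "real (card \<U>) * D n powr s \<le> K * exp (real n * ?F) * D n powr s"
      using U(4) by (intro mult_right_mono) auto
    also have "\<dots> = K * k powr s * exp (real n * (?F - A n * s))"
      unfolding Dn by (simp add: exp_diff exp_minus right_diff_distrib divide_inverse mult_ac)
    also have "\<dots> \<le> K * k powr s * exp (real n * (- (\<epsilon> * a0)))"
    proof -
      have "\<epsilon> * a0 \<le> \<epsilon> * A n" using \<epsilon> A(1) by simp
      then have "?F - A n * s \<le> - (\<epsilon> * a0)" using A(2)[of n] n by (simp add: algebra_simps)
      from mult_left_mono[OF this, of "real n"] show ?thesis
        using K by (intro mult_left_mono) simp_all
    qed
    also have "\<dots> = K * k powr s * exp (- (\<epsilon> * a0)) ^ n" using expa[of n "\<epsilon> * a0"] by simp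
    finally have le: "real (card \<U>) * D n powr s \<le> K * k powr s * exp (- (\<epsilon> * a0)) ^ n" .
    show "\<exists>\<U>. finite \<U> \<and> hit_set \<beta> f n (\<lambda>i. exp (- real n * \<tau> n $ i)) \<subseteq> \<Union>\<U> \<and>
      (\<forall>U\<in>\<U>. U \<subseteq> torus \<and> (\<forall>x\<in>U. \<forall>y\<in>U. torus_dist x y \<le> D n)) \<and>
      real (card \<U>) * D n powr s \<le> K * k powr s * exp (- (\<epsilon> * a0)) ^ n"
      by (rule exI[of _ \<U>]) (intro conjI U(1,2,3) le)
  qed
qed

end

section \<open>Solutions inside a cylinder\<close>

text \<open>The representative of \<open>v\<close> modulo 1 nearest to \<open>y\<close>, written as
  \<open>y\<close> plus the signed displacement.\<close>

definition circle_lift :: "real \<Rightarrow> real \<Rightarrow> real" where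
  "circle_lift y v = y + (v - y - of_int (round (v - y)))"

lemma circle_lift_near: "\<bar>circle_lift y v - y\<bar> = circle_dist v y"
  by (simp add: circle_lift_def circle_dist_alt)

text \<open>Both lifts lie within 1/8 of \<open>y\<close>, hence within 1/2 of each other, where
  circle and line distance agree. This turns a target that is Lipschitz modulo 1 into a real-valued
  Lipschitz function.\<close>

lemma circle_lift_diff_le:
  assumes "circle_dist v y \<le> 1 / 8" "circle_dist v' y \<le> 1 / 8"
  shows "\<bar>circle_lift y v - circle_lift y v'\<bar> \<le> circle_dist v v'"
proof -
  have "\<bar>circle_lift y v - circle_lift y v'\<bar> \<le> 1 / 2"
    using assms circle_lift_near[of y v] circle_lift_near[of y v'] by linarith
  then have "\<bar>circle_lift y v - circle_lift y v'\<bar> = circle_dist (circle_lift y v) (circle_lift y v')"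
    by (rule circle_dist_eq[symmetric])
  also have "\<dots> \<le> \<bar>circle_lift y v - circle_lift y v' -
      of_int (round (v - v') - round (v - y) + round (v' - y))\<bar>"
    by (rule circle_dist_le)
  also have "\<dots> = circle_dist v v'"
    by (simp add: circle_lift_def circle_dist_alt)
  finally show ?thesis .
qed

definition cube :: "real ^ 'd \<Rightarrow> real \<Rightarrow> (real ^ 'd) set" where
  "cube a \<sigma> = {x. \<forall>j. a $ j \<le> x $ j \<and> x $ j \<le> a $ j + \<sigma>}"

context moving_targets
begin

text \<open>A safety margin. The image of a cylinder of order \<open>n - 1\<close> lifts to [0,
  \<beta>), and a target lifted into [gap, 1 + gap) keeps the distance \<open>gap\<close> from both
  ends because 1 + 2 gap <= \<beta>. The cap 1/2 gives gap / 4 <= 1/8, as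
  \<open>circle_lift_diff_le\<close> requires.\<close>

definition gap :: "'d \<Rightarrow> real" where
  "gap j = min ((\<beta> j - 1) / 2) (1 / 2)"

lemma gap: "0 < gap j" "gap j \<le> 1 / 2" "1 + 2 * gap j \<le> \<beta> j"
  using \<beta>[of j] by (auto simp: gap_def min_def field_simps)

text \<open>On a full cylinder of order \<open>n - 1\<close> the \<open>n\<close>-th iterate is, as a map into the circle, affine
  and onto with overlap: its lift has length \<open>\<beta> j > 1\<close>. Hence every target has a lift that stays away
  from both ends of the cylinder, whatever the (only Lipschitz) target function does. On full
  cylinders of order \<open>n\<close> this can fail: the solution may escape through an end point.\<close>

definition good_time :: "nat \<Rightarrow> bool" where
  "good_time n \<longleftrightarrow> 1 \<le> n \<and> (\<forall>j. 4 * c * real CARD('d) \<le> \<beta> j ^ n) \<and>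
     (\<forall>j. c * (\<Sum>i\<in>UNIV. \<beta> i / \<beta> i ^ n) \<le> gap j / 4) \<and> c * (\<Sum>i\<in>UNIV. 1 / \<beta> i ^ n) \<le> 1 / 2"

lemma eventually_good_time: "\<forall>\<^sub>F n in sequentially. good_time n"
proof -
  have "\<forall>\<^sub>F n in sequentially. 4 * c * real CARD('d) \<le> \<beta> j ^ n" for j
  proof -
    obtain N where "4 * c * real CARD('d) < \<beta> j ^ N"
      using real_arch_pow[OF \<beta>] by blast
    moreover have "\<beta> j ^ N \<le> \<beta> j ^ n" if "N \<le> n" for n
      using power_increasing[of N n "\<beta> j"] that \<beta>[of j] by simp
    ultimately have "4 * c * real CARD('d) \<le> \<beta> j ^ n" if "N \<le> n" for n
      using that by fastforce
    then show ?thesis unfolding eventually_sequentially by blast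
  qed
  moreover have "\<forall>\<^sub>F n in sequentially. c * (\<Sum>i\<in>UNIV. \<beta> i / \<beta> i ^ n) \<le> gap j / 4" for j
  proof -
    define B where "B = Max (range \<beta>)"
    have B: "\<beta> i \<le> B" for i unfolding B_def by simp
    then have "0 < B" using \<beta>[of undefined] B[of undefined] by linarith
    have "\<forall>\<^sub>F n in sequentially. (\<Sum>i\<in>UNIV. 1 / \<beta> i ^ n) < gap j / (4 * c * B)"
      using gap(1)[of j] c \<open>0 < B\<close> by (intro eventually_inverse_power_small) auto
    then show ?thesis
    proof eventually_elim
      case (elim n)
      have "(\<Sum>i\<in>UNIV. \<beta> i / \<beta> i ^ n) \<le> (\<Sum>i\<in>UNIV. B * (1 / \<beta> i ^ n))"
        using B \<beta> by (intro sum_mono) (simp add: divide_right_mono less_imp_le order.strict_trans[OF zero_less_one])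
      also have "\<dots> = B * (\<Sum>i\<in>UNIV. 1 / \<beta> i ^ n)" by (simp add: sum_distrib_left)
      also have "\<dots> \<le> B * (gap j / (4 * c * B))"
        using elim \<open>0 < B\<close> by (intro mult_left_mono) auto
      finally have "(\<Sum>i\<in>UNIV. \<beta> i / \<beta> i ^ n) \<le> gap j / (4 * c)" using \<open>0 < B\<close> by simp
      then show ?case using c by (simp add: field_simps)
    qed
  qed
  moreover have "\<forall>\<^sub>F n in sequentially. c * (\<Sum>i\<in>UNIV. 1 / \<beta> i ^ n) \<le> 1 / 2"
    using eventually_inverse_power_small[of "1 / (2 * c)"] c
    by (auto elim!: eventually_mono simp: field_simps)
  ultimately show ?thesis
    unfolding good_time_def by (intro eventually_conj eventually_all_finite eventually_ge_at_top)
qed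

text \<open>A grid step 4 \<sigma> becomes 4 \<sigma> \<beta>^n after \<open>n\<close> iterates, so
  admissible offsets fill at most half of the target radius. The other half is reserved for the side
  of the cube and the motion of the target across it.\<close>

definition admissible :: "nat \<Rightarrow> ('d \<Rightarrow> real) \<Rightarrow> real \<Rightarrow> ('d \<Rightarrow> nat) \<Rightarrow> bool" where
  "admissible n p \<sigma> i \<longleftrightarrow> (\<forall>j. 8 * \<sigma> * \<beta> j ^ n * real (i j) \<le> p j)"

text \<open>The cubes of side \<open>\<sigma>\<close> at the points \<open>g i\<close> consist of solutions in the cylinder at \<open>z\<close>, and
  the \<open>g i\<close> form an almost regular grid of spacing \<open>4 \<sigma>\<close> in a sheared box.\<close>

definition solution_grid ::
    "nat \<Rightarrow> ('d \<Rightarrow> real) \<Rightarrow> real \<Rightarrow> real ^ 'd \<Rightarrow> (('d \<Rightarrow> nat) \<Rightarrow> real ^ 'd) \<Rightarrow> bool" where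
  "solution_grid n p \<sigma> z g \<longleftrightarrow>
     (\<forall>i j. admissible n p \<sigma> i \<longrightarrow> z $ j \<le> g i $ j \<and> g i $ j + \<sigma> < z $ j + 1 / \<beta> j ^ (n - 1)) \<and>
     (\<forall>i. admissible n p \<sigma> i \<longrightarrow> cube (g i) \<sigma> \<subseteq> hit_set \<beta> f n p) \<and>
     (\<forall>i i' R j. admissible n p \<sigma> i \<longrightarrow> admissible n p \<sigma> i' \<longrightarrow> (\<forall>k. \<bar>g i $ k - g i' $ k\<bar> \<le> R) \<longrightarrow>
       \<bar>g i $ j - g i' $ j - 4 * \<sigma> * (real (i j) - real (i' j))\<bar> \<le> R / 4)"

text \<open>A point whose iterate is displaced by a prescribed offset from its own moving target is
  a fixed point: invert the affine branch at target plus offset. The inverse branches contract by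
  \<beta>^(-n), which beats the Lipschitz constant at a good time.\<close>

lemma solution_cubes:
  fixes z :: "real ^ 'd" and p :: "'d \<Rightarrow> real"
  assumes n: "good_time n"
    and z: "\<And>j. z $ j \<in> full_cyl (\<beta> j) (n - 1)"
    and p: "\<And>j. 0 < p j" "\<And>j. p j \<le> gap j / 2"
    and \<sigma>: "0 < \<sigma>" "\<And>j. \<beta> j ^ n * \<sigma> \<le> p j / 8"
  shows "\<exists>g. solution_grid n p \<sigma> z g"
proof -
  have n1: "1 \<le> n" and n2: "\<And>j. 4 * c * real CARD('d) \<le> \<beta> j ^ n"
    and n3: "\<And>j. c * (\<Sum>i\<in>UNIV. \<beta> i / \<beta> i ^ n) \<le> gap j / 4"
    and n4: "c * (\<Sum>i\<in>UNIV. 1 / \<beta> i ^ n) \<le> 1 / 2"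
    using n by (auto simp: good_time_def)
  have pos: "0 < \<beta> j ^ n" "0 < \<beta> j" for j using \<beta>[of j] by auto
  have len: "1 / \<beta> j ^ (n - 1) = \<beta> j / \<beta> j ^ n" for j
    using n1 pos[of j] by (cases n) (auto simp: field_simps)
  define B where "B = {x :: real ^ 'd. \<forall>j. z $ j \<le> x $ j \<and> x $ j < z $ j + \<beta> j / \<beta> j ^ n}"
  have zB: "z \<in> B" using pos by (auto simp: B_def)
  have B_torus: "x \<in> torus" if "x \<in> B" for x
    unfolding torus_def
  proof (intro CollectI allI)
    fix j
    have "0 \<le> z $ j" "z $ j + \<beta> j / \<beta> j ^ n \<le> 1" using z[of j] len[of j] by (auto simp: full_cyl_def)
    moreover have "z $ j \<le> x $ j" "x $ j < z $ j + \<beta> j / \<beta> j ^ n" using that by (auto simp: B_def)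
    ultimately show "0 \<le> x $ j \<and> x $ j < 1" by linarith
  qed
  \<comment> \<open>The lift of the target at the corner \<open>z\<close> into [gap, 1 + gap). On
    the whole cylinder the target stays within gap / 4 of it, so a single lift serves all
    points.\<close>
  define y where "y = (\<lambda>j. frac (f n z $ j - gap j) + gap j)"
  have y: "gap j \<le> y j" "y j < 1 + gap j" for j
    by (auto simp: y_def frac_lt_1 add.commute)
  have y_eq: "circle_dist v (y j) \<le> circle_dist v (f n z $ j)" for v j
  proof -
    obtain k :: int where k: "y j = f n z $ j - of_int k"
      unfolding y_def frac_def by auto
    show ?thesis
      using circle_dist_le[of v "y j" "round (v - f n z $ j) + k"] by (simp add: k circle_dist_alt[of v "f n z $ j"])
  qed
  define h where "h = (\<lambda>x j. circle_lift (y j) (f n x $ j))"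
  have near: "circle_dist (f n x $ j) (y j) \<le> gap j / 4" if "x \<in> B" for x j
  proof -
    have "circle_dist (f n x $ j) (y j) \<le> c * norm (x - z)"
      using circle_dist_target_le[OF n1 B_torus[OF that] B_torus[OF zB], of j] y_eq order_trans by blast
    also have "\<dots> \<le> c * (\<Sum>i\<in>UNIV. \<beta> i / \<beta> i ^ n)"
    proof (intro mult_left_mono order_trans[OF norm_le_l1_cart] sum_mono)
      fix i show "\<bar>(x - z) $ i\<bar> \<le> \<beta> i / \<beta> i ^ n"
        using that unfolding B_def by (simp add: abs_le_iff) (smt (verit, del_insts))
    qed (use c in simp)
    finally show ?thesis using n3[of j] by linarith
  qed
  have h_near: "\<bar>h x j - y j\<bar> \<le> gap j / 4" if "x \<in> B" for x j
    using near[OF that, of j] by (simp add: h_def circle_lift_near)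
  have h_lip: "\<bar>h x j - h x' j\<bar> \<le> c * norm (x - x')" if "x \<in> B" "x' \<in> B" for x x' j
  proof -
    have "\<bar>h x j - h x' j\<bar> \<le> circle_dist (f n x $ j) (f n x' $ j)"
      unfolding h_def using near[OF that(1), of j] near[OF that(2), of j] gap(2)[of j]
      by (intro circle_lift_diff_le) linarith+
    then show ?thesis
      using circle_dist_target_le[OF n1 B_torus[OF that(1)] B_torus[OF that(2)], of j] by linarith
  qed
  define adm where "adm = admissible n p \<sigma>"
  define r where "r = (\<lambda>i j. 4 * \<sigma> * \<beta> j ^ n * real (i j :: nat))"
  \<comment> \<open>A closed, hence complete, subset of the half-open cylinder. Lifted target plus
    offset is at most 1 + 3 gap / 2 <= \<beta> - gap / 2, so the contraction preserves it, and the
    missing gap / 2 is room for the cube.\<close>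
  define B' where "B' = {x :: real ^ 'd. \<forall>j. z $ j \<le> x $ j \<and> x $ j \<le> z $ j + (\<beta> j - gap j / 2) / \<beta> j ^ n}"
  have B'B: "B' \<subseteq> B"
  proof
    fix x assume x: "x \<in> B'"
    have "z $ j \<le> x $ j \<and> x $ j < z $ j + \<beta> j / \<beta> j ^ n" for j
    proof -
      have "(\<beta> j - gap j / 2) / \<beta> j ^ n < \<beta> j / \<beta> j ^ n"
        using gap(1)[of j] pos[of j] by (intro divide_strict_right_mono) auto
      moreover have "z $ j \<le> x $ j" "x $ j \<le> z $ j + (\<beta> j - gap j / 2) / \<beta> j ^ n"
        using x by (auto simp: B'_def)
      ultimately show ?thesis by linarith
    qed
    then show "x \<in> B" by (simp add: B_def)
  qed
  have "\<exists>x\<in>B'. \<forall>j. \<beta> j ^ n * (x $ j - z $ j) = h x j + r i j" if "adm i" for i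
  proof -
    have r: "0 \<le> r i j" "r i j \<le> gap j / 4" for j
    proof -
      show "0 \<le> r i j" using \<sigma>(1) pos[of j] by (simp add: r_def)
      have "8 * \<sigma> * \<beta> j ^ n * real (i j) \<le> p j" using that by (simp add: adm_def admissible_def)
      then show "r i j \<le> gap j / 4" using p(2)[of j] unfolding r_def by linarith
    qed
    define \<Gamma> where "\<Gamma> = (\<lambda>x. (\<chi> j. z $ j + (h x j + r i j) / \<beta> j ^ n) :: real ^ 'd)"
    have "\<exists>!x. x \<in> B' \<and> \<Gamma> x = x"
    proof (rule Banach_fix[of B' "1 / 2" \<Gamma>])
      have "B' = cbox z (\<chi> j. z $ j + (\<beta> j - gap j / 2) / \<beta> j ^ n)"
        by (auto simp: B'_def mem_box_cart)
      then show "complete B'" by (simp add: compact_imp_complete)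
      have "0 \<le> (\<beta> j - gap j / 2) / \<beta> j ^ n" for j
        using gap[of j] pos[of j] by (intro divide_nonneg_pos) auto
      then have "z \<in> B'" by (auto simp: B'_def)
      then show "B' \<noteq> {}" by blast
      show "\<Gamma> ` B' \<subseteq> B'"
      proof
        fix x' assume "x' \<in> \<Gamma> ` B'"
        then obtain x where x: "x \<in> B'" "x' = \<Gamma> x" by blast
        have "0 \<le> h x j + r i j \<and> h x j + r i j \<le> \<beta> j - gap j / 2" for j
        proof -
          have "\<bar>h x j - y j\<bar> \<le> gap j / 4" using h_near x(1) B'B by blast
          then show ?thesis using y[of j] r[of j] gap[of j] by linarith
        qed
        then show "x' \<in> B'"
          using pos unfolding x(2) B'_def \<Gamma>_def by (simp add: divide_right_mono less_imp_le)
      qed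
      show "dist (\<Gamma> x) (\<Gamma> x') \<le> 1 / 2 * dist x x'" if "x \<in> B'" "x' \<in> B'" for x x'
      proof -
        have "dist (\<Gamma> x) (\<Gamma> x') \<le> (\<Sum>j\<in>UNIV. \<bar>(\<Gamma> x - \<Gamma> x') $ j\<bar>)"
          unfolding dist_norm by (rule norm_le_l1_cart)
        also have "\<dots> \<le> (\<Sum>j\<in>UNIV. c * norm (x - x') * (1 / \<beta> j ^ n))"
        proof (rule sum_mono)
          fix j
          have "\<bar>(\<Gamma> x - \<Gamma> x') $ j\<bar> = \<bar>h x j - h x' j\<bar> / \<beta> j ^ n"
            using pos[of j] by (simp add: \<Gamma>_def diff_divide_distrib[symmetric] abs_divide)
          also have "\<dots> \<le> c * norm (x - x') / \<beta> j ^ n"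
            using pos[of j] h_lip[of x x' j] that B'B by (intro divide_right_mono) auto
          finally show "\<bar>(\<Gamma> x - \<Gamma> x') $ j\<bar> \<le> c * norm (x - x') * (1 / \<beta> j ^ n)" by simp
        qed
        also have "\<dots> = (c * (\<Sum>j\<in>UNIV. 1 / \<beta> j ^ n)) * norm (x - x')"
          by (simp add: sum_distrib_left sum_distrib_right mult_ac)
        also have "\<dots> \<le> 1 / 2 * norm (x - x')"
          using n4 by (intro mult_right_mono) auto
        finally show ?thesis by (simp add: dist_norm)
      qed
    qed auto
    then obtain x where x: "x \<in> B'" "\<Gamma> x = x" by blast
    have "\<beta> j ^ n * (x $ j - z $ j) = h x j + r i j" for j
    proof -
      have "x $ j = z $ j + (h x j + r i j) / \<beta> j ^ n"
        using arg_cong[OF x(2), of "\<lambda>v. v $ j"] by (simp add: \<Gamma>_def)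
      then show ?thesis using pos[of j] by (simp add: field_simps)
    qed
    then show ?thesis using x(1) by blast
  qed
  then have "\<forall>i. \<exists>x. adm i \<longrightarrow> x \<in> B' \<and> (\<forall>j. \<beta> j ^ n * (x $ j - z $ j) = h x j + r i j)" by blast
  from choice[OF this] obtain g where
    g: "\<And>i. adm i \<Longrightarrow> g i \<in> B'" "\<And>i j. adm i \<Longrightarrow> \<beta> j ^ n * (g i $ j - z $ j) = h (g i) j + r i j"
    by blast
  have cube: "x \<in> B" if i: "adm i" and x: "\<And>j. g i $ j \<le> x $ j \<and> x $ j \<le> g i $ j + \<sigma>" for i x
  proof -
    have "z $ j \<le> x $ j \<and> x $ j < z $ j + \<beta> j / \<beta> j ^ n" for j
    proof -
      have "z $ j \<le> g i $ j" "g i $ j \<le> z $ j + (\<beta> j - gap j / 2) / \<beta> j ^ n"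
        using g(1)[OF i] by (auto simp: B'_def)
      moreover have "(\<beta> j - gap j / 2) / \<beta> j ^ n + \<sigma> < \<beta> j / \<beta> j ^ n"
      proof -
        have "\<beta> j ^ n * \<sigma> < gap j / 2" using \<sigma>(2)[of j] p(2)[of j] gap(1)[of j] by linarith
        then have "\<sigma> < gap j / 2 / \<beta> j ^ n" using pos[of j] by (simp add: pos_less_divide_eq mult.commute)
        then show ?thesis by (simp add: diff_divide_distrib)
      qed
      ultimately show ?thesis using x[of j] by linarith
    qed
    then show ?thesis by (simp add: B_def)
  qed
  have sum_le: "norm x \<le> real CARD('d) * R" if "\<And>k. \<bar>x $ k\<bar> \<le> R" for x :: "real ^ 'd" and R
  proof -
    have "norm x \<le> (\<Sum>k\<in>(UNIV :: 'd set). R)"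
      using that by (intro order_trans[OF norm_le_l1_cart] sum_mono)
    then show ?thesis by simp
  qed
  have c_small: "c * (real CARD('d) * R) \<le> \<beta> j ^ n * R / 4" if "0 \<le> R" for j R
    using mult_right_mono[OF n2[of j] that] by simp
  have hit: "x \<in> hit_set \<beta> f n p" if i: "adm i" and x: "\<And>j. g i $ j \<le> x $ j \<and> x $ j \<le> g i $ j + \<sigma>" for i x
  proof -
    have xB: "x \<in> B" using cube[OF i x] .
    have gB: "g i \<in> B" using g(1)[OF i] B'B by blast
    have "circle_dist ((btrans (\<beta> j) ^^ n) (x $ j)) (f n x $ j) < p j" for j
    proof -
      define u where "u = \<beta> j ^ n * (x $ j - z $ j)"
      obtain m where m: "n = Suc m" using n1 by (cases n) auto
      have "(btrans (\<beta> j) ^^ m) (x $ j) = \<beta> j ^ m * (x $ j - z $ j)"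
        using xB z[of j] len[of j] m by (intro full_cylD) (auto simp: B_def simp del: power_Suc)
      then have T: "(btrans (\<beta> j) ^^ n) (x $ j) = frac u"
        by (simp add: m btrans_def u_def mult.assoc)
      \<comment> \<open>The integer is chosen to undo both reductions modulo 1: from
        \<open>u\<close> to its fractional part and from the target to its lift.\<close>
      have "circle_dist (frac u) (f n x $ j) \<le>
          \<bar>frac u - f n x $ j - of_int (- \<lfloor>u\<rfloor> - round (f n x $ j - y j))\<bar>"
        by (rule circle_dist_le)
      also have "\<dots> = \<bar>u - h x j\<bar>"
        by (simp add: frac_def h_def circle_lift_def)
      also have "u - h x j = r i j + \<beta> j ^ n * (x $ j - g i $ j) - (h x j - h (g i) j)"
        using g(2)[OF i, of j] by (simp add: u_def algebra_simps)
      also have "\<bar>\<dots>\<bar> \<le> r i j + \<beta> j ^ n * \<sigma> + c * norm (x - g i)"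
      proof -
        have "0 \<le> r i j" using \<sigma>(1) pos[of j] by (simp add: r_def)
        moreover have "0 \<le> \<beta> j ^ n * (x $ j - g i $ j)" "\<beta> j ^ n * (x $ j - g i $ j) \<le> \<beta> j ^ n * \<sigma>"
          using x[of j] pos[of j] by auto
        ultimately show ?thesis using h_lip[OF xB gB, of j] by (simp add: abs_le_iff)
      qed
      also have "c * norm (x - g i) \<le> c * (real CARD('d) * \<sigma>)"
        using x c by (intro mult_left_mono sum_le) (auto simp: abs_le_iff algebra_simps)
      also have "\<dots> \<le> \<beta> j ^ n * \<sigma> / 4" using \<sigma>(1) by (intro c_small) simp
      \<comment> \<open>The budget is p/2 for the offset, p/8 for the side and p/32 for the motion
        of the target.\<close>
      also have "r i j + \<beta> j ^ n * \<sigma> + \<beta> j ^ n * \<sigma> / 4 < p j"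
      proof -
        have "8 * \<sigma> * \<beta> j ^ n * real (i j) \<le> p j" using i by (simp add: adm_def admissible_def)
        then show ?thesis using \<sigma>(2)[of j] p(1)[of j] unfolding r_def by linarith
      qed
      finally show ?thesis using T by simp
    qed
    then show ?thesis using B_torus[OF xB] by (simp add: hit_set_def)
  qed
  have grid: "\<bar>g i $ j - g i' $ j - 4 * \<sigma> * (real (i j) - real (i' j))\<bar> \<le> R / 4"
    if i: "adm i" "adm i'" and R: "\<And>k. \<bar>g i $ k - g i' $ k\<bar> \<le> R" for i i' j R
  proof -
    have R0: "0 \<le> R" using R[of undefined] by linarith
    have gB: "g i \<in> B" "g i' \<in> B" using g(1) i B'B by blast+
    have "\<beta> j ^ n * (g i $ j - g i' $ j - 4 * \<sigma> * (real (i j) - real (i' j))) = h (g i) j - h (g i') j"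
      using g(2)[OF i(1), of j] g(2)[OF i(2), of j] by (simp add: r_def algebra_simps)
    then have "\<beta> j ^ n * \<bar>g i $ j - g i' $ j - 4 * \<sigma> * (real (i j) - real (i' j))\<bar> = \<bar>h (g i) j - h (g i') j\<bar>"
      using pos(1)[of j] by (metis abs_mult abs_of_pos)
    also have "\<dots> \<le> c * norm (g i - g i')" by (rule h_lip[OF gB])
    also have "\<dots> \<le> c * (real CARD('d) * R)"
      using R c by (intro mult_left_mono sum_le) auto
    also have "\<dots> \<le> \<beta> j ^ n * (R / 4)" using c_small[OF R0, of j] by simp
    finally show ?thesis using pos(1)[of j] by simp
  qed
  have ends: "z $ j \<le> g i $ j \<and> g i $ j + \<sigma> < z $ j + 1 / \<beta> j ^ (n - 1)" if "adm i" for i j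
  proof -
    have "(\<chi> k. g i $ k + \<sigma>) \<in> B" using cube[OF that, of "\<chi> k. g i $ k + \<sigma>"] \<sigma>(1) by simp
    moreover have "g i \<in> B" using g(1)[OF that] B'B by blast
    ultimately show ?thesis unfolding len by (simp add: B_def)
  qed
  show ?thesis
    unfolding solution_grid_def cube_def adm_def[symmetric]
    using hit grid ends by (intro exI[of _ g] conjI allI impI) blast+
qed

end

section \<open>Families of cubes\<close>

text \<open>A family is given by the lower corners of its cubes. Separation of the corners by the
  common side in some coordinate means that distinct cubes meet at most along their
  boundaries.\<close>

definition cube_family :: "(real ^ 'd) set \<Rightarrow> real \<Rightarrow> bool" where
  "cube_family L \<sigma> \<longleftrightarrow> finite L \<and> L \<noteq> {} \<and> 0 < \<sigma> \<and>
     (\<forall>a\<in>L. \<forall>j. 0 \<le> a $ j \<and> a $ j + \<sigma> \<le> 1) \<and>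
     (\<forall>a\<in>L. \<forall>b\<in>L. a \<noteq> b \<longrightarrow> (\<exists>j. \<sigma> \<le> \<bar>a $ j - b $ j\<bar>))"

lemma card_vec_product:
  fixes S :: "'d::finite \<Rightarrow> 'a set"
  assumes "\<And>j. finite (S j)"
  shows "finite {z :: 'a ^ 'd. \<forall>j. z $ j \<in> S j}"
    and "card {z :: 'a ^ 'd. \<forall>j. z $ j \<in> S j} = (\<Prod>j\<in>UNIV. card (S j))"
proof -
  have "bij_betw vec_lambda (PiE UNIV S) {z :: 'a ^ 'd. \<forall>j. z $ j \<in> S j}"
    by (rule bij_betw_byWitness[where f' = vec_nth]) auto
  moreover have "finite (PiE UNIV S)" using assms by (intro finite_PiE) auto
  ultimately show "finite {z :: 'a ^ 'd. \<forall>j. z $ j \<in> S j}"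
    "card {z :: 'a ^ 'd. \<forall>j. z $ j \<in> S j} = (\<Prod>j\<in>UNIV. card (S j))"
    using bij_betw_finite bij_betw_same_card card_PiE[of UNIV S] by force+
qed

text \<open>Rounding corners with step \<sigma> is injective by separation. Relative to
  \<open>x\<close> the rounded coordinates lie between -3 and 2, which leaves six values
  each.\<close>

lemma cube_family_card_near:
  fixes L :: "(real ^ 'd::finite) set"
  assumes L: "cube_family L \<sigma>" and \<rho>: "\<rho> \<le> 2 * \<sigma>"
  shows "card {a \<in> L. \<forall>j. x $ j - \<rho> - \<sigma> \<le> a $ j \<and> a $ j \<le> x $ j + \<rho>} \<le> 6 ^ CARD('d)"
proof -
  define N where "N = {a \<in> L. \<forall>j. x $ j - \<rho> - \<sigma> \<le> a $ j \<and> a $ j \<le> x $ j + \<rho>}"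
  define q where "q = (\<lambda>a. \<chi> j. \<lfloor>(a $ j - x $ j) / \<sigma>\<rfloor>)"
  have \<sigma>: "0 < \<sigma>" using L by (simp add: cube_family_def)
  have "inj_on q N"
  proof (rule inj_onI, rule ccontr)
    fix a b assume ab: "a \<in> N" "b \<in> N" "q a = q b" "a \<noteq> b"
    then obtain j where j: "\<sigma> \<le> \<bar>a $ j - b $ j\<bar>" using L unfolding cube_family_def N_def by blast
    have "\<lfloor>(a $ j - x $ j) / \<sigma>\<rfloor> = \<lfloor>(b $ j - x $ j) / \<sigma>\<rfloor>"
      using arg_cong[OF ab(3), of "\<lambda>v. v $ j"] by (simp add: q_def)
    then have "\<bar>(a $ j - x $ j) / \<sigma> - (b $ j - x $ j) / \<sigma>\<bar> < 1" by linarith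
    then have "\<bar>a $ j - b $ j\<bar> < \<sigma>" using \<sigma> by (simp add: diff_divide_distrib[symmetric] abs_divide)
    then show False using j by simp
  qed
  moreover have "q ` N \<subseteq> {z. \<forall>j. z $ j \<in> {-3..2}}"
  proof (intro subsetI CollectI allI)
    fix z j assume "z \<in> q ` N"
    then obtain a where a: "a \<in> N" "z = q a" by blast
    have "- 3 \<le> (a $ j - x $ j) / \<sigma>" "(a $ j - x $ j) / \<sigma> \<le> 2"
      using a(1) \<rho> \<sigma> by (auto simp: N_def pos_le_divide_eq pos_divide_le_eq dest!: spec[of _ j])
    then show "z $ j \<in> {-3..2}" by (simp add: a(2) q_def floor_le_iff le_floor_iff)
  qed
  ultimately have "card N \<le> card {z :: int ^ 'd. \<forall>j. z $ j \<in> {-3..2}}"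
    by (intro card_inj_on_le card_vec_product) auto
  also have "\<dots> = 6 ^ CARD('d)" by (subst card_vec_product) auto
  finally show ?thesis by (simp add: N_def)
qed

lemma card_nat_near:
  assumes "0 \<le> w"
  shows "finite {k :: nat. \<bar>real k - u\<bar> \<le> w}" "real (card {k :: nat. \<bar>real k - u\<bar> \<le> w}) \<le> 2 * w + 1"
proof -
  let ?S = "real ` {k :: nat. \<bar>real k - u\<bar> \<le> w}"
  have sub: "?S \<subseteq> {u - w..u + w}" by (auto simp: abs_le_iff)
  have sep: "1 \<le> \<bar>x - y\<bar>" if "x \<in> ?S" "y \<in> ?S" "x \<noteq> y" for x y
    using that by auto
  have inj: "inj_on real A" for A by (simp add: inj_on_def)
  have "finite ?S" "real (card ?S) \<le> ((u + w) - (u - w)) / 1 + 1"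
    using assms by (intro separated_card[OF _ sub _ sep]; simp)+
  then show "finite {k :: nat. \<bar>real k - u\<bar> \<le> w}" "real (card {k :: nat. \<bar>real k - u\<bar> \<le> w}) \<le> 2 * w + 1"
    using finite_imageD[OF _ inj] card_image[OF inj] by auto
qed

text \<open>With \<rho> = exp (- n A) the first factor, which compares \<rho> with the length of
  cylinders of order \<open>n - 1\<close>, has size exp (- n min A b). The second, the share of one
  grid within distance \<rho>, is exp (- n max 0 (A - b - \<tau>)). The exponents add up to
  \<open>\<Phi>\<close>.\<close>

lemma coordinate_factor:
  assumes \<beta>: "1 < \<beta>" and n: "1 \<le> n" and \<rho>: "0 < \<rho>" and \<tau>: "0 \<le> \<tau>"
  shows "(\<rho> + \<beta> / \<beta> ^ n) * min 1 (\<rho> * \<beta> ^ n / exp (- real n * \<tau>))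
    \<le> 2 * \<beta> * exp (- real n * \<Phi> (ln \<beta>) \<tau> (- ln \<rho> / real n))"
proof -
  define A where "A = - ln \<rho> / real n"
  define b where "b = ln \<beta>"
  have \<rho>A: "\<rho> = exp (- real n * A)" using n \<rho> by (simp add: A_def)
  have \<beta>b: "\<beta> ^ n = exp (real n * b)" using \<beta> by (simp add: b_def exp_of_nat_mult)
  have nn: "0 \<le> real n" by simp
  have "\<rho> + \<beta> / \<beta> ^ n = exp (- real n * A) + \<beta> * exp (- real n * b)"
    unfolding \<rho>A \<beta>b by (simp add: exp_minus divide_inverse)
  also have "\<dots> \<le> \<beta> * exp (- real n * min A b) + \<beta> * exp (- real n * min A b)"
  proof (rule add_mono)
    have "exp (- real n * A) \<le> 1 * exp (- real n * min A b)" by (simp add: mult_left_mono)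
    also have "\<dots> \<le> \<beta> * exp (- real n * min A b)" using \<beta> by (intro mult_right_mono) auto
    finally show "exp (- real n * A) \<le> \<beta> * exp (- real n * min A b)" .
    show "\<beta> * exp (- real n * b) \<le> \<beta> * exp (- real n * min A b)"
      using \<beta> by (simp add: mult_left_mono)
  qed
  finally have 1: "\<rho> + \<beta> / \<beta> ^ n \<le> 2 * \<beta> * exp (- real n * min A b)" by simp
  have 2: "min 1 (\<rho> * \<beta> ^ n / exp (- real n * \<tau>)) = exp (- real n * max 0 (A - b - \<tau>))"
  proof -
    have "\<rho> * \<beta> ^ n / exp (- real n * \<tau>) = exp (- real n * (A - b - \<tau>))"
      unfolding \<rho>A \<beta>b by (simp add: exp_add[symmetric] exp_diff[symmetric] algebra_simps)
    then show ?thesis using n by (auto simp: min_def max_def mult_le_0_iff zero_le_mult_iff)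
  qed
  have "(\<rho> + \<beta> / \<beta> ^ n) * min 1 (\<rho> * \<beta> ^ n / exp (- real n * \<tau>))
      \<le> 2 * \<beta> * exp (- real n * min A b) * exp (- real n * max 0 (A - b - \<tau>))"
    unfolding 2 using 1 by (intro mult_right_mono) auto
  also have "\<dots> = 2 * \<beta> * exp (- real n * (min A b + max 0 (A - b - \<tau>)))"
    by (simp add: distrib_left exp_add exp_diff exp_minus divide_inverse)
  also have "\<dots> \<le> 2 * \<beta> * exp (- real n * \<Phi> b \<tau> A)"
  proof -
    have "\<Phi> b \<tau> A \<le> min A b + max 0 (A - b - \<tau>)" using \<tau> by (auto simp: \<Phi>_def)
    then show ?thesis using \<beta> by (intro mult_left_mono) (auto intro: mult_left_mono)
  qed
  finally show ?thesis by (simp add: A_def b_def)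
qed

context moving_targets
begin

text \<open>Every old cube receives the grids of equally many cylinders. Near a box of radius \<rho>
  at most 6^d old cubes matter, in each coordinate at most 2 \<rho> \<beta>^(n-1) + 2 cylinders, and
  of each grid at most 5 \<rho> / \<sigma>' or all indices. \<open>M j\<close> is the exact number
  of admissible indices.\<close>

lemma refine_cubes:
  fixes \<tau> :: "'d \<Rightarrow> real" and L :: "(real ^ 'd) set" and H :: "'d \<Rightarrow> nat"
  assumes L: "cube_family L \<sigma>" and n: "good_time n"
    and p: "\<And>j. 0 < p j" "\<And>j. p j \<le> gap j / 2"
    and H: "\<forall>a\<in>L. \<forall>j.
      H j \<le> card {z \<in> full_cyl (\<beta> j) (n - 1). a $ j \<le> z \<and> z + 1 / \<beta> j ^ (n - 1) \<le> a $ j + \<sigma>}" "\<And>j. 0 < H j"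
    and \<sigma>': "0 < \<sigma>'" "\<And>j. \<beta> j ^ n * \<sigma>' \<le> p j / 8"
    and M: "\<And>j. M j = nat \<lfloor>p j / (8 * \<sigma>' * \<beta> j ^ n)\<rfloor> + 1"
  shows "\<exists>L' par. cube_family L' \<sigma>' \<and>
    (\<forall>g\<in>L'. par g \<in> L \<and> cube g \<sigma>' \<subseteq> cube (par g) \<sigma> \<and> cube g \<sigma>' \<subseteq> hit_set \<beta> f n p) \<and>
    (\<forall>a\<in>L. card {g \<in> L'. par g = a} = (\<Prod>j\<in>UNIV. H j * M j)) \<and>
    card L' = card L * (\<Prod>j\<in>UNIV. H j * M j) \<and>
    (\<forall>x \<rho>. \<sigma>' \<le> \<rho> \<and> \<rho> \<le> 2 * \<sigma> \<longrightarrow> real (card {g \<in> L'. \<forall>j. \<bar>g $ j - x $ j\<bar> \<le> \<rho>}) \<le>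
       6 ^ CARD('d) * (\<Prod>j\<in>UNIV. (2 * \<rho> * \<beta> j ^ (n - 1) + 2) * min (real (M j)) (5 * \<rho> / \<sigma>')))"
proof -
  define len where "len = (\<lambda>j. 1 / \<beta> j ^ (n - 1))"
  have pos: "0 < \<beta> j ^ k" for j k using \<beta>[of j] by simp
  have len: "0 < len j" for j using pos by (simp add: len_def)
  have \<sigma>: "0 < \<sigma>" and finL: "finite L" and neL: "L \<noteq> {}" using L by (auto simp: cube_family_def)
  define cyls where "cyls = (\<lambda>(a :: real ^ 'd) j. {z \<in> full_cyl (\<beta> j) (n - 1). a $ j \<le> z \<and> z + len j \<le> a $ j + \<sigma>})"
  \<comment> \<open>Surplus cylinders are discarded so that all parents have the same number of
    children, which makes the mass distribution uniform.\<close>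
  define F where "F = (\<lambda>a j. SOME F. F \<subseteq> cyls a j \<and> card F = H j \<and> finite F)"
  have F: "F a j \<subseteq> cyls a j" "card (F a j) = H j" "finite (F a j)" if "a \<in> L" for a j
  proof -
    have "H j \<le> card (cyls a j)" using H(1)[rule_format, OF that, of j] by (simp add: cyls_def len_def)
    then have "\<exists>F. F \<subseteq> cyls a j \<and> card F = H j \<and> finite F"
      by (rule obtain_subset_with_card_n) blast
    from someI_ex[OF this] show "F a j \<subseteq> cyls a j" "card (F a j) = H j" "finite (F a j)"
      by (simp_all add: F_def)
  qed
  define Z where "Z = (\<lambda>a. {z :: real ^ 'd. \<forall>j. z $ j \<in> F a j})"
  define I where "I = PiE UNIV (\<lambda>j. {..<M j})"
  have adm: "admissible n p \<sigma>' i" if "i \<in> I" for i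
    unfolding admissible_def
  proof
    fix j
    have pq: "0 \<le> p j / (8 * \<sigma>' * \<beta> j ^ n)" using p(1)[of j] \<sigma>'(1) pos[of j n] by simp
    have "i j \<le> nat \<lfloor>p j / (8 * \<sigma>' * \<beta> j ^ n)\<rfloor>" 
    proof -
      have "i j < M j" using that by (auto simp: I_def)
      then show ?thesis using M[of j] by simp
    qed
    then have "real (i j) \<le> p j / (8 * \<sigma>' * \<beta> j ^ n)" using pq by linarith
    then show "8 * \<sigma>' * \<beta> j ^ n * real (i j) \<le> p j"
      using \<sigma>'(1) pos[of j n] by (simp add: pos_le_divide_eq mult.commute)
  qed
  define g where "g = (\<lambda>z. SOME g. solution_grid n p \<sigma>' z g)"
  have Zfull: "z $ j \<in> full_cyl (\<beta> j) (n - 1)" "a $ j \<le> z $ j" "z $ j + len j \<le> a $ j + \<sigma>"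
    if "a \<in> L" "z \<in> Z a" for a z j
    using F(1)[OF that(1), of j] that(2) by (auto simp: Z_def cyls_def)
  have g: "solution_grid n p \<sigma>' z (g z)" if "a \<in> L" "z \<in> Z a" for a z
  proof -
    have "\<exists>g. solution_grid n p \<sigma>' z g" using Zfull(1)[OF that] by (intro solution_cubes n p \<sigma>')
    then show ?thesis unfolding g_def by (rule someI_ex)
  qed
  have g1: "z $ j \<le> g z i $ j" "g z i $ j + \<sigma>' < z $ j + len j" if "a \<in> L" "z \<in> Z a" "i \<in> I" for a z i j
    using g[OF that(1,2)] adm[OF that(3)] unfolding len_def solution_grid_def by blast+
  have g2: "cube (g z i) \<sigma>' \<subseteq> hit_set \<beta> f n p" if "a \<in> L" "z \<in> Z a" "i \<in> I" for a z i
    using g[OF that(1,2)] adm[OF that(3)] unfolding solution_grid_def by blast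
  have g3: "\<bar>g z i $ j - g z i' $ j - 4 * \<sigma>' * (real (i j) - real (i' j))\<bar> \<le> R / 4"
    if "a \<in> L" "z \<in> Z a" "i \<in> I" "i' \<in> I" "\<And>k. \<bar>g z i $ k - g z i' $ k\<bar> \<le> R" for a z i i' j R
    using g[OF that(1,2)] adm[OF that(3)] adm[OF that(4)] that(5) unfolding solution_grid_def by blast
  have sep: "\<exists>j. \<sigma>' \<le> \<bar>g z i $ j - g z' i' $ j\<bar>"
    if az: "a \<in> L" "z \<in> Z a" "i \<in> I" "a' \<in> L" "z' \<in> Z a'" "i' \<in> I" and ne: "(a, z, i) \<noteq> (a', z', i')"
    for a z i a' z' i'
  proof (cases "a = a'")
    case False
    then obtain j where "\<sigma> \<le> \<bar>a $ j - a' $ j\<bar>" using L az(1,4) unfolding cube_family_def by blast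
    moreover note g1[OF az(1-3), of j] g1[OF az(4-6), of j] Zfull(2,3)[OF az(1,2), of j] Zfull(2,3)[OF az(4,5), of j]
    ultimately show ?thesis by (intro exI[of _ j]) linarith
  next
    case a: True
    show ?thesis
    proof (cases "z = z'")
      case False
      then obtain j where "z $ j \<noteq> z' $ j" by (auto simp: vec_eq_iff)
      then have "len j \<le> \<bar>z $ j - z' $ j\<bar>"
        unfolding len_def using full_cyl_separated[OF \<beta> Zfull(1)[OF az(1,2)] Zfull(1)[OF az(4,5)]] by blast
      moreover note g1[OF az(1-3), of j] g1[OF az(4-6), of j]
      ultimately show ?thesis by (intro exI[of _ j]) linarith
    next
      case True
      then obtain j where j: "i j \<noteq> i' j" using a ne by auto
      show ?thesis
      proof (rule ccontr)
        assume "\<not> ?thesis"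
        then have lt: "\<bar>g z i $ k - g z i' $ k\<bar> \<le> \<sigma>'" for k using True by (metis less_imp_le not_le)
        have "\<bar>g z i $ j - g z i' $ j - 4 * \<sigma>' * (real (i j) - real (i' j))\<bar> \<le> \<sigma>' / 4"
          using g3[OF az(1,2,3,6) lt] .
        then have "\<bar>4 * \<sigma>' * (real (i j) - real (i' j))\<bar> \<le> 2 * \<sigma>'" using lt[of j] \<sigma>'(1) by linarith
        moreover have "1 \<le> \<bar>real (i j) - real (i' j)\<bar>" using j by linarith
        then have "4 * \<sigma>' * 1 \<le> 4 * \<sigma>' * \<bar>real (i j) - real (i' j)\<bar>"
          using \<sigma>'(1) by (intro mult_left_mono) auto
        ultimately show False using \<sigma>'(1) by (simp add: abs_mult)
      qed
    qed
  qed
  define X where "X = Sigma L (\<lambda>a. Z a \<times> I)"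
  define G where "G = (\<lambda>(a :: real ^ 'd, z, i). g z i)"
  define L' where "L' = G ` X"
  \<comment> \<open>A new corner determines its parent because \<open>G\<close> is injective, by the
    separation just shown.\<close>
  define par where "par = (\<lambda>y. fst (inv_into X G y))"
  have inj: "inj_on G X"
  proof (rule inj_onI, rule ccontr)
    fix u v assume uv: "u \<in> X" "v \<in> X" "G u = G v" "u \<noteq> v"
    obtain a z i a' z' i' where "u = (a, z, i)" "v = (a', z', i')" by (metis prod_cases3)
    then have "\<exists>j. \<sigma>' \<le> \<bar>G u $ j - G v $ j\<bar>"
      using uv sep[of a z i a' z' i'] by (auto simp: X_def G_def)
    then show False using uv(3) \<sigma>'(1) by simp
  qed
  have par: "par (g z i) = a" if "a \<in> L" "z \<in> Z a" "i \<in> I" for a z i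
  proof -
    have "inv_into X G (G (a, z, i)) = (a, z, i)"
      by (rule inv_into_f_f[OF inj]) (use that in \<open>auto simp: X_def\<close>)
    then show ?thesis by (simp add: par_def G_def)
  qed
  have finZ: "finite (Z a)" and cardZ: "card (Z a) = (\<Prod>j\<in>UNIV. H j)" if "a \<in> L" for a
    unfolding Z_def using card_vec_product[of "F a"] F(2,3)[OF that] by auto
  have finI: "finite I" and cardI: "card I = (\<Prod>j\<in>UNIV. M j)"
    by (auto simp: I_def card_PiE intro!: finite_PiE)
  have M1: "0 < M j" for j using M[of j] by simp
  have children: "{y \<in> L'. par y = a} = G ` ({a} \<times> (Z a \<times> I))" if "a \<in> L" for a
  proof (intro equalityI subsetI)
    fix y assume "y \<in> {y \<in> L'. par y = a}"
    then obtain a' z i where "y = g z i" "a' \<in> L" "z \<in> Z a'" "i \<in> I" "par y = a"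
      by (auto simp: L'_def X_def G_def)
    then have "z \<in> Z a" "i \<in> I" "y = G (a, z, i)" using par by (auto simp: G_def)
    then show "y \<in> G ` ({a} \<times> (Z a \<times> I))" by blast
  next
    fix y assume "y \<in> G ` ({a} \<times> (Z a \<times> I))"
    then obtain z i where zi: "z \<in> Z a" "i \<in> I" "y = G (a, z, i)" by blast
    then have "(a, z, i) \<in> X" using that by (simp add: X_def)
    then have "y \<in> L'" unfolding L'_def zi(3) by (rule imageI)
    then show "y \<in> {y \<in> L'. par y = a}"
      using par[OF that zi(1,2)] zi(3) by (simp add: G_def)
  qed
  have card_children: "card {y \<in> L'. par y = a} = (\<Prod>j\<in>UNIV. H j * M j)" if "a \<in> L" for a
  proof -
    have "card (G ` ({a} \<times> (Z a \<times> I))) = card ({a} \<times> (Z a \<times> I))"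
      by (rule card_image) (rule inj_on_subset[OF inj], use that in \<open>auto simp: X_def\<close>)
    then show ?thesis unfolding children[OF that]
      by (simp add: card_cartesian_product cardZ[OF that] cardI prod.distrib)
  qed
  have cardL': "card L' = card L * (\<Prod>j\<in>UNIV. H j * M j)"
  proof -
    have "card L' = card X" unfolding L'_def by (rule card_image[OF inj])
    then show ?thesis unfolding X_def
      using finL finZ finI by (simp add: card_SigmaI card_cartesian_product cardZ cardI prod.distrib)
  qed
  have "cube_family L' \<sigma>'"
    unfolding cube_family_def
  proof (intro conjI ballI allI impI)
    show "finite L'" using finL finZ finI by (auto simp: L'_def X_def)
    have "card L' \<noteq> 0" unfolding cardL' using finL neL H(2) M1 by (simp add: card_eq_0_iff)
    then show "L' \<noteq> {}" by auto
    show "0 < \<sigma>'" by fact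
    fix y assume "y \<in> L'"
    then obtain a z i where y: "y = g z i" "a \<in> L" "z \<in> Z a" "i \<in> I" by (auto simp: L'_def X_def G_def)
    have a01: "0 \<le> a $ j" "a $ j + \<sigma> \<le> 1" for j using L y(2) by (auto simp: cube_family_def)
    show "0 \<le> y $ j" for j
      using g1(1)[OF y(2-4), of j] Zfull(2)[OF y(2,3), of j] a01(1)[of j] unfolding y(1) by linarith
    show "y $ j + \<sigma>' \<le> 1" for j
      using g1(2)[OF y(2-4), of j] Zfull(3)[OF y(2,3), of j] a01(2)[of j] unfolding y(1) by linarith
    fix y' assume "y' \<in> L'" "y \<noteq> y'"
    then obtain a' z' i' where y': "y' = g z' i'" "a' \<in> L" "z' \<in> Z a'" "i' \<in> I" by (auto simp: L'_def X_def G_def)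
    have "(a, z, i) \<noteq> (a', z', i')" using \<open>y \<noteq> y'\<close> y(1) y'(1) by auto
    then show "\<exists>j. \<sigma>' \<le> \<bar>y $ j - y' $ j\<bar>" using sep[OF y(2-4) y'(2-4)] y(1) y'(1) by simp
  qed
  moreover have "par y \<in> L \<and> cube y \<sigma>' \<subseteq> cube (par y) \<sigma> \<and> cube y \<sigma>' \<subseteq> hit_set \<beta> f n p" if yL: "y \<in> L'" for y
  proof -
    obtain a z i where y: "y = g z i" "a \<in> L" "z \<in> Z a" "i \<in> I" using yL by (auto simp: L'_def X_def G_def)
    have "cube (g z i) \<sigma>' \<subseteq> cube a \<sigma>"
    proof
      fix x assume x: "x \<in> cube (g z i) \<sigma>'"
      have "a $ j \<le> x $ j \<and> x $ j \<le> a $ j + \<sigma>" for j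
      proof -
        have "g z i $ j \<le> x $ j" "x $ j \<le> g z i $ j + \<sigma>'" using x by (auto simp: cube_def)
        then show ?thesis using g1[OF y(2-4), of j] Zfull(2,3)[OF y(2,3), of j] by linarith
      qed
      then show "x \<in> cube a \<sigma>" by (simp add: cube_def)
    qed
    then show ?thesis using g2[OF y(2-4)] par[OF y(2-4)] y by simp
  qed
  moreover have "real (card {y \<in> L'. \<forall>j. \<bar>y $ j - x $ j\<bar> \<le> \<rho>}) \<le>
       6 ^ CARD('d) * (\<Prod>j\<in>UNIV. (2 * \<rho> * \<beta> j ^ (n - 1) + 2) * min (real (M j)) (5 * \<rho> / \<sigma>'))"
    if \<rho>: "\<sigma>' \<le> \<rho>" "\<rho> \<le> 2 * \<sigma>" for x \<rho>
  proof -
    have \<rho>0: "0 < \<rho>" using \<rho> \<sigma>'(1) by linarith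
    define La where "La = {a \<in> L. \<forall>j. x $ j - \<rho> - \<sigma> \<le> a $ j \<and> a $ j \<le> x $ j + \<rho>}"
    define Za where "Za = (\<lambda>a. {z :: real ^ 'd. \<forall>j. z $ j \<in> {w \<in> F a j. x $ j - \<rho> - len j \<le> w \<and> w \<le> x $ j + \<rho>}})"
    define Ia where "Ia = (\<lambda>z. {i \<in> I. \<forall>j. \<bar>g z i $ j - x $ j\<bar> \<le> \<rho>})"
    have sub: "{y \<in> L'. \<forall>j. \<bar>y $ j - x $ j\<bar> \<le> \<rho>} \<subseteq> (\<Union>a\<in>La. \<Union>z\<in>Za a. g z ` Ia z)"
    proof
      fix y assume "y \<in> {y \<in> L'. \<forall>j. \<bar>y $ j - x $ j\<bar> \<le> \<rho>}"
      then obtain a z i where y: "y = g z i" "a \<in> L" "z \<in> Z a" "i \<in> I" and near: "\<And>j. \<bar>g z i $ j - x $ j\<bar> \<le> \<rho>"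
        by (auto simp: L'_def X_def G_def)
      have "x $ j - \<rho> - \<sigma> \<le> a $ j \<and> a $ j \<le> x $ j + \<rho> \<and> x $ j - \<rho> - len j \<le> z $ j \<and> z $ j \<le> x $ j + \<rho>" for j
        using g1[OF y(2-4), of j] Zfull(2,3)[OF y(2,3), of j] near[of j] \<sigma>'(1) by linarith
      then show "y \<in> (\<Union>a\<in>La. \<Union>z\<in>Za a. g z ` Ia z)"
        using y near by (auto simp: La_def Za_def Ia_def Z_def)
    qed
    have finLa: "finite La" using finL by (simp add: La_def)
    have La_L: "a \<in> L" if "a \<in> La" for a using that by (simp add: La_def)
    have Za_Z: "Za a \<subseteq> Z a" for a by (auto simp: Za_def Z_def)
    have finZa: "finite (Za a)" if "a \<in> La" for a
      using finite_subset[OF Za_Z finZ] La_L[OF that] by blast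
    have cZ: "real (card (Za a)) \<le> (\<Prod>j\<in>UNIV. 2 * \<rho> * \<beta> j ^ (n - 1) + 2)" if a: "a \<in> La" for a
    proof -
      define W where "W = (\<lambda>j. {w \<in> F a j. x $ j - \<rho> - len j \<le> w \<and> w \<le> x $ j + \<rho>})"
      have fW: "finite (W j)" for j using F(3)[OF La_L[OF a]] by (simp add: W_def)
      have cW: "real (card (W j)) \<le> 2 * \<rho> * \<beta> j ^ (n - 1) + 2" for j
      proof -
        have "real (card (W j)) \<le> ((x $ j + \<rho>) - (x $ j - \<rho> - len j)) / len j + 1"
        proof (rule separated_card(2)[OF len])
          show "W j \<subseteq> {x $ j - \<rho> - len j..x $ j + \<rho>}" by (auto simp: W_def)
          show "x $ j - \<rho> - len j \<le> x $ j + \<rho>" using \<rho>0 len[of j] by simp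
          show "len j \<le> \<bar>u - v\<bar>" if "u \<in> W j" "v \<in> W j" "u \<noteq> v" for u v
            unfolding len_def using that F(1)[OF La_L[OF a], of j]
            by (intro full_cyl_separated[OF \<beta>]) (auto simp: W_def cyls_def)
        qed
        also have "\<dots> = 2 * \<rho> / len j + 2" using len[of j] by (simp add: field_simps)
        also have "\<dots> = 2 * \<rho> * \<beta> j ^ (n - 1) + 2" by (simp add: len_def)
        finally show ?thesis .
      qed
      have "Za a = {z. \<forall>j. z $ j \<in> W j}" by (simp add: Za_def W_def)
      then have "real (card (Za a)) = (\<Prod>j\<in>UNIV. real (card (W j)))"
        using card_vec_product(2)[of W] fW by simp
      also have "\<dots> \<le> (\<Prod>j\<in>UNIV. 2 * \<rho> * \<beta> j ^ (n - 1) + 2)"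
        using cW by (intro prod_mono conjI) simp_all
      finally show ?thesis .
    qed
    have cI: "real (card (Ia z)) \<le> (\<Prod>j\<in>UNIV. min (real (M j)) (5 * \<rho> / \<sigma>'))" if a: "a \<in> La" and z: "z \<in> Za a" for a z
    proof (cases "Ia z = {}")
      case True
      then show ?thesis using \<rho>0 \<sigma>'(1) by (auto intro!: prod_nonneg)
    next
      case False
      then obtain i0 where i0: "i0 \<in> Ia z" by blast
      define w where "w = 2 * \<rho> / \<sigma>'"
      have w: "0 \<le> w" using \<rho>0 \<sigma>'(1) by (simp add: w_def)
      define W where "W = (\<lambda>j. {k \<in> {..<M j}. \<bar>real k - real (i0 j)\<bar> \<le> w})"
      have "Ia z \<subseteq> PiE UNIV W"
      proof
        fix i assume i: "i \<in> Ia z"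
        have near: "\<bar>g z i $ k - g z i0 $ k\<bar> \<le> 2 * \<rho>" for k
        proof -
          have "\<bar>g z i $ k - x $ k\<bar> \<le> \<rho>" "\<bar>g z i0 $ k - x $ k\<bar> \<le> \<rho>" using i i0 by (auto simp: Ia_def)
          then show ?thesis by linarith
        qed
        have "\<bar>real (i j) - real (i0 j)\<bar> \<le> w" for j
        proof -
          have "z \<in> Z a" "i \<in> I" "i0 \<in> I" using z Za_Z i i0 by (auto simp: Ia_def)
          then have "\<bar>g z i $ j - g z i0 $ j - 4 * \<sigma>' * (real (i j) - real (i0 j))\<bar> \<le> 2 * \<rho> / 4"
            using g3[OF La_L[OF a] _ _ _ near] by blast
          then have "\<bar>4 * \<sigma>' * (real (i j) - real (i0 j))\<bar> \<le> 4 * (2 * \<rho>)"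
            using near[of j] \<rho>0 by linarith
          then have "\<sigma>' * \<bar>real (i j) - real (i0 j)\<bar> \<le> 2 * \<rho>" using \<sigma>'(1) by (simp add: abs_mult)
          then show ?thesis using \<sigma>'(1) by (simp add: w_def pos_le_divide_eq mult.commute)
        qed
        then show "i \<in> PiE UNIV W" using i by (auto simp: Ia_def I_def W_def)
      qed
      then have "card (Ia z) \<le> card (PiE UNIV W)"
        by (intro card_mono finite_PiE) (auto simp: W_def)
      then have "real (card (Ia z)) \<le> (\<Prod>j\<in>UNIV. real (card (W j)))" by (simp add: card_PiE flip: of_nat_prod)
      also have "\<dots> \<le> (\<Prod>j\<in>UNIV. min (real (M j)) (5 * \<rho> / \<sigma>'))"
      proof (intro prod_mono conjI)
        fix j
        have "card (W j) \<le> card {..<M j}" by (rule card_mono) (auto simp: W_def)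
        moreover have "card (W j) \<le> card {k :: nat. \<bar>real k - real (i0 j)\<bar> \<le> w}"
          using card_nat_near(1)[OF w] by (intro card_mono) (auto simp: W_def)
        then have "real (card (W j)) \<le> 2 * w + 1" using card_nat_near(2)[OF w, of "real (i0 j)"] by linarith
        \<comment> \<open>This is where \<open>\<sigma>' \<le> \<rho>\<close> enters: the additive 1
          is at most \<rho> / \<sigma>'.\<close>
        moreover have "2 * w + 1 \<le> 5 * \<rho> / \<sigma>'"
        proof -
          have "1 \<le> \<rho> / \<sigma>'" using \<rho>(1) \<sigma>'(1) by simp
          then show ?thesis by (simp add: w_def)
        qed
        ultimately show "real (card (W j)) \<le> min (real (M j)) (5 * \<rho> / \<sigma>')" by simp
      qed simp
      finally show ?thesis .
    qed
    define PZ where "PZ = (\<Prod>j\<in>UNIV. 2 * \<rho> * \<beta> j ^ (n - 1) + 2)"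
    define PI where "PI = (\<Prod>j\<in>UNIV. min (real (M j)) (5 * \<rho> / \<sigma>'))"
    have PI0: "0 \<le> PI" using \<rho>0 \<sigma>'(1) by (auto simp: PI_def intro!: prod_nonneg)
    have PZ0: "0 \<le> PZ" 
      unfolding PZ_def using \<rho>0 pos by (intro prod_nonneg ballI add_nonneg_nonneg mult_nonneg_nonneg) (auto intro: less_imp_le)
    have finIa: "finite (Ia z)" for z using finI by (simp add: Ia_def)
    have "card {y \<in> L'. \<forall>j. \<bar>y $ j - x $ j\<bar> \<le> \<rho>} \<le> card (\<Union>a\<in>La. \<Union>z\<in>Za a. g z ` Ia z)"
      using finLa finZa finIa by (intro card_mono sub) auto
    also have "\<dots> \<le> (\<Sum>a\<in>La. card (\<Union>z\<in>Za a. g z ` Ia z))" by (rule card_UN_le[OF finLa])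
    also have "\<dots> \<le> (\<Sum>a\<in>La. \<Sum>z\<in>Za a. card (g z ` Ia z))"
      by (intro sum_mono card_UN_le finZa)
    also have "\<dots> \<le> (\<Sum>a\<in>La. \<Sum>z\<in>Za a. card (Ia z))"
      by (intro sum_mono card_image_le finIa)
    finally have "real (card {y \<in> L'. \<forall>j. \<bar>y $ j - x $ j\<bar> \<le> \<rho>}) \<le> (\<Sum>a\<in>La. \<Sum>z\<in>Za a. real (card (Ia z)))"
      by (simp flip: of_nat_sum)
    also have "\<dots> \<le> (\<Sum>a\<in>La. \<Sum>z\<in>Za a. PI)"
      unfolding PI_def using cI by (intro sum_mono) blast
    also have "\<dots> = (\<Sum>a\<in>La. real (card (Za a)) * PI)" by simp
    also have "\<dots> \<le> (\<Sum>a\<in>La. PZ * PI)"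
      unfolding PZ_def using cZ PI0 by (intro sum_mono mult_right_mono) auto
    also have "\<dots> = real (card La) * (PZ * PI)" by simp
    also have "\<dots> \<le> 6 ^ CARD('d) * (PZ * PI)"
    proof (intro mult_right_mono)
      show "real (card La) \<le> 6 ^ CARD('d)"
        unfolding La_def using cube_family_card_near[OF L \<rho>(2), of x] by simp
    qed (use PZ0 PI0 in simp)
    finally show ?thesis by (simp add: PZ_def PI_def prod.distrib)
  qed
  ultimately show ?thesis
    using card_children cardL' by (intro exI[of _ L'] exI[of _ par]) blast
qed

end

section \<open>One refinement step of the Cantor construction\<close>

text \<open>The last clause is the mass bound in counting form. The windows of successive steps
  cover all small radii, and their upper end is twice the old side so that the bound can be used at
  2 \<rho> for any \<rho> between two successive sides.\<close>

definition refines :: "(real ^ 'd) set \<Rightarrow> real \<Rightarrow> real \<Rightarrow> (real ^ 'd) set \<Rightarrow> real \<Rightarrow>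
    (real ^ 'd) set \<Rightarrow> real \<Rightarrow> (real ^ 'd \<Rightarrow> real ^ 'd) \<Rightarrow> bool" where
  "refines H s K L \<sigma> L' \<sigma>' par \<longleftrightarrow> cube_family L' \<sigma>' \<and> \<sigma>' \<le> \<sigma> / 2 \<and>
     (\<forall>g\<in>L'. par g \<in> L \<and> cube g \<sigma>' \<subseteq> cube (par g) \<sigma> \<and> cube g \<sigma>' \<subseteq> H) \<and>
     (\<exists>m. \<forall>a\<in>L. card {g \<in> L'. par g = a} = m) \<and>
     (\<forall>x \<rho>. \<sigma>' \<le> \<rho> \<and> \<rho> \<le> 2 * \<sigma> \<longrightarrow>
        real (card {g \<in> L'. \<forall>j. \<bar>g $ j - x $ j\<bar> \<le> \<rho>}) \<le> K * \<rho> powr s * real (card L'))"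

context moving_targets
begin

lemma refinement_time:
  fixes L :: "(real ^ 'd) set"
  assumes L: "finite L" "\<And>a j. a \<in> L \<Longrightarrow> 0 \<le> a $ j \<and> a $ j + \<sigma> \<le> 1" "0 < \<sigma>"
    and cc: "\<forall>j a b. 0 \<le> a \<and> a < b \<and> b \<le> 1 \<longrightarrow>
     (\<exists>n0. \<forall>n\<ge>n0. cc j * (b - a) * \<beta> j ^ n \<le> real (card {z \<in> full_cyl (\<beta> j) n. a \<le> z \<and> z + 1 / \<beta> j ^ n \<le> b}))"
    and \<tau>: "\<And>j. 0 < \<tau> j" and inf: "infinite \<N>"
  shows "\<exists>n\<in>\<N>. N < n \<and> good_time n \<and> (\<forall>j. exp (- real n * \<tau> j) \<le> gap j / 2) \<and>
    (\<forall>a\<in>L. \<forall>j. cc j * \<sigma> * \<beta> j ^ (n - 1) \<le>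
       real (card {z \<in> full_cyl (\<beta> j) (n - 1). a $ j \<le> z \<and> z + 1 / \<beta> j ^ (n - 1) \<le> a $ j + \<sigma>}))"
proof -
  have "\<forall>\<^sub>F n in sequentially. exp (- real n * \<tau> j) \<le> gap j / 2" for j
  proof -
    have "(\<lambda>n. exp (- \<tau> j) ^ n) \<longlonglongrightarrow> 0" using \<tau>[of j] by (intro LIMSEQ_realpow_zero) auto
    moreover have "exp (- \<tau> j) ^ n = exp (- real n * \<tau> j)" for n
      by (simp add: exp_of_nat_mult[symmetric])
    ultimately have "(\<lambda>n. exp (- real n * \<tau> j)) \<longlonglongrightarrow> 0" by simp
    then have "\<forall>\<^sub>F n in sequentially. exp (- real n * \<tau> j) < gap j / 2"
      using gap(1)[of j] by (intro order_tendstoD(2)) auto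
    then show ?thesis by eventually_elim simp
  qed
  moreover have "\<forall>\<^sub>F n in sequentially. cc j * \<sigma> * \<beta> j ^ (n - 1) \<le>
      real (card {z \<in> full_cyl (\<beta> j) (n - 1). a $ j \<le> z \<and> z + 1 / \<beta> j ^ (n - 1) \<le> a $ j + \<sigma>})" if aL: "a \<in> L" for a j
  proof -
    obtain n0 where n0: "\<And>n. n \<ge> n0 \<Longrightarrow> cc j * (a $ j + \<sigma> - a $ j) * \<beta> j ^ n \<le>
        real (card {z \<in> full_cyl (\<beta> j) n. a $ j \<le> z \<and> z + 1 / \<beta> j ^ n \<le> a $ j + \<sigma>})"
      using cc[rule_format, of "a $ j" "a $ j + \<sigma>" j] L(2)[OF aL, of j] L(3) by auto
    show ?thesis unfolding eventually_sequentially
    proof (intro exI[of _ "Suc n0"] allI impI)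
      fix n assume "Suc n0 \<le> n"
      then show "cc j * \<sigma> * \<beta> j ^ (n - 1) \<le>
        real (card {z \<in> full_cyl (\<beta> j) (n - 1). a $ j \<le> z \<and> z + 1 / \<beta> j ^ (n - 1) \<le> a $ j + \<sigma>})"
        using n0[of "n - 1"] by simp
    qed
  qed
  ultimately have "\<forall>\<^sub>F n in sequentially. N < n \<and> good_time n \<and> (\<forall>j. exp (- real n * \<tau> j) \<le> gap j / 2) \<and>
    (\<forall>a\<in>L. \<forall>j. cc j * \<sigma> * \<beta> j ^ (n - 1) \<le>
       real (card {z \<in> full_cyl (\<beta> j) (n - 1). a $ j \<le> z \<and> z + 1 / \<beta> j ^ (n - 1) \<le> a $ j + \<sigma>}))"
    by (intro eventually_conj eventually_gt_at_top eventually_good_time eventually_all_finite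
        eventually_ball_finite L(1) ballI)
  then show ?thesis
    using inf unfolding eventually_sequentially infinite_nat_iff_unbounded_le by blast
qed

text \<open>The count is compared with the number of children coordinate by coordinate. Each ratio
  is bounded by \<open>coordinate_factor\<close>, and the product of the resulting exponentials is
  at most \<rho>^s0 by the assumption on \<open>s0\<close>. The power \<sigma>^(-d) arises since an
  old cube is only guaranteed a share \<sigma> of the cylinders per coordinate.\<close>

lemma children_count_bound:
  assumes n: "1 \<le> n" and \<sigma>: "0 < \<sigma>" "\<sigma> \<le> 1 / 4" and \<sigma>': "0 < \<sigma>'" "\<sigma>' \<le> \<rho>" and \<rho>: "\<rho> \<le> 2 * \<sigma>"
    and cc: "\<And>j. 0 < cc j" and \<tau>: "\<And>j. 0 < \<tau> j"
    and H: "\<And>j. cc j * \<sigma> * \<beta> j ^ (n - 1) \<le> H j"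
    and M: "\<And>j. exp (- real n * \<tau> j) / (8 * \<sigma>' * \<beta> j ^ n) \<le> M j"
    and s0: "\<And>A. 0 < A \<Longrightarrow> s0 * A \<le> (\<Sum>j\<in>UNIV. \<Phi> (ln (\<beta> j)) (\<tau> j) A)"
  shows "(\<Prod>j\<in>UNIV. (2 * \<rho> * \<beta> j ^ (n - 1) + 2) * min (M j) (5 * \<rho> / \<sigma>')) \<le>
    (\<Prod>j\<in>UNIV. 160 * \<beta> j / cc j) * \<sigma> powr (- real CARD('d)) * \<rho> powr s0 * (\<Prod>j\<in>UNIV. H j * M j)"
proof -
  have \<rho>0: "0 < \<rho>" using \<sigma>' by linarith
  have pos: "0 < \<beta> j ^ k" "0 < \<beta> j" for j k using \<beta>[of j] by auto
  define A where "A = - ln \<rho> / real n"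
  have "\<rho> < 1" using \<rho> \<sigma>(2) by linarith
  then have A: "0 < A" using \<rho>0 n by (simp add: A_def divide_neg_pos)
  have \<rho>A: "\<rho> = exp (- real n * A)" using n \<rho>0 by (simp add: A_def)
  define E where "E = (\<lambda>j. exp (- real n * \<Phi> (ln (\<beta> j)) (\<tau> j) A))"
  have Mpos: "0 < M j" for j
    by (rule less_le_trans[OF _ M]) (use \<sigma>' pos in auto)
  have Hpos: "0 < H j" for j
    by (rule less_le_trans[OF _ H]) (use cc \<sigma> pos in auto)
  have factor: "(2 * \<rho> * \<beta> j ^ (n - 1) + 2) * min (M j) (5 * \<rho> / \<sigma>') \<le>
    (160 * \<beta> j / cc j) * (1 / \<sigma>) * E j * (H j * M j)" for j
  proof -
    define p where "p = exp (- real n * \<tau> j)"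
    have \<beta>n: "\<beta> j ^ n = \<beta> j * \<beta> j ^ (n - 1)" using n by (cases n) auto
    have "2 * \<rho> * \<beta> j ^ (n - 1) + 2 = 2 * (\<rho> + \<beta> j / \<beta> j ^ n) * \<beta> j ^ (n - 1)"
      using pos(1)[of j "n - 1"] pos(2)[of j] unfolding \<beta>n by (simp add: field_simps)
    also have "\<dots> \<le> 2 * (\<rho> + \<beta> j / \<beta> j ^ n) * (H j / (cc j * \<sigma>))"
      using H[of j] cc[of j] \<sigma>(1) \<rho>0 pos by (intro mult_left_mono) (auto simp: pos_le_divide_eq mult_ac less_imp_le)
    finally have 1: "2 * \<rho> * \<beta> j ^ (n - 1) + 2 \<le> 2 * (\<rho> + \<beta> j / \<beta> j ^ n) * (H j / (cc j * \<sigma>))" .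
    have "min (M j) (5 * \<rho> / \<sigma>') = M j * min 1 (5 * \<rho> / (\<sigma>' * M j))"
      using Mpos[of j] by (simp add: min_mult_distrib_left)
    also have "\<dots> \<le> M j * (40 * min 1 (\<rho> * \<beta> j ^ n / p))"
    proof (intro mult_left_mono)
      have "p \<le> \<sigma>' * M j * (8 * \<beta> j ^ n)"
        using M[of j] \<sigma>'(1) pos[of j] by (simp add: p_def pos_divide_le_eq mult_ac)
      then have "5 * \<rho> / (\<sigma>' * M j) \<le> 40 * (\<rho> * \<beta> j ^ n / p)"
        using \<sigma>'(1) Mpos[of j] \<rho>0 by (simp add: p_def divide_le_eq) (simp add: field_simps p_def mult_left_mono)
      then show "min 1 (5 * \<rho> / (\<sigma>' * M j)) \<le> 40 * min 1 (\<rho> * \<beta> j ^ n / p)"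
        by (simp add: min_def)
    qed (use Mpos[of j] in simp)
    finally have 2: "min (M j) (5 * \<rho> / \<sigma>') \<le> M j * (40 * min 1 (\<rho> * \<beta> j ^ n / p))" .
    have "(2 * \<rho> * \<beta> j ^ (n - 1) + 2) * min (M j) (5 * \<rho> / \<sigma>') \<le>
        (2 * (\<rho> + \<beta> j / \<beta> j ^ n) * (H j / (cc j * \<sigma>))) * (M j * (40 * min 1 (\<rho> * \<beta> j ^ n / p)))"
      using 1 2 Mpos[of j] Hpos[of j] \<rho>0 \<sigma>' \<sigma>(1) cc[of j] pos[of j]
      by (intro mult_mono) (auto intro!: mult_nonneg_nonneg add_nonneg_nonneg less_imp_le[OF divide_pos_pos])
    also have "\<dots> = (80 * H j * M j / (cc j * \<sigma>)) * ((\<rho> + \<beta> j / \<beta> j ^ n) * min 1 (\<rho> * \<beta> j ^ n / p))"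
      by simp
    also have "\<dots> \<le> (80 * H j * M j / (cc j * \<sigma>)) * (2 * \<beta> j * E j)"
      unfolding p_def E_def A_def using Mpos[of j] Hpos[of j] cc[of j] \<sigma>(1) \<tau>[of j]
      by (intro mult_left_mono coordinate_factor \<beta> n \<rho>0) auto
    \<comment> \<open>The constant is 160 = 2 * 40 * 2, where 40 = 5 * 8 combines the grid count
      with the lower bound for \<open>M j\<close>.\<close>
    also have "\<dots> = (160 * \<beta> j / cc j) * (1 / \<sigma>) * E j * (H j * M j)" by simp
    finally show ?thesis .
  qed
  have "(\<Prod>j\<in>UNIV. (2 * \<rho> * \<beta> j ^ (n - 1) + 2) * min (M j) (5 * \<rho> / \<sigma>')) \<le>
      (\<Prod>j\<in>UNIV. (160 * \<beta> j / cc j) * (1 / \<sigma>) * E j * (H j * M j))"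
  proof (intro prod_mono conjI factor)
    show "0 \<le> (2 * \<rho> * \<beta> j ^ (n - 1) + 2) * min (M j) (5 * \<rho> / \<sigma>')" for j
      using \<rho>0 \<sigma>'(1) Mpos[of j] pos(1)[of j "n - 1"] by (intro mult_nonneg_nonneg add_nonneg_nonneg) auto
  qed
  also have "\<dots> = (\<Prod>j\<in>UNIV. 160 * \<beta> j / cc j) * (1 / \<sigma>) ^ CARD('d) * (\<Prod>j\<in>UNIV. E j) * (\<Prod>j\<in>UNIV. H j * M j)"
    by (simp only: prod.distrib prod_constant)
  also have "(1 / \<sigma>) ^ CARD('d) = \<sigma> powr (- real CARD('d))"
    using \<sigma>(1) by (simp add: powr_minus powr_realpow power_one_over inverse_eq_divide)
  also have "(\<Prod>j\<in>UNIV. E j) = exp (- real n * (\<Sum>j\<in>UNIV. \<Phi> (ln (\<beta> j)) (\<tau> j) A))"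
    unfolding E_def by (simp only: exp_sum[OF finite_class.finite_UNIV, symmetric] sum_distrib_left)
  also have "(\<Prod>j\<in>UNIV. 160 * \<beta> j / cc j) * \<sigma> powr (- real CARD('d)) *
      exp (- real n * (\<Sum>j\<in>UNIV. \<Phi> (ln (\<beta> j)) (\<tau> j) A)) * (\<Prod>j\<in>UNIV. H j * M j)
      \<le> (\<Prod>j\<in>UNIV. 160 * \<beta> j / cc j) * \<sigma> powr (- real CARD('d)) * \<rho> powr s0 * (\<Prod>j\<in>UNIV. H j * M j)"
  proof (intro mult_right_mono mult_left_mono)
    have "exp (- real n * (\<Sum>j\<in>UNIV. \<Phi> (ln (\<beta> j)) (\<tau> j) A)) \<le> exp (- real n * (s0 * A))"
      using s0[OF A] by (simp add: mult_left_mono)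
    also have "\<dots> = \<rho> powr s0" unfolding \<rho>A by (simp add: exp_powr_real mult_ac)
    finally show "exp (- real n * (\<Sum>j\<in>UNIV. \<Phi> (ln (\<beta> j)) (\<tau> j) A)) \<le> \<rho> powr s0" .
    show "0 \<le> (\<Prod>j\<in>UNIV. 160 * \<beta> j / cc j) * \<sigma> powr (- real CARD('d))"
      using cc pos by (intro mult_nonneg_nonneg prod_nonneg) (auto intro: less_imp_le)
    show "0 \<le> (\<Prod>j\<in>UNIV. H j * M j)"
      using Hpos Mpos by (intro prod_nonneg) (auto intro: less_imp_le)
  qed
  finally show ?thesis .
qed

text \<open>The invariant \<kappa> \<sigma>^(s0 - s - d) <= card L trades the loss \<sigma>^(-d) for
  card L times \<sigma>^(-(s0 - s)). This remaining power is cancelled by the surplus \<rho>^(s0 -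
  s), as \<rho> <= 2 \<sigma>, so \<open>K\<close> depends neither on the level nor on the
  cubes.\<close>

lemma cantor_step:
  fixes \<tau> :: "'d \<Rightarrow> real" and \<N> :: "nat set"
  assumes \<tau>: "\<And>j. 0 < \<tau> j" and s: "s < s0" and \<kappa>: "0 < \<kappa>" and inf: "infinite \<N>"
    and s0: "\<forall>A>0. s0 * A \<le> (\<Sum>j\<in>UNIV. \<Phi> (ln (\<beta> j)) (\<tau> j) A)"
  shows "\<exists>K>0. \<forall>L \<sigma> N. cube_family L \<sigma> \<longrightarrow> \<sigma> \<le> 1 / 4 \<longrightarrow>
    \<kappa> * \<sigma> powr (s0 - s - real CARD('d)) \<le> real (card L) \<longrightarrow>
    (\<exists>n\<in>\<N>. N < n \<and> (\<exists>L' \<sigma>' par. refines (hit_set \<beta> f n (\<lambda>j. exp (- real n * \<tau> j))) s K L \<sigma> L' \<sigma>' par \<and>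
       \<kappa> * \<sigma>' powr (s0 - s - real CARD('d)) \<le> real (card L')))"
proof -
  have "\<forall>j. \<exists>c>0. \<forall>a b. 0 \<le> a \<and> a < b \<and> b \<le> 1 \<longrightarrow>
     (\<exists>n0. \<forall>n\<ge>n0. c * (b - a) * \<beta> j ^ n \<le> real (card {z \<in> full_cyl (\<beta> j) n. a \<le> z \<and> z + 1 / \<beta> j ^ n \<le> b}))"
    using full_cyl_count[OF \<beta>] by blast
  from choice[OF this] obtain cc where cc: "\<And>j. 0 < cc j" "\<forall>j a b. 0 \<le> a \<and> a < b \<and> b \<le> 1 \<longrightarrow>
     (\<exists>n0. \<forall>n\<ge>n0. cc j * (b - a) * \<beta> j ^ n \<le> real (card {z \<in> full_cyl (\<beta> j) n. a \<le> z \<and> z + 1 / \<beta> j ^ n \<le> b}))"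
    by blast
  have pos: "0 < \<beta> j ^ k" "0 < \<beta> j" for j k using \<beta>[of j] by auto
  define e where "e = s0 - s"
  have e: "0 < e" using s by (simp add: e_def)
  define D where "D = (\<Prod>j\<in>UNIV. 160 * \<beta> j / cc j)"
  have D: "0 < D" unfolding D_def using cc pos by (intro prod_pos) auto
  define K where "K = 6 ^ CARD('d) * D * 2 powr e / \<kappa>"
  have K: "0 < K" using D \<kappa> by (simp add: K_def)
  have "\<exists>n\<in>\<N>. N < n \<and> (\<exists>L' \<sigma>' par. refines (hit_set \<beta> f n (\<lambda>j. exp (- real n * \<tau> j))) s K L \<sigma> L' \<sigma>' par \<and>
       \<kappa> * \<sigma>' powr (e - real CARD('d)) \<le> real (card L'))"
    if L: "cube_family L \<sigma>" and \<sigma>: "\<sigma> \<le> 1 / 4" and inv: "\<kappa> * \<sigma> powr (e - real CARD('d)) \<le> real (card L)" for L \<sigma> N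
  proof -
    have \<sigma>0: "0 < \<sigma>" using L by (simp add: cube_family_def)
    obtain n where n: "n \<in> \<N>" "N < n" "good_time n" "\<And>j. exp (- real n * \<tau> j) \<le> gap j / 2"
      "\<And>a j. a \<in> L \<Longrightarrow> cc j * \<sigma> * \<beta> j ^ (n - 1) \<le>
       real (card {z \<in> full_cyl (\<beta> j) (n - 1). a $ j \<le> z \<and> z + 1 / \<beta> j ^ (n - 1) \<le> a $ j + \<sigma>})"
    proof -
      have "finite L" "\<And>a j. a \<in> L \<Longrightarrow> 0 \<le> a $ j \<and> a $ j + \<sigma> \<le> 1"
        using L by (auto simp: cube_family_def)
      from refinement_time[where \<tau> = \<tau> and N = N, OF this \<sigma>0 cc(2) \<tau> inf] that
      show ?thesis by blast
    qed
    have n1: "1 \<le> n" using n(3) by (simp add: good_time_def)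
    define p where "p = (\<lambda>j. exp (- real n * \<tau> j))"
    define h where "h = (\<lambda>j. nat \<lceil>cc j * \<sigma> * \<beta> j ^ (n - 1)\<rceil>)"
    define q where "q = (\<Prod>j\<in>UNIV. p j / (8 * \<beta> j ^ n))"
    have ppos: "0 < p j" for j by (simp add: p_def)
    have p_gap: "p j \<le> gap j / 2" for j using n(4) by (simp add: p_def)
    have q: "0 < q" unfolding q_def using ppos pos by (intro prod_pos) auto
    \<comment> \<open>The new side obeys three demands: the sides at least halve, the invariant is
      restored for the new family, and the cubes fit into the targets.\<close>
    define S where "S = {\<sigma> / 2, (q / \<kappa>) powr (1 / e)} \<union> range (\<lambda>j. p j / (8 * \<beta> j ^ n))"
    define \<sigma>' where "\<sigma>' = Min S"
    have finS: "finite S" "S \<noteq> {}" by (auto simp: S_def)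
    have \<sigma>'0: "0 < \<sigma>'"
      unfolding \<sigma>'_def using finS q \<kappa> \<sigma>0 ppos pos by (subst Min_gr_iff) (auto simp: S_def)
    have \<sigma>'_le: "\<sigma>' \<le> \<sigma> / 2" "\<sigma>' \<le> (q / \<kappa>) powr (1 / e)" "\<sigma>' \<le> p j / (8 * \<beta> j ^ n)" for j
      unfolding \<sigma>'_def by (rule Min_le[OF finS(1)], simp add: S_def)+
    have \<sigma>'_p: "\<beta> j ^ n * \<sigma>' \<le> p j / 8" for j
      using \<sigma>'_le(3)[of j] pos[of j] by (simp add: pos_le_divide_eq mult_ac)
    define M where "M = (\<lambda>j. nat \<lfloor>p j / (8 * \<sigma>' * \<beta> j ^ n)\<rfloor> + 1)"
    have hL: "\<forall>a\<in>L. \<forall>j. h j \<le> card {z \<in> full_cyl (\<beta> j) (n - 1). a $ j \<le> z \<and> z + 1 / \<beta> j ^ (n - 1) \<le> a $ j + \<sigma>}"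
      unfolding h_def using n(5) by (simp add: nat_le_iff ceiling_le_iff)
    have h0: "0 < h j" for j unfolding h_def using cc(1) \<sigma>0 pos by simp
    have h_ge: "cc j * \<sigma> * \<beta> j ^ (n - 1) \<le> real (h j)" for j
      unfolding h_def by (rule real_nat_ceiling_ge)
    have M_ge: "p j / (8 * \<sigma>' * \<beta> j ^ n) \<le> real (M j)" for j
      unfolding M_def by linarith
    have M_eq: "M j = nat \<lfloor>p j / (8 * \<sigma>' * \<beta> j ^ n)\<rfloor> + 1" for j by (simp add: M_def)
    obtain L' par where L': "cube_family L' \<sigma>'"
      "\<forall>g\<in>L'. par g \<in> L \<and> cube g \<sigma>' \<subseteq> cube (par g) \<sigma> \<and> cube g \<sigma>' \<subseteq> hit_set \<beta> f n p"
      "\<forall>a\<in>L. card {g \<in> L'. par g = a} = (\<Prod>j\<in>UNIV. h j * M j)"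
      "card L' = card L * (\<Prod>j\<in>UNIV. h j * M j)"
      "\<forall>x \<rho>. \<sigma>' \<le> \<rho> \<and> \<rho> \<le> 2 * \<sigma> \<longrightarrow> real (card {g \<in> L'. \<forall>j. \<bar>g $ j - x $ j\<bar> \<le> \<rho>}) \<le>
       6 ^ CARD('d) * (\<Prod>j\<in>UNIV. (2 * \<rho> * \<beta> j ^ (n - 1) + 2) * min (real (M j)) (5 * \<rho> / \<sigma>'))"
      using refine_cubes[where p = p and H = h and M = M, OF L n(3) ppos p_gap hL h0 \<sigma>'0 \<sigma>'_p M_eq]
      by (elim exE conjE)
    have cardL: "1 \<le> real (card L)" using L by (simp add: cube_family_def card_gt_0_iff Suc_le_eq)
    have "\<kappa> * \<sigma>' powr (e - real CARD('d)) = \<kappa> * \<sigma>' powr e * \<sigma>' powr (- real CARD('d))"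
      by (simp add: powr_add[symmetric])
    also have "\<dots> \<le> q * \<sigma>' powr (- real CARD('d))"
    proof (intro mult_right_mono)
      have "\<sigma>' powr e \<le> ((q / \<kappa>) powr (1 / e)) powr e"
        using \<sigma>'_le(2) \<sigma>'0 e by (intro powr_mono2) auto
      also have "\<dots> = q / \<kappa>" using q \<kappa> e by (simp add: powr_powr)
      finally show "\<kappa> * \<sigma>' powr e \<le> q" using \<kappa> by (simp add: pos_le_divide_eq mult.commute)
    qed simp
    also have "\<dots> = (\<Prod>j\<in>UNIV. p j / (8 * \<sigma>' * \<beta> j ^ n))"
    proof -
      have "\<sigma>' powr (- real CARD('d)) = (\<Prod>j\<in>(UNIV :: 'd set). 1 / \<sigma>')"
        using \<sigma>'0 by (simp add: powr_minus powr_realpow power_one_over inverse_eq_divide)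
      then have "q * \<sigma>' powr (- real CARD('d)) = (\<Prod>j\<in>UNIV. p j / (8 * \<beta> j ^ n) * (1 / \<sigma>'))"
        by (simp only: q_def prod.distrib)
      then show ?thesis by (simp add: mult_ac)
    qed
    also have "\<dots> \<le> (\<Prod>j\<in>UNIV. real (h j * M j))"
    proof (intro prod_mono conjI)
      fix j
      show "0 \<le> p j / (8 * \<sigma>' * \<beta> j ^ n)" using ppos[of j] \<sigma>'0 pos[of j] by (intro divide_nonneg_pos) (auto intro: less_imp_le)
      \<comment> \<open>One cylinder in one parent suffices here: the grid sizes \<open>M j\<close>
        alone restore the invariant when the side is small.\<close>
      have "1 * real (M j) \<le> real (h j) * real (M j)" using h0[of j] by (intro mult_right_mono) auto
      then show "p j / (8 * \<sigma>' * \<beta> j ^ n) \<le> real (h j * M j)" using M_ge[of j] by simp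
    qed
    also have "\<dots> \<le> real (card L) * (\<Prod>j\<in>UNIV. real (h j * M j))"
      using mult_right_mono[OF cardL, of "\<Prod>j\<in>UNIV. real (h j * M j)"] by (simp add: prod_nonneg)
    also have "\<dots> = real (card L')" by (simp add: L'(4))
    finally have inv': "\<kappa> * \<sigma>' powr (e - real CARD('d)) \<le> real (card L')" .
    have count: "real (card {g \<in> L'. \<forall>j. \<bar>g $ j - x $ j\<bar> \<le> \<rho>}) \<le> K * \<rho> powr s * real (card L')"
      if \<rho>: "\<sigma>' \<le> \<rho>" "\<rho> \<le> 2 * \<sigma>" for x \<rho>
    proof -
      have \<rho>0: "0 < \<rho>" using \<rho>(1) \<sigma>'0 by linarith
      define P where "P = (\<Prod>j\<in>UNIV. real (h j) * real (M j))"
      have P0: "0 \<le> P" by (simp add: P_def prod_nonneg)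
      have "real (card {g \<in> L'. \<forall>j. \<bar>g $ j - x $ j\<bar> \<le> \<rho>}) \<le>
          6 ^ CARD('d) * (\<Prod>j\<in>UNIV. (2 * \<rho> * \<beta> j ^ (n - 1) + 2) * min (real (M j)) (5 * \<rho> / \<sigma>'))"
        using L'(5) \<rho> by blast
      also have "\<dots> \<le> 6 ^ CARD('d) * (D * \<sigma> powr (- real CARD('d)) * \<rho> powr s0 * P)"
        unfolding D_def P_def
        using M_ge unfolding p_def
        by (intro mult_left_mono children_count_bound[where \<tau> = \<tau>] n1 \<sigma>0 \<sigma> \<sigma>'0 \<rho> cc(1) \<tau> h_ge s0[rule_format]) auto
      also have "\<dots> \<le> 6 ^ CARD('d) * (D * (real (card L) * \<sigma> powr (- e) / \<kappa>) * \<rho> powr s0 * P)"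
      proof (intro mult_left_mono mult_right_mono)
        have "\<sigma> powr (- real CARD('d)) = \<sigma> powr (e - real CARD('d)) * \<sigma> powr (- e)"
          by (simp add: powr_add[symmetric])
        also have "\<dots> \<le> (real (card L) / \<kappa>) * \<sigma> powr (- e)"
          using inv \<kappa> by (intro mult_right_mono) (auto simp: pos_le_divide_eq mult.commute)
        finally show "\<sigma> powr (- real CARD('d)) \<le> real (card L) * \<sigma> powr (- e) / \<kappa>" by simp
      qed (use D P0 in auto)
      also have "\<dots> = (6 ^ CARD('d) * D / \<kappa>) * (\<sigma> powr (- e) * \<rho> powr e) * \<rho> powr s * (real (card L) * P)"
        by (simp add: e_def powr_diff mult_ac)
      also have "\<dots> \<le> (6 ^ CARD('d) * D / \<kappa>) * 2 powr e * \<rho> powr s * (real (card L) * P)"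
      proof (intro mult_left_mono mult_right_mono)
        have "\<rho> powr e \<le> (2 * \<sigma>) powr e" using \<rho>(2) \<rho>0 e by (intro powr_mono2) auto
        also have "\<dots> = 2 powr e * \<sigma> powr e" using \<sigma>0 by (simp add: powr_mult)
        finally have "\<sigma> powr (- e) * \<rho> powr e \<le> \<sigma> powr (- e) * (2 powr e * \<sigma> powr e)"
          by (intro mult_left_mono) auto
        also have "\<dots> = 2 powr e" using \<sigma>0 by (simp add: powr_minus)
        finally show "\<sigma> powr (- e) * \<rho> powr e \<le> 2 powr e" .
      qed (use D P0 \<kappa> in auto)
      also have "\<dots> = K * \<rho> powr s * real (card L')"
        by (simp add: K_def L'(4) P_def)
      finally show ?thesis .
    qed
    have "refines (hit_set \<beta> f n p) s K L \<sigma> L' \<sigma>' par"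
      unfolding refines_def using L'(1,2) L'(3) \<sigma>'_le(1) count by blast
    then show ?thesis using n(1,2) inv' unfolding p_def by blast
  qed
  then show ?thesis using K unfolding e_def by blast
qed

end

section \<open>Limit sets of nested cube families\<close>

lemma card_fibres:
  assumes "finite L'" "finite S" "\<And>a. a \<in> S \<Longrightarrow> card {g \<in> L'. p g = a} = m"
  shows "card {g \<in> L'. p g \<in> S} = m * card S"
proof -
  have "{g \<in> L'. p g \<in> S} = (\<Union>a\<in>S. {g \<in> L'. p g = a})" by auto
  also have "card \<dots> = (\<Sum>a\<in>S. card {g \<in> L'. p g = a})"
    using assms(1,2) by (intro card_UN_disjoint) auto
  finally show ?thesis using assms(3) by simp
qed

lemma hausdorff_measure_empty: "hausdorff_measure M d s {} = 0"
proof -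
  have "hausdorff_pre M d s \<delta> {} \<le> (\<Sum>k. hausdorff_weight d s ((\<lambda>_. {}) k))" for \<delta>
    unfolding hausdorff_pre_def by (rule INF_lower) auto
  then show ?thesis by (simp add: hausdorff_measure_def hausdorff_weight_def)
qed

lemma hausdorff_measure_zero_cover:
  assumes "hausdorff_measure M d s A = 0" "0 < \<eta>"
  shows "\<exists>U :: nat \<Rightarrow> 'a set. A \<subseteq> (\<Union>k. U k) \<and> (\<forall>k. U k \<subseteq> M \<and> (\<forall>x\<in>U k. \<forall>y\<in>U k. d x y \<le> 1)) \<and>
    (\<Sum>k. hausdorff_weight d s (U k)) < ennreal \<eta>"
proof -
  have "hausdorff_pre M d s 1 A \<le> hausdorff_measure M d s A"
    unfolding hausdorff_measure_def by (rule SUP_upper) simp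
  then have "hausdorff_pre M d s 1 A < ennreal \<eta>" using assms by simp
  then show ?thesis unfolding hausdorff_pre_def INF_less_iff by blast
qed

text \<open>In dimension 0 every nonempty set has weight 1, so a cover of total weight below 1 has
  only empty members.\<close>

lemma hausdorff_measure_zero_dim:
  assumes "hausdorff_measure M d 0 A = 0"
  shows "A = {}"
proof -
  obtain U :: "nat \<Rightarrow> 'a set" where U: "A \<subseteq> (\<Union>k. U k)" "(\<Sum>k. hausdorff_weight d 0 (U k)) < ennreal 1"
    using hausdorff_measure_zero_cover[OF assms zero_less_one] by blast
  have "hausdorff_weight d 0 (U k) < ennreal 1" for k
    using ennreal_suminf_lessD[OF U(2)] .
  then have "U k = {}" for k by (metis ennreal_1 hausdorff_weight_def less_irrefl)
  then show ?thesis using U(1) by simp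
qed

lemma compact_cube: "compact (cube a \<sigma>)"
proof -
  have "cube a \<sigma> = cbox a (\<chi> j. a $ j + \<sigma>)" by (auto simp: cube_def mem_box_cart)
  then show ?thesis by simp
qed

text \<open>The proportion of the cubes of level \<open>k\<close> that meet a given box does not increase with \<open>k\<close>.
  Counting cubes of one sufficiently late level therefore replaces a measure on the limit set.\<close>

lemma cantor_measure_pos:
  fixes L :: "nat \<Rightarrow> (real ^ 'd::finite) set"
  assumes s: "0 < s" and K: "0 < K" and L0: "cube_family (L 0) (\<sigma> 0)"
    and quarter: "\<And>a. a \<in> L 0 \<Longrightarrow> cube a (\<sigma> 0) \<subseteq> {x. \<forall>j. 1 / 4 \<le> x $ j \<and> x $ j \<le> 3 / 4}"
    and ref: "\<And>k. refines (H k) s K (L k) (\<sigma> k) (L (Suc k)) (\<sigma> (Suc k)) (par k)"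
    and W: "(\<Inter>k. H k) \<subseteq> W"
  shows "hausdorff_measure torus torus_dist s W \<noteq> 0"
proof
  assume zero: "hausdorff_measure torus torus_dist s W = 0"
  have fam: "cube_family (L k) (\<sigma> k)" for k
    using L0 ref by (cases k) (auto simp: refines_def)
  have \<sigma>0: "0 < \<sigma> k" and fin: "finite (L k)" and ne: "L k \<noteq> {}" for k
    using fam[of k] by (auto simp: cube_family_def)
  have half: "\<sigma> (Suc k) \<le> \<sigma> k / 2" and parL: "\<And>g. g \<in> L (Suc k) \<Longrightarrow> par k g \<in> L k"
    and parC: "\<And>g. g \<in> L (Suc k) \<Longrightarrow> cube g (\<sigma> (Suc k)) \<subseteq> cube (par k g) (\<sigma> k)"
    and parH: "\<And>g. g \<in> L (Suc k) \<Longrightarrow> cube g (\<sigma> (Suc k)) \<subseteq> H k"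
    and fibre: "\<exists>m. \<forall>a\<in>L k. card {g \<in> L (Suc k). par k g = a} = m"
    and count: "\<And>x \<rho>. \<sigma> (Suc k) \<le> \<rho> \<Longrightarrow> \<rho> \<le> 2 * \<sigma> k \<Longrightarrow>
      real (card {g \<in> L (Suc k). \<forall>j. \<bar>g $ j - x $ j\<bar> \<le> \<rho>}) \<le> K * \<rho> powr s * real (card (L (Suc k)))" for k
    using ref[of k] unfolding refines_def by blast+
  have "\<sigma> k \<le> \<sigma> 0 * (1 / 2) ^ k" for k
  proof (induction k)
    case (Suc k)
    then show ?case using half[of k] by simp
  qed simp
  moreover have "(\<lambda>k. \<sigma> 0 * (1 / 2) ^ k) \<longlonglongrightarrow> \<sigma> 0 * 0"
    by (intro tendsto_intros LIMSEQ_realpow_zero) auto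
  ultimately have small: "\<exists>k. \<sigma> k \<le> \<rho>" if "0 < \<rho>" for \<rho>
    using order_tendstoD(2)[of _ "\<sigma> 0 * 0" sequentially \<rho>] that
    by (metis (no_types, lifting) eventually_sequentially less_imp_le mult_zero_right order_refl order_trans)
  define X where "X = (\<lambda>k. \<Union>a\<in>L k. cube a (\<sigma> k))"
  have X_comp: "compact (X k)" for k unfolding X_def using fin by (intro compact_UN compact_cube)
  have X_Suc: "X (Suc k) \<subseteq> X k" for k unfolding X_def using parL parC by blast
  have X_mono: "X n \<subseteq> X m" if "m \<le> n" for m n using X_Suc that by (rule lift_Suc_antimono_le)
  have X_H: "X (Suc k) \<subseteq> H k" for k unfolding X_def using parH by blast
  have L_X: "L k \<subseteq> X k" for k
  proof
    fix a assume "a \<in> L k"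
    moreover have "a \<in> cube a (\<sigma> k)" using \<sigma>0[of k] by (simp add: cube_def)
    ultimately show "a \<in> X k" unfolding X_def by blast
  qed
  have X_quarter: "\<forall>j. 1 / 4 \<le> x $ j \<and> x $ j \<le> 3 / 4" if "x \<in> X k" for x k
  proof -
    have "x \<in> X 0" using that X_mono[of 0 k] by blast
    then show ?thesis unfolding X_def using quarter by blast
  qed
  define B where "B = (\<lambda>k x \<rho>. {g \<in> L k. \<exists>y\<in>cube g (\<sigma> k). \<forall>j. \<bar>y $ j - x $ j\<bar> \<le> \<rho>})"
  have finB: "finite (B k x \<rho>)" for k x \<rho> using fin by (simp add: B_def)
  \<comment> \<open>The proportions are cross-multiplied. The parent of a cube meeting the box meets
    it too, and all parents have equally many children.\<close>
  have ratio: "card (B m x \<rho>) * card (L k) \<le> card (B k x \<rho>) * card (L m)" if "k \<le> m" for k m x \<rho>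
    using that
  proof (induction m rule: dec_induct)
    case (step m)
    obtain c where c: "\<And>a. a \<in> L m \<Longrightarrow> card {g \<in> L (Suc m). par m g = a} = c" using fibre by blast
    have "{g \<in> L (Suc m). par m g \<in> L m} = L (Suc m)" using parL by auto
    then have cL: "card (L (Suc m)) = c * card (L m)"
      using card_fibres[of "L (Suc m)" "L m" "par m" c] fin c by simp
    have "B (Suc m) x \<rho> \<subseteq> {g \<in> L (Suc m). par m g \<in> B m x \<rho>}"
      using parL parC unfolding B_def by blast
    then have "card (B (Suc m) x \<rho>) \<le> card {g \<in> L (Suc m). par m g \<in> B m x \<rho>}"
      using fin by (intro card_mono) auto
    also have "\<dots> = c * card (B m x \<rho>)"
      using c by (intro card_fibres fin finB) (auto simp: B_def)
    finally have "card (B (Suc m) x \<rho>) * card (L k) \<le> c * (card (B m x \<rho>) * card (L k))" by simp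
    also have "\<dots> \<le> c * (card (B k x \<rho>) * card (L m))" using step by (intro mult_left_mono) auto
    finally show ?case by (simp add: cL mult_ac)
  qed simp
  have mass: "\<exists>k. \<forall>m\<ge>k. real (card (B m x \<rho>)) \<le> K * (2 * \<rho>) powr s * real (card (L m))"
    if \<rho>: "0 < \<rho>" "\<rho> < \<sigma> 0" for x \<rho>
  proof -
    \<comment> \<open>Now \<rho> lies between two successive sides. Cubes of the finer level that
      meet the box have corners within 2 \<rho>, so the counting clause applies at radius 2
      \<rho>.\<close>
    define k where "k = (LEAST k. \<sigma> (Suc k) \<le> \<rho>)"
    obtain k' where "\<sigma> k' \<le> \<rho>" using small[OF \<rho>(1)] by blast
    then obtain k'' where "\<sigma> (Suc k'') \<le> \<rho>" using \<rho>(2) by (cases k') auto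
    then have k1: "\<sigma> (Suc k) \<le> \<rho>" unfolding k_def by (rule LeastI)
    have k2: "\<rho> < \<sigma> k"
    proof (cases k)
      case (Suc i)
      then show ?thesis using not_less_Least[of i "\<lambda>k. \<sigma> (Suc k) \<le> \<rho>"] by (simp add: k_def)
    qed (use \<rho> in simp)
    have "B (Suc k) x \<rho> \<subseteq> {g \<in> L (Suc k). \<forall>j. \<bar>g $ j - x $ j\<bar> \<le> 2 * \<rho>}"
    proof
      fix g assume "g \<in> B (Suc k) x \<rho>"
      then obtain y where y: "g \<in> L (Suc k)" "y \<in> cube g (\<sigma> (Suc k))" "\<And>j. \<bar>y $ j - x $ j\<bar> \<le> \<rho>"
        by (auto simp: B_def)
      have "\<bar>g $ j - x $ j\<bar> \<le> 2 * \<rho>" for j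
      proof -
        have "g $ j \<le> y $ j" "y $ j \<le> g $ j + \<sigma> (Suc k)" using y(2) by (auto simp: cube_def)
        then show ?thesis using y(3)[of j] k1 by linarith
      qed
      then show "g \<in> {g \<in> L (Suc k). \<forall>j. \<bar>g $ j - x $ j\<bar> \<le> 2 * \<rho>}" using y(1) by simp
    qed
    then have "real (card (B (Suc k) x \<rho>)) \<le> real (card {g \<in> L (Suc k). \<forall>j. \<bar>g $ j - x $ j\<bar> \<le> 2 * \<rho>})"
      using fin by (intro of_nat_mono card_mono) auto
    also have "\<dots> \<le> K * (2 * \<rho>) powr s * real (card (L (Suc k)))"
      using count[of k "2 * \<rho>" x] k1 k2 \<rho> by linarith
    finally have base: "real (card (B (Suc k) x \<rho>)) \<le> K * (2 * \<rho>) powr s * real (card (L (Suc k)))" .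
    have "real (card (B m x \<rho>)) \<le> K * (2 * \<rho>) powr s * real (card (L m))" if "Suc k \<le> m" for m
    proof -
      have pos: "0 < real (card (L (Suc k)))" using fin ne by (simp add: card_gt_0_iff)
      have "real (card (B m x \<rho>)) * real (card (L (Suc k))) \<le> real (card (B (Suc k) x \<rho>)) * real (card (L m))"
        using ratio[OF that, of x \<rho>] by (metis of_nat_le_iff of_nat_mult)
      also have "\<dots> \<le> K * (2 * \<rho>) powr s * real (card (L (Suc k))) * real (card (L m))"
        using base by (intro mult_right_mono) auto
      also have "\<dots> = (K * (2 * \<rho>) powr s * real (card (L m))) * real (card (L (Suc k)))" by simp
      finally show ?thesis using pos by (rule mult_right_le_imp_le)
    qed
    then show ?thesis by blast
  qed
  \<comment> \<open>The first bound keeps all radii \<open>r i\<close> below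
    \<open>\<sigma> 0\<close>, as \<open>mass\<close> requires. The second makes the total
    proportion of cubes met at most 1/2.\<close>
  define \<eta> where "\<eta> = min (\<sigma> 0 powr s / 4) (1 / (4 * K * 2 powr s))"
  have \<eta>: "0 < \<eta>" using \<sigma>0[of 0] K by (simp add: \<eta>_def)
  obtain U where U: "W \<subseteq> (\<Union>k. U k)" "\<And>k. \<forall>x\<in>U k. \<forall>y\<in>U k. torus_dist x y \<le> 1"
    "(\<Sum>k. hausdorff_weight torus_dist s (U k)) < ennreal \<eta>"
    using hausdorff_measure_zero_cover[OF zero \<eta>] by blast
  define D where "D = (\<lambda>i. diam_wrt torus_dist (U i))"
  define w where "w = (\<lambda>i. if U i = {} then 0 else D i powr s)"
  \<comment> \<open>The summable surplus makes every radius positive and larger than the diameter,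
    so that the sets can be replaced by open boxes, while the total of the \<open>s\<close>-th
    powers stays below 2 \<eta>.\<close>
  define r where "r = (\<lambda>i. (w i + \<eta> * (1 / 2) ^ Suc i) powr (1 / s))"
  have D: "torus_dist x y \<le> D i" if "x \<in> U i" "y \<in> U i" for x y i
  proof -
    have "bdd_above ((\<lambda>(x, y). torus_dist x y) ` (U i \<times> U i))"
      using U(2)[of i] by (intro bdd_aboveI2[of _ _ 1]) auto
    then have "(\<lambda>(x, y). torus_dist x y) (x, y) \<le> (SUP (x, y)\<in>U i \<times> U i. torus_dist x y)"
      using that by (intro cSUP_upper) auto
    then show ?thesis using that by (auto simp: D_def diam_wrt_def)
  qed
  have w0: "0 \<le> w i" for i by (simp add: w_def)
  have w_weight: "hausdorff_weight torus_dist s (U i) = ennreal (w i)" for i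
    using s by (simp add: hausdorff_weight_def w_def D_def)
  have w_sum: "sum w I < \<eta>" if "finite I" for I
  proof -
    have "ennreal (sum w I) = (\<Sum>i\<in>I. ennreal (w i))" using w0 by (intro sum_ennreal[symmetric])
    also have "\<dots> \<le> (\<Sum>i. ennreal (w i))" using that by (intro sum_le_suminf) auto
    also have "\<dots> < ennreal \<eta>" using U(3) by (simp add: w_weight)
    finally show ?thesis using w0 by (simp add: ennreal_less_iff sum_nonneg)
  qed
  have e0: "0 < w i + \<eta> * (1 / 2) ^ Suc i" for i using w0[of i] \<eta> by (intro add_nonneg_pos) auto
  have r0: "0 < r i" for i using e0[of i] by (simp add: r_def)
  have r_pow: "r i powr s = w i + \<eta> * (1 / 2) ^ Suc i" for i
    using e0[of i] s by (simp add: r_def powr_powr)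
  have r_less: "r i < \<sigma> 0" for i
  proof (rule ccontr)
    assume "\<not> r i < \<sigma> 0"
    then have "\<sigma> 0 powr s \<le> r i powr s" using \<sigma>0[of 0] s by (intro powr_mono2) auto
    moreover have "w i < \<eta>" using w_sum[of "{i}"] by simp
    moreover have "\<eta> * (1 / 2) ^ Suc i \<le> \<eta> * 1" using \<eta> by (intro mult_left_mono power_le_one) auto
    moreover have "\<eta> \<le> \<sigma> 0 powr s / 4" by (simp add: \<eta>_def)
    moreover have "0 < \<sigma> 0 powr s" using \<sigma>0[of 0] by simp
    ultimately show False unfolding r_pow by linarith
  qed
  have D_r: "D i < r i" if "U i \<noteq> {}" for i
  proof (rule ccontr)
    assume "\<not> D i < r i"
    then have "r i powr s \<le> D i powr s" using r0[of i] s by (intro powr_mono2) auto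
    moreover have "0 < \<eta> * (1 / 2) ^ Suc i" using \<eta> by simp
    moreover have "w i = D i powr s" using that by (simp add: w_def)
    ultimately show False unfolding r_pow by linarith
  qed
  define Y where "Y = (\<Inter>k. X k)"
  define u where "u = (\<lambda>i. SOME x. x \<in> U i \<inter> Y)"
  define Q where "Q = (\<lambda>i. if U i \<inter> Y = {} then {} else box (\<chi> j. u i $ j - r i) (\<chi> j. u i $ j + r i))"
  have openQ: "open (Q i)" for i by (simp add: Q_def open_box)
  have memQ: "\<bar>x $ j - u i $ j\<bar> < r i" if "x \<in> Q i" for x i j
    using that by (auto simp: Q_def mem_box_cart abs_less_iff split: if_splits) (smt (verit))+
  have YQ: "Y \<subseteq> (\<Union>i. Q i)"
  proof
    fix x assume x: "x \<in> Y"
    then have "x \<in> H k" for k using X_H[of k] unfolding Y_def by blast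
    then obtain i where i: "x \<in> U i" using W U(1) by blast
    have ui: "u i \<in> U i \<inter> Y" unfolding u_def by (rule someI[of _ x]) (use i x in blast)
    have "\<bar>x $ j - u i $ j\<bar> < r i" for j
    proof -
      have "x \<in> X 0" "u i \<in> X 0" using x ui by (auto simp: Y_def)
      then have "1 / 4 \<le> x $ j" "x $ j \<le> 3 / 4" "1 / 4 \<le> u i $ j" "u i $ j \<le> 3 / 4"
        using X_quarter by blast+
      then have "\<bar>x $ j - u i $ j\<bar> \<le> 1 / 2" by linarith
      then have "\<bar>x $ j - u i $ j\<bar> = circle_dist (x $ j) (u i $ j)" by (rule circle_dist_eq[symmetric])
      also have "\<dots> \<le> torus_dist x (u i)" by (rule circle_dist_nth_le)
      also have "\<dots> \<le> D i" using D i ui by blast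
      also have "\<dots> < r i" using D_r i by blast
      finally show ?thesis .
    qed
    then have "u i $ j - r i < x $ j \<and> x $ j < u i $ j + r i" for j by (smt (verit))
    then have "x \<in> Q i" using ui by (auto simp: Q_def mem_box_cart)
    then show "x \<in> (\<Union>i. Q i)" by blast
  qed
  \<comment> \<open>By compactness an open cover of the limit set already covers some finite level,
    and finitely many boxes then suffice.\<close>
  have "\<exists>k. X k \<subseteq> (\<Union>i. Q i)"
  proof (rule ccontr)
    assume "\<not> ?thesis"
    then have "X k - (\<Union>i. Q i) \<noteq> {}" for k by blast
    moreover have "compact (X k - (\<Union>i. Q i))" for k
      by (intro compact_diff X_comp open_UN ballI openQ)
    moreover have "X n - (\<Union>i. Q i) \<subseteq> X m - (\<Union>i. Q i)" if "m \<le> n" for m n using X_mono[OF that] by blast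
    ultimately have "(\<Inter>k. X k - (\<Union>i. Q i)) \<noteq> {}" by (intro compact_nest) auto
    then show False using YQ by (auto simp: Y_def)
  qed
  then obtain k where k: "X k \<subseteq> (\<Union>i. Q i)" by blast
  obtain I where I: "finite I" "X k \<subseteq> (\<Union>i\<in>I. Q i)"
    using compactE_image[OF X_comp[of k], of UNIV Q] openQ k by (metis)
  have "\<forall>\<^sub>F m in sequentially. real (card (B m (u i) (r i))) \<le> K * (2 * r i) powr s * real (card (L m))" for i
    using mass[OF r0 r_less] unfolding eventually_sequentially by blast
  then have "\<forall>\<^sub>F m in sequentially. k \<le> m \<and>
      (\<forall>i\<in>I. real (card (B m (u i) (r i))) \<le> K * (2 * r i) powr s * real (card (L m)))"
    using I(1) by (intro eventually_conj eventually_ge_at_top eventually_ball_finite) auto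
  then obtain m where m: "k \<le> m"
    "\<And>i. i \<in> I \<Longrightarrow> real (card (B m (u i) (r i))) \<le> K * (2 * r i) powr s * real (card (L m))"
    unfolding eventually_sequentially by blast
  have "L m \<subseteq> (\<Union>i\<in>I. B m (u i) (r i))"
  proof
    fix g assume g: "g \<in> L m"
    then have "g \<in> X k" using L_X[of m] X_mono[OF m(1)] by blast
    then obtain i where i: "i \<in> I" "g \<in> Q i" using I(2) by blast
    have "g \<in> cube g (\<sigma> m)" using \<sigma>0[of m] by (simp add: cube_def)
    moreover have "\<forall>j. \<bar>g $ j - u i $ j\<bar> \<le> r i" using memQ[OF i(2)] by (simp add: less_imp_le)
    ultimately show "g \<in> (\<Union>i\<in>I. B m (u i) (r i))" using i(1) g unfolding B_def by blast
  qed
  then have "card (L m) \<le> card (\<Union>i\<in>I. B m (u i) (r i))" using I(1) finB by (intro card_mono) auto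
  also have "\<dots> \<le> (\<Sum>i\<in>I. card (B m (u i) (r i)))" by (rule card_UN_le[OF I(1)])
  finally have "real (card (L m)) \<le> (\<Sum>i\<in>I. real (card (B m (u i) (r i))))"
    by (simp flip: of_nat_sum)
  also have "\<dots> \<le> (\<Sum>i\<in>I. K * (2 * r i) powr s * real (card (L m)))"
    by (intro sum_mono m(2))
  also have "\<dots> = (K * 2 powr s * (\<Sum>i\<in>I. r i powr s)) * real (card (L m))"
    using r0 by (simp add: powr_mult sum_distrib_left sum_distrib_right mult_ac less_imp_le)
  finally have "1 * real (card (L m)) \<le> (K * 2 powr s * (\<Sum>i\<in>I. r i powr s)) * real (card (L m))" by simp
  moreover have "0 < real (card (L m))" using fin ne by (simp add: card_gt_0_iff)
  ultimately have "1 \<le> K * 2 powr s * (\<Sum>i\<in>I. r i powr s)" by (rule mult_right_le_imp_le)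
  moreover have "(\<Sum>i\<in>I. r i powr s) \<le> 2 * \<eta>"
  proof -
    have "(\<Sum>i\<in>I. (1 / 2 :: real) ^ Suc i) \<le> (\<Sum>i. (1 / 2) ^ Suc i)"
      using I(1) power_half_series by (intro sum_le_suminf) (auto simp: sums_iff)
    also have "\<dots> = 1" using power_half_series by (simp add: sums_iff)
    finally have "\<eta> * (\<Sum>i\<in>I. (1 / 2) ^ Suc i) \<le> \<eta> * 1" using \<eta> by (intro mult_left_mono) auto
    moreover have "(\<Sum>i\<in>I. r i powr s) = sum w I + \<eta> * (\<Sum>i\<in>I. (1 / 2) ^ Suc i)"
      by (simp only: r_pow sum.distrib sum_distrib_left)
    ultimately show ?thesis using w_sum[OF I(1)] by linarith
  qed
  then have "K * 2 powr s * (\<Sum>i\<in>I. r i powr s) \<le> K * 2 powr s * (2 * \<eta>)"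
    using K by (intro mult_left_mono) auto
  moreover have "K * 2 powr s * (2 * \<eta>) \<le> K * 2 powr s * (2 * (1 / (4 * K * 2 powr s)))"
    using K by (intro mult_left_mono) (auto simp: \<eta>_def)
  moreover have "K * 2 powr s * (2 * (1 / (4 * K * 2 powr s))) = 1 / 2" using K by (simp add: field_simps)
  ultimately show False by linarith
qed

section \<open>Lower bound\<close>

context moving_targets
begin

text \<open>Iterating \<open>cantor_step\<close> with strictly increasing times from \<N> produces
  nested families whose limit points are hit at every chosen time, hence infinitely often.\<close>

lemma hausdorff_measure_limsup_hit_set_nonzero:
  fixes \<tau> :: "'d \<Rightarrow> real" and \<N> :: "nat set"
  assumes \<tau>: "\<And>j. 0 < \<tau> j" and s: "0 < s" "s < s0" and inf: "infinite \<N>"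
    and s0: "\<forall>A>0. s0 * A \<le> (\<Sum>j\<in>UNIV. \<Phi> (ln (\<beta> j)) (\<tau> j) A)"
    and W: "{x. infinite {n \<in> \<N>. x \<in> hit_set \<beta> f n (\<lambda>j. exp (- real n * \<tau> j))}} \<subseteq> W"
  shows "hausdorff_measure torus torus_dist s W \<noteq> 0"
proof -
  define h where "h = (\<lambda>n. hit_set \<beta> f n (\<lambda>j. exp (- real n * \<tau> j)))"
  define e where "e = s0 - s - real CARD('d)"
  \<comment> \<open>Chosen so that the invariant of \<open>cantor_step\<close> holds with equality
    for the initial family, a single cube of side 1/4.\<close>
  define \<kappa> :: real where "\<kappa> = (1 / 4) powr (- e)"
  have \<kappa>: "0 < \<kappa>" by (simp add: \<kappa>_def)
  obtain K where K: "0 < K" and step: "\<forall>L \<sigma> N. cube_family L \<sigma> \<longrightarrow> \<sigma> \<le> 1 / 4 \<longrightarrow>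
    \<kappa> * \<sigma> powr e \<le> real (card L) \<longrightarrow>
    (\<exists>n\<in>\<N>. N < n \<and> (\<exists>L' \<sigma>' par. refines (h n) s K L \<sigma> L' \<sigma>' par \<and> \<kappa> * \<sigma>' powr e \<le> real (card L')))"
    using cantor_step[OF \<tau> s(2) \<kappa> inf s0] unfolding h_def e_def by (elim exE conjE)
  define inv where "inv = (\<lambda>(n :: nat, L :: (real ^ 'd) set, \<sigma>, par :: real ^ 'd \<Rightarrow> real ^ 'd).
    cube_family L \<sigma> \<and> \<sigma> \<le> 1 / 4 \<and> \<kappa> * \<sigma> powr e \<le> real (card L))"
  define nxt where "nxt = (\<lambda>(n :: nat, L :: (real ^ 'd) set, \<sigma>, par :: real ^ 'd \<Rightarrow> real ^ 'd) (n', L', \<sigma>', par').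
    n' \<in> \<N> \<and> n < n' \<and> refines (h n') s K L \<sigma> L' \<sigma>' par')"
  define a0 :: "real ^ 'd" where "a0 = (\<chi> j. 1 / 4)"
  define st0 where "st0 = (0 :: nat, {a0}, 1 / 4 :: real, id :: real ^ 'd \<Rightarrow> real ^ 'd)"
  have inv0: "inv st0"
    by (simp add: inv_def st0_def cube_family_def a0_def \<kappa>_def powr_add[symmetric])
  have "\<exists>S. (S 0 = st0 \<and> inv (S 0)) \<and> (\<forall>k. inv (S (Suc k)) \<and> nxt (S k) (S (Suc k)))"
  proof -
    have next_ex: "\<exists>st'. inv st' \<and> nxt st st'" if st: "inv st" for st
    proof -
      obtain n L \<sigma> p where st_eq: "st = (n, L, \<sigma>, p)" by (metis prod_cases4)
      then have i: "cube_family L \<sigma>" "\<sigma> \<le> 1 / 4" "\<kappa> * \<sigma> powr e \<le> real (card L)" using st by (auto simp: inv_def)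
      then obtain n' L' \<sigma>' p' where n': "n' \<in> \<N>" "n < n'" "refines (h n') s K L \<sigma> L' \<sigma>' p'"
        "\<kappa> * \<sigma>' powr e \<le> real (card L')" using step[rule_format, OF i, of n] by blast
      have "cube_family L' \<sigma>'" "\<sigma>' \<le> \<sigma> / 2" using n'(3) by (auto simp: refines_def)
      moreover have "0 < \<sigma>" using i(1) by (simp add: cube_family_def)
      ultimately have "inv (n', L', \<sigma>', p')" using i(2) n'(4) by (simp add: inv_def)
      moreover have "nxt st (n', L', \<sigma>', p')" using n' by (simp add: nxt_def st_eq)
      ultimately show ?thesis by blast
    qed
    define S where "S = rec_nat st0 (\<lambda>_ st. SOME st'. inv st' \<and> nxt st st')"
    have S0: "S 0 = st0" by (simp add: S_def)
    have S_Suc: "S (Suc k) = (SOME st'. inv st' \<and> nxt (S k) st')" for k by (simp add: S_def)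
    have sel: "inv (S (Suc k)) \<and> nxt (S k) (S (Suc k))" if "inv (S k)" for k
      unfolding S_Suc using someI_ex[OF next_ex[OF that]] .
    have "inv (S k)" for k by (induction k) (use S0 inv0 sel in auto)
    then show ?thesis using S0 inv0 sel by metis
  qed
  then obtain S where S: "S 0 = st0" "\<And>k. nxt (S k) (S (Suc k))" by blast
  define ns where "ns = (\<lambda>k. fst (S k))"
  define L where "L = (\<lambda>k. fst (snd (S k)))"
  define \<sigma> where "\<sigma> = (\<lambda>k. fst (snd (snd (S k))))"
  define par where "par = (\<lambda>k. snd (snd (snd (S (Suc k)))))"
  have nx: "ns (Suc k) \<in> \<N> \<and> ns k < ns (Suc k) \<and>
      refines (h (ns (Suc k))) s K (L k) (\<sigma> k) (L (Suc k)) (\<sigma> (Suc k)) (par k)" for k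
    using S(2)[of k] by (simp add: nxt_def ns_def L_def \<sigma>_def par_def case_prod_beta)
  have mono: "strict_mono ns" using nx by (intro strict_monoI_Suc) auto
  show ?thesis
  proof (rule cantor_measure_pos[OF s(1) K, of L \<sigma> "\<lambda>k. h (ns (Suc k))" par])
    show "cube_family (L 0) (\<sigma> 0)" using inv0 S(1) by (simp add: L_def \<sigma>_def inv_def st0_def)
    show "cube a (\<sigma> 0) \<subseteq> {x. \<forall>j. 1 / 4 \<le> x $ j \<and> x $ j \<le> 3 / 4}" if "a \<in> L 0" for a
    proof -
      have "a = a0" "\<sigma> 0 = 1 / 4" using that by (auto simp: L_def \<sigma>_def S(1) st0_def)
      then have "1 / 4 \<le> x $ j \<and> x $ j \<le> 3 / 4" if "x \<in> cube a (\<sigma> 0)" for x j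
        using that by (auto simp: a0_def cube_def dest!: spec[of _ j])
      then show ?thesis by blast
    qed
    show "refines (h (ns (Suc k))) s K (L k) (\<sigma> k) (L (Suc k)) (\<sigma> (Suc k)) (par k)" for k
      using nx by blast
    show "(\<Inter>k. h (ns (Suc k))) \<subseteq> W"
    proof
      fix x assume x: "x \<in> (\<Inter>k. h (ns (Suc k)))"
      have "range (\<lambda>k. ns (Suc k)) \<subseteq> {n \<in> \<N>. x \<in> h n}" using x nx by blast
      moreover have "inj (\<lambda>k. ns (Suc k))"
        using strict_mono_imp_inj_on[OF mono] by (auto simp: inj_on_def)
      then have "infinite (range (\<lambda>k. ns (Suc k)))" by (rule range_inj_infinite)
      ultimately have "infinite {n \<in> \<N>. x \<in> h n}" by (rule infinite_super)
      then show "x \<in> W" using W by (auto simp: h_def)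
    qed
  qed
qed

end

section \<open>The dimension formula\<close>

lemma hausdorff_dim_le:
  assumes "0 \<le> s" "hausdorff_measure M d s A = 0"
  shows "hausdorff_dim M d A \<le> ereal s"
  unfolding hausdorff_dim_def by (rule Inf_lower) (use assms in blast)

text \<open>The infimum also ranges over s = 0, which \<open>pos\<close> does not address. Null
  measure there means an empty set, contradicting nonvanishing at m / 2.\<close>

lemma hausdorff_dim_ge:
  assumes m: "0 < m" and pos: "\<And>s. 0 < s \<Longrightarrow> s < m \<Longrightarrow> hausdorff_measure M d s A \<noteq> 0"
  shows "ereal m \<le> hausdorff_dim M d A"
  unfolding hausdorff_dim_def
proof (rule Inf_greatest, clarify)
  fix s assume s: "0 \<le> s" "hausdorff_measure M d s A = 0"
  have "s \<noteq> 0"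
  proof
    assume "s = 0"
    then have "A = {}" using hausdorff_measure_zero_dim s(2) by blast
    then show False using pos[of "m / 2"] m hausdorff_measure_empty by auto
  qed
  then have "\<not> s < m" using pos[of s] s by auto
  then show "ereal m \<le> ereal s" by simp
qed

context moving_targets
begin

lemma ln_\<beta>_pos: "0 < ln (\<beta> i)"
  using \<beta>[of i] by simp

lemma \<Phi>_sum_pos: "0 < A \<Longrightarrow> 0 < (\<Sum>j\<in>(UNIV :: 'd set). \<Phi> (ln (\<beta> j)) (t j) A)"
  using ln_\<beta>_pos by (intro sum_pos) (auto simp: \<Phi>_def less_max_iff_disj)

lemma lam_pos:
  fixes t :: "real ^ 'd"
  assumes "\<And>i. 0 \<le> t $ i"
  shows "0 < lam \<beta> t i"
proof -
  have "0 < ln (\<beta> i) + t $ i" using ln_\<beta>_pos assms[of i] by (rule add_pos_nonneg)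
  then show ?thesis using lam_eq[OF \<beta> assms] \<Phi>_sum_pos by simp
qed

text \<open>Enlarging the exponents a little makes all of them positive and allows the exact target sizes
  \<open>exp (- n (t j + \<epsilon>))\<close> to be used for infinitely many \<open>n\<close>.\<close>

lemma perturbed_exponents:
  fixes t :: "real ^ 'd"
  assumes t: "\<And>i. 0 \<le> t $ i" and s: "\<And>i. s < lam \<beta> t i"
  shows "\<exists>\<epsilon>>0. \<exists>s0>s. \<forall>A>0. s0 * A \<le> (\<Sum>j\<in>UNIV. \<Phi> (ln (\<beta> j)) (t $ j + \<epsilon>) A)"
proof -
  define q where "q = (\<lambda>\<epsilon> i. (\<Sum>j\<in>UNIV. \<Phi> (ln (\<beta> j)) (t $ j + \<epsilon>) (ln (\<beta> i) + (t $ i + \<epsilon>))) / (ln (\<beta> i) + (t $ i + \<epsilon>)))"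
  have Ai: "0 < ln (\<beta> i) + t $ i" for i using ln_\<beta>_pos t[of i] by (rule add_pos_nonneg)
  have "((\<lambda>\<epsilon>. q \<epsilon> i) \<longlongrightarrow> q 0 i) (at_right 0)" for i
    unfolding q_def using Ai[of i] by (intro tendsto_intros) auto
  moreover have "s < q 0 i" for i using s[of i] lam_eq[OF \<beta> t] by (simp add: q_def)
  ultimately have "\<forall>\<^sub>F \<epsilon> in at_right 0. s < q \<epsilon> i" for i by (rule order_tendstoD(1))
  then have "\<forall>\<^sub>F \<epsilon> in at_right 0. (\<forall>i. s < q \<epsilon> i) \<and> 0 < \<epsilon>"
    by (intro eventually_conj eventually_all_finite eventually_at_right_less)
  then obtain \<epsilon> where \<epsilon>: "\<And>i. s < q \<epsilon> i" "0 < \<epsilon>"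
    using eventually_happens'[OF trivial_limit_at_right_real] by blast
  \<comment> \<open>The smallest ratio over the finitely many critical scales;
    \<open>\<Phi>_sum_minimum\<close> extends the bound to every \<open>A\<close>.\<close>
  define s0 where "s0 = Min (range (q \<epsilon>))"
  have "s < s0" unfolding s0_def using \<epsilon>(1) by simp
  moreover have "s0 * A \<le> (\<Sum>j\<in>UNIV. \<Phi> (ln (\<beta> j)) (t $ j + \<epsilon>) A)" if A: "0 < A" for A
  proof -
    have "0 < ln (\<beta> i)" "0 < t $ i + \<epsilon>" for i using ln_\<beta>_pos t[of i] \<epsilon>(2) by auto
    then obtain i where i: "(\<Sum>j\<in>UNIV. \<Phi> (ln (\<beta> j)) (t $ j + \<epsilon>) (ln (\<beta> i) + (t $ i + \<epsilon>))) * A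
        \<le> (\<Sum>j\<in>UNIV. \<Phi> (ln (\<beta> j)) (t $ j + \<epsilon>) A) * (ln (\<beta> i) + (t $ i + \<epsilon>))"
      using \<Phi>_sum_minimum[of "\<lambda>i. ln (\<beta> i)" "\<lambda>i. t $ i + \<epsilon>" A] A by blast
    have pos: "0 < ln (\<beta> i) + (t $ i + \<epsilon>)" using Ai[of i] \<epsilon>(2) by linarith
    have "s0 \<le> q \<epsilon> i" unfolding s0_def by simp
    then have "s0 * A \<le> q \<epsilon> i * A" using A by simp
    also have "\<dots> \<le> (\<Sum>j\<in>UNIV. \<Phi> (ln (\<beta> j)) (t $ j + \<epsilon>) A)"
      using i pos by (simp add: q_def pos_divide_le_eq)
    finally show ?thesis .
  qed
  ultimately show ?thesis using \<epsilon>(2) by blast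
qed

end

lemma W_set_eq:
  fixes T :: "real ^ 'd ^ 'd::finite"
  assumes "\<forall>i j. T $ i $ j = (if i = j then \<beta> i else 0)"
  shows "W_set T \<Psi> f = {x. infinite {n. 1 \<le> n \<and> x \<in> hit_set \<beta> f n (\<lambda>i. \<Psi> n $ i)}}"
proof -
  have "(torus_map T ^^ n) x \<in> target_box (f n x) (\<Psi> n) \<longleftrightarrow> x \<in> hit_set \<beta> f n (\<lambda>i. \<Psi> n $ i)"
    if x: "x \<in> torus" for n x
    using x btrans_funpow_range[of _ n]
    by (auto simp: target_box_def hit_set_def torus_map_funpow[OF assms] torus_def)
  moreover have "x \<in> torus" if inf: "infinite {n. 1 \<le> n \<and> x \<in> hit_set \<beta> f n (\<lambda>i. \<Psi> n $ i)}" for x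
  proof -
    obtain n where "x \<in> hit_set \<beta> f n (\<lambda>i. \<Psi> n $ i)" using not_finite_existsD[OF inf] by blast
    then show ?thesis by (simp add: hit_set_def)
  qed
  ultimately show ?thesis unfolding W_set_def by (auto cong: conj_cong)
qed

theorem theorem1p2:
  fixes T :: "real ^ ('d :: {finite, linorder}) ^ ('d :: {finite, linorder})"
    and \<beta> :: "('d :: {finite, linorder}) \<Rightarrow> real"
    and f :: "nat \<Rightarrow> real ^ ('d :: {finite, linorder}) \<Rightarrow> real ^ ('d :: {finite, linorder})"
    and \<Psi> :: "nat \<Rightarrow> real ^ ('d :: {finite, linorder})"
  assumes nonsingular: "invertible T"
    and diagonal: "\<forall>i j. T $ i $ j = (if i = j then \<beta> i else 0)"
    and expanding: "\<forall>i. 1 < \<beta> i"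
    and ordered: "\<forall>i j. i \<le> j \<longrightarrow> \<beta> i \<le> \<beta> j"
    and f_torus: "\<forall>n\<ge>1. f n \<in> torus \<rightarrow> torus"
    and f_lipschitz: "\<exists>c>0. \<forall>n\<ge>1. \<forall>x\<in>torus. \<forall>y\<in>torus.
                        torus_dist (f n x) (f n y) \<le> c * torus_dist x y"
    and \<Psi>_pos: "\<forall>n\<ge>1. \<forall>i. 0 < \<Psi> n $ i"
    and C_bounded: "\<exists>B. bounded B \<and> C_set \<Psi> \<subseteq> ereal_vec ` B"
    and C_nonneg: "\<forall>t\<in>C_set \<Psi>. \<forall>i. 0 \<le> t $ i"
  shows "hausdorff_dim torus torus_dist (W_set T \<Psi> f) =
           (SUP t \<in> {t. ereal_vec t \<in> C_set \<Psi>}. ereal (MIN i. lam \<beta> t i))"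
proof -
  obtain c where c: "0 < c" "\<And>n x y. 1 \<le> n \<Longrightarrow> x \<in> torus \<Longrightarrow> y \<in> torus \<Longrightarrow>
      torus_dist (f n x) (f n y) \<le> c * torus_dist x y"
    using f_lipschitz by blast
  interpret moving_targets \<beta> f c
    using expanding c by unfold_locales auto
  define \<tau> where "\<tau> = (\<lambda>n. \<chi> i. - ln (\<Psi> n $ i) / real n)"
  have \<Psi>: "\<Psi> n $ i = exp (- real n * \<tau> n $ i)" if "1 \<le> n" for n i
    using that \<Psi>_pos by (simp add: \<tau>_def)
  have C_set: "C_set \<Psi> = {l. \<exists>r. strict_mono r \<and> (\<lambda>n. ereal_vec (\<tau> (r n))) \<longlonglongrightarrow> l}"
    by (simp add: C_set_def accumulation_points_def \<tau>_def)
  have C_real: "\<exists>t. l = ereal_vec t \<and> (\<forall>i. 0 \<le> t $ i)" if l: "l \<in> C_set \<Psi>" for l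
  proof -
    obtain t where t: "l = ereal_vec t" using C_bounded l by blast
    have "0 \<le> t $ i" for i using C_nonneg l unfolding t by (auto simp: ereal_vec_def dest!: bspec spec[of _ i])
    then show ?thesis using t by blast
  qed
  define S where "S = (SUP t \<in> {t. ereal_vec t \<in> C_set \<Psi>}. ereal (MIN i. lam \<beta> t i))"
  have S_upper: "ereal (MIN i. lam \<beta> t i) \<le> S" if "ereal_vec t \<in> C_set \<Psi>" for t
    unfolding S_def using that by (intro SUP_upper) simp
  have nonneg: "0 \<le> t $ i" if "ereal_vec t \<in> C_set \<Psi>" for t i
    using bspec[OF C_nonneg that] by (simp add: ereal_vec_def)
  have min_pos: "0 < (MIN i. lam \<beta> t i)" if "ereal_vec t \<in> C_set \<Psi>" for t
    using lam_pos[OF nonneg[OF that]] by (simp add: Min_gr_iff)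
  \<comment> \<open>Existence by compactness keeps the supremum from being taken over the empty set.
    It is therefore positive, and the upper bound only meets exponents s > 0.\<close>
  obtain t0 where t0: "ereal_vec t0 \<in> C_set \<Psi>"
  proof -
    obtain l r where "strict_mono r" "(\<lambda>n. ereal_vec (\<tau> (r n))) \<longlonglongrightarrow> l"
      using ereal_vec_convergent_subsequence[of "\<lambda>n. ereal_vec (\<tau> n)"] by blast
    then have "l \<in> C_set \<Psi>" unfolding C_set by blast
    then show ?thesis using C_real that by blast
  qed
  have "hausdorff_dim torus torus_dist (W_set T \<Psi> f) \<le> S"
  proof (rule dense_ge)
    fix x assume x: "S < x"
    have "0 < S" using S_upper[OF t0] min_pos[OF t0] by (metis ereal_less(2) less_le_trans)
    show "hausdorff_dim torus torus_dist (W_set T \<Psi> f) \<le> x"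
    proof (cases x)
      case (real s)
      then have s: "0 < s" using x \<open>0 < S\<close> by (metis ereal_less(2) less_trans)
      \<comment> \<open>Every critical scale \<open>ln (\<beta> i) + t $ i\<close> is at least
        \<open>a0\<close>, so the optimal scales stay away from 0 uniformly in
        \<open>t\<close>.\<close>
      define a0 where "a0 = (MIN i. ln (\<beta> i))"
      have a0: "0 < a0" unfolding a0_def using ln_\<beta>_pos by simp
      have "hausdorff_measure torus torus_dist s (W_set T \<Psi> f) = 0"
      proof (rule hausdorff_measure_limsup_hit_set_zero[OF s a0, of \<tau>])
        fix l r assume "strict_mono r" "(\<lambda>n. ereal_vec (\<tau> (r n))) \<longlonglongrightarrow> l"
        then have l: "l \<in> C_set \<Psi>" unfolding C_set by blast
        then obtain t where t: "l = ereal_vec t" "\<And>i. 0 \<le> t $ i" using C_real by blast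
        have "(MIN i. lam \<beta> t i) \<in> range (lam \<beta> t)" by (intro Min_in) auto
        then obtain i where i: "(MIN i. lam \<beta> t i) = lam \<beta> t i" by blast
        have "ereal (lam \<beta> t i) < ereal s"
          using le_less_trans[OF S_upper[OF l[unfolded t(1)]] x] unfolding i real .
        then have less: "lam \<beta> t i < s" by simp
        define A where "A = ln (\<beta> i) + t $ i"
        have "a0 \<le> ln (\<beta> i)" unfolding a0_def by simp
        then have A: "a0 \<le> A" "0 < A" using t(2)[of i] a0 unfolding A_def by linarith+
        have "(\<Sum>j\<in>UNIV. \<Phi> (ln (\<beta> j)) (t $ j) A) = lam \<beta> t i * A"
          using lam_eq[OF \<beta> t(2), where i = i] A(2) by (simp add: A_def)
        also have "\<dots> < s * A" using less A by simp
        finally show "\<exists>t A. l = ereal_vec t \<and> a0 \<le> A \<and> (\<Sum>i\<in>UNIV. \<Phi> (ln (\<beta> i)) (t $ i) A) < s * A"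
          using t(1) A(1) by blast
      next
        show "W_set T \<Psi> f \<subseteq> {x. infinite {n. x \<in> hit_set \<beta> f n (\<lambda>i. exp (- real n * \<tau> n $ i))}}"
        proof
          fix x assume "x \<in> W_set T \<Psi> f"
          then have "infinite {n. 1 \<le> n \<and> x \<in> hit_set \<beta> f n (\<lambda>i. \<Psi> n $ i)}"
            unfolding W_set_eq[OF diagonal] by blast
          moreover have "{n. 1 \<le> n \<and> x \<in> hit_set \<beta> f n (\<lambda>i. \<Psi> n $ i)}
              \<subseteq> {n. x \<in> hit_set \<beta> f n (\<lambda>i. exp (- real n * \<tau> n $ i))}"
            using \<Psi> by auto
          ultimately show "x \<in> {x. infinite {n. x \<in> hit_set \<beta> f n (\<lambda>i. exp (- real n * \<tau> n $ i))}}"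
            using infinite_super by blast
        qed
      qed
      then show ?thesis using hausdorff_dim_le[of s] s real by simp
    qed (use x in auto)
  qed
  moreover have "ereal (MIN i. lam \<beta> t i) \<le> hausdorff_dim torus torus_dist (W_set T \<Psi> f)"
    if t: "ereal_vec t \<in> C_set \<Psi>" for t
  proof (rule hausdorff_dim_ge[OF min_pos[OF t]])
    fix s assume s: "0 < s" "s < (MIN i. lam \<beta> t i)"
    then have "s < lam \<beta> t i" for i by (simp add: Min_gr_iff)
    then obtain \<epsilon> s0 where \<epsilon>: "0 < \<epsilon>" "s < s0"
      "\<forall>A>0. s0 * A \<le> (\<Sum>j\<in>UNIV. \<Phi> (ln (\<beta> j)) (t $ j + \<epsilon>) A)"
      using perturbed_exponents[OF nonneg[OF t]] by blast
    \<comment> \<open>At these times the box with exact exponents \<open>t $ i + \<epsilon>\<close>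
      fits into the target given by \<open>\<Psi> n\<close>. There are infinitely many of them
      because \<open>t\<close> is an accumulation point.\<close>
    define \<N> where "\<N> = {n. 1 \<le> n \<and> (\<forall>i. \<tau> n $ i \<le> t $ i + \<epsilon>)}"
    obtain r where r: "strict_mono r" "(\<lambda>n. ereal_vec (\<tau> (r n))) \<longlonglongrightarrow> ereal_vec t"
      using t unfolding C_set by blast
    have "\<forall>\<^sub>F k in sequentially. \<tau> (r k) $ i < t $ i + \<epsilon>" for i
      using r(2) \<epsilon>(1) unfolding tendsto_ereal_vec_iff by (intro order_tendstoD(2)) auto
    then have "\<forall>\<^sub>F k in sequentially. (\<forall>i. \<tau> (r k) $ i < t $ i + \<epsilon>) \<and> 1 \<le> k"
      by (intro eventually_conj eventually_all_finite eventually_ge_at_top)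
    then obtain k0 where k0: "\<And>k. k \<ge> k0 \<Longrightarrow> (\<forall>i. \<tau> (r k) $ i < t $ i + \<epsilon>) \<and> 1 \<le> k"
      unfolding eventually_sequentially by blast
    have "r ` {k0..} \<subseteq> \<N>"
    proof
      fix n assume "n \<in> r ` {k0..}"
      then obtain k where k: "n = r k" "k \<ge> k0" by auto
      then have "1 \<le> n" using k0[OF k(2)] seq_suble[OF r(1), of k] by linarith
      then show "n \<in> \<N>" using k0[OF k(2)] k(1) by (auto simp: \<N>_def less_imp_le)
    qed
    moreover have "infinite (r ` {k0..})"
      using strict_mono_imp_inj_on[OF r(1)] infinite_Ici[of k0] finite_imageD inj_on_subset by blast
    ultimately have inf: "infinite \<N>" by (rule infinite_super)
    have hit_mono: "hit_set \<beta> f n (\<lambda>j. exp (- real n * (t $ j + \<epsilon>))) \<subseteq> hit_set \<beta> f n (\<lambda>i. \<Psi> n $ i)"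
      if n: "n \<in> \<N>" for n
    proof -
      have "exp (- real n * (t $ i + \<epsilon>)) \<le> \<Psi> n $ i" for i
        using n by (simp add: \<N>_def \<Psi> mult_left_mono)
      then show ?thesis unfolding hit_set_def by (auto intro: less_le_trans)
    qed
    show "hausdorff_measure torus torus_dist s (W_set T \<Psi> f) \<noteq> 0"
    proof (rule hausdorff_measure_limsup_hit_set_nonzero[OF _ s(1) \<epsilon>(2) inf \<epsilon>(3)])
      show "0 < t $ j + \<epsilon>" for j using nonneg[OF t, of j] \<epsilon>(1) by linarith
      show "{x. infinite {n \<in> \<N>. x \<in> hit_set \<beta> f n (\<lambda>j. exp (- real n * (t $ j + \<epsilon>)))}} \<subseteq> W_set T \<Psi> f"
      proof
        fix x assume "x \<in> {x. infinite {n \<in> \<N>. x \<in> hit_set \<beta> f n (\<lambda>j. exp (- real n * (t $ j + \<epsilon>)))}}"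
        moreover have "{n \<in> \<N>. x \<in> hit_set \<beta> f n (\<lambda>j. exp (- real n * (t $ j + \<epsilon>)))}
            \<subseteq> {n. 1 \<le> n \<and> x \<in> hit_set \<beta> f n (\<lambda>i. \<Psi> n $ i)}"
          using hit_mono by (auto simp: \<N>_def)
        ultimately show "x \<in> W_set T \<Psi> f"
          unfolding W_set_eq[OF diagonal] using infinite_super by blast
      qed
    qed
  qed
  then have "S \<le> hausdorff_dim torus torus_dist (W_set T \<Psi> f)"
    unfolding S_def by (intro SUP_least) simp
  ultimately show ?thesis unfolding S_def by (rule antisym)
qed

end
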